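(* Let $G$ be a finite group and $\Bbbk$ a field. Suppose $\Gamma\in\mathcal{RK}$ gives rise to a closed surface $\Sigma_\Gamma^{\mathrm{cl}}$ of genus $g$ and that the involutive Hopf bimodule $(M,\psi)$ over $\Bbbk G$ is induced by a pair in involution $(p,\chi)$. There is a linear isomorphism $$\mathrm{Prot}_{\Bbbk G}^M(\Gamma,\Bbbk_\varepsilon^1)\cong{}^{p^{2g}}(\Omega_g)\big/\big((\ker\chi^{-2g})\bullet{}^{p^{2g}}(\Omega_g)\big).$$ In case $|G|$ is invertible in $\Bbbk$ this simplifies to $$\mathrm{Prot}_{\Bbbk G}^M(\Gamma,\Bbbk_\varepsilon^1)\cong\{f\in{}^{p^{2g}}(\Omega_g)\mid h\bullet f=\chi^{-2g}(h)f\text{ for all }h\in G\}.$$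
   Context: **Notation.** $H:=\Bbbk G$, $\otimes=\otimes_\Bbbk$. $\mathrm{Gr}(H)=G$; $\mathrm{Gr}(H^* )$ is the group of characters (algebra maps $H\to\Bbbk$) under convolution; powers $\chi^n$ are in this group; $\ker\chi^{-2g}\subset\Bbbk G$ is the kernel of the algebra map $\chi^{-2g}$. A pair in involution is $(p,\chi)\in\mathrm{Gr}(H)\times\mathrm{Gr}(H^* )$ with $S^2(h)=\chi^{-1}(h_{(1)})\chi(h_{(3)})ph_{(2)}p^{-1}$ for all $h$ (for $\Bbbk G$: $p$ central). The involutive Hopf bimodule induced by $(p,\chi)$ (and a square root $\zeta\in\Bbbk$ of $\chi(p)$, assumed to exist) is $M=H$ with $g\triangleright m\triangleleft h=\chi^{-1}(h_{(2)})gmh_{(1)}$, $m_{[-1]}\otimes m_{[0]}\otimes m_{[1]}=m_{(1)}\otimes m_{(2)}\otimes m_{(3)}p$, and involution $\psi(m)=\zeta\chi(m_{(1)})p^{-1}S(m_{(2)})$. **$\Omega_g$.** If $g=0$, $\varpi_1(\Sigma_g^{\mathrm{cl}}):=\mathbb Z$ and $x=1$. If $g\ge1$, $\varpi_1(\Sigma_g^{\mathrm{cl}})$ is the group with generators $\alpha_1,\beta_1,\dots,\alpha_g,\beta_g,x$ and relations $[\beta_g,\alpha_g^{-1}]\cdots[\beta_1,\alpha_1^{-1}]=x$ and $x$ commutes with all $\alpha_i,\beta_i$; $[a,b]=aba^{-1}b^{-1}$. $\Omega_g=\mathrm{span}_\Bbbk\mathrm{Hom}_{\mathrm{Grp}}(\varpi_1(\Sigma_g^{\mathrm{cl}}),G)$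 is a left-left Yetter--Drinfeld module over $\Bbbk G$ via $\delta(f)=f(x)\otimes f$, $(h\bullet f)(y)=hf(y)h^{-1}$. For $q\in G$, ${}^q(\Omega_g)=\{f\mid\delta(f)=q\otimes f\}$. **Kitaev graphs.** A ribbon graph $(\Gamma,\iota,\rho)$ is a finite set $\Gamma$ of half-edges with a fixed-point free involution $\iota$ and a permutation $\rho$. Vertices $V_\Gamma$, edges $E_\Gamma$, faces $F_\Gamma$ are the cycles (including those of length one) of $\rho$, $\iota$, $\rho^{-1}\iota$; $v_h,e_h,f_h$ are the ones containing $h\in\Gamma$. It is connected if $\langle\iota,\rho\rangle$ acts transitively. A Kitaev graph is a connected ribbon graph with a subset $C_\Gamma\subset\Gamma$ of cilia such that $C_\Gamma\to V_\Gamma$, $c\mapsto v_c$, and $C_\Gamma\to F_\Gamma$, $c\mapsto f_{\rho^{-1}(c)}$, are bijective, a distinguished cilium $\mathrm{pt}\in C_\Gamma$, and a total order on $\Gamma$ such that for $e_h\ne e_k$: $h<k$ iff $\iota(h)<\iota(k)$. The source of an edge $\{h,\iota(h)\}$ is $s=\min\{h,\iota(h)\}$, its target is $\iota(s)$. $\mathcal{RK}$ is the set of Kitaev graphs whose half-edges form a finite subset of $\mathbb N=\{1,2,\dots\}$ stable under $\kappa_\infty=(1\,2)(3\,4)\cdots$, with $\iota$ the restriction of $\kappa_\infty$ and order inherited from $\mathbb N$. $\Sigma_\Gamma$ is the compact oriented surface obtained from oriented discs (one per vertex, with disjoint boundary intervals labelled counterclockwise by its half-edges in cyclic order) by gluing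 a rectangle along its short sides to the intervals $h,\iota(h)$ for each edge, compatibly with orientations; $\Sigma_\Gamma^{\mathrm{cl}}$ is obtained by gluing a disc to each boundary component. Its genus is $1-\tfrac12(|V_\Gamma|-|E_\Gamma|+|F_\Gamma|)$. **Extended Hilbert space.** $\mathbb M_\Gamma=\bigotimes_{e\in E_\Gamma}M$. For a half-edge $h$, $a\in H$, $\alpha\in H^*$, $L_h(a),T_h(\alpha)$ are the identity on all factors except that of $e_h$, where $L_h(a)m=a\triangleright m$ if $h$ is a target, $m\triangleleft S(a)$ if $h$ is a source; $T_h(\alpha)m=\alpha(m_{[-1]})m_{[0]}$ if $h$ is a source, $\alpha(S(m_{[1]}))m_{[0]}$ if $h$ is a target. For a cilium $c$ let $v_c=[h_1,\dots,h_i]$ with $h_1=c$, $h_{r+1}=\rho(h_r)$, and $f_{\rho^{-1}(c)}=[k_1,\dots,k_j]$ with $k_1=\rho^{-1}(c)$, $k_{r+1}=\rho^{-1}\iota(k_r)$. $H_c=H$ acts by $a\bullet_cm=L_{h_i}(a_{(i)})\cdots L_{h_1}(a_{(1)})m$ and coacts by $\delta_c$ with $(\alpha\otimes\mathrm{id})\delta_c(m)=T_{k_j}(\alpha_{(1)})\cdots T_{k_1}(\alpha_{(j)})m$. These commute for different cilia and make $\mathbb M_\Gamma$ a left-left Yetter--Drinfeld module over $\mathbb H_\Gamma=\bigotimes_{c\in C_\Gamma}H_c$. **Protected space.** For a right-right module-comodule $X$ and left-left module-comodule $N$ over an algebra $A$ and coalgebra $C$ (no compatibility), $\mathrm{Bit}_A^C(X,N)$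 is the image of $X\square_CN\hookrightarrow X\otimes N\twoheadrightarrow X\otimes_AN$. $\Bbbk^q_\zeta$ is $\Bbbk$ with right action $\lambda h=\zeta(h)\lambda$ and right coaction $\lambda\mapsto\lambda\otimes q$. $\mathrm{Prot}_H^M(\Gamma,X)=\mathrm{Bit}_{\mathbb H_\Gamma}^{\mathbb H_\Gamma}(\mathbb X_\Gamma,\mathbb M_\Gamma)$ with $\mathbb X_\Gamma=\bigotimes_{c\in C_\Gamma}Z_c$, $Z_{\mathrm{pt}}=X$, $Z_c=\Bbbk^{p^{-2}}_{\chi^2}$ for $c\ne\mathrm{pt}$, with factorwise structure. *)

theory Defs
  imports
    "HOL-Algebra.Module"
    "HOL-Algebra.Elementary_Groups"
    "HOL-Combinatorics.Combinatorics"
    "HOL-Library.Function_Algebras"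
    "HOL-Library.Set_Algebras"
begin

section \<open>Vector spaces with a chosen basis\<close>

text \<open>
  The vector space with basis \<open>B\<close> over a field \<open>'k\<close> consists of the finitely supported functions
  \<open>B \<rightarrow> 'k\<close>, extended by zero to the whole type. Tensor products are taken on bases: the space with
  basis \<open>B \<times> C\<close> is the tensor product of those with bases \<open>B\<close> and \<open>C\<close>, and the space with basis
  \<open>PiE I B\<close> is the tensor product over a finite set \<open>I\<close> of the spaces with bases \<open>B i\<close>.
\<close>

definition free_vs :: "'b set \<Rightarrow> ('b \<Rightarrow> 'k::field) set" where
  "free_vs B = {v. finite {x. v x \<noteq> 0} \<and> {x. v x \<noteq> 0} \<subseteq> B}"

definition fscale :: "'k::field \<Rightarrow> ('b \<Rightarrow> 'k) \<Rightarrow> 'b \<Rightarrow> 'k" where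
  "fscale c v = (\<lambda>x. c * v x)"

interpretation fv: vector_space fscale
  by standard (auto simp: fscale_def fun_eq_iff algebra_simps)

definition single :: "'b \<Rightarrow> 'b \<Rightarrow> 'k::field" where
  "single x = (\<lambda>y. if y = x then 1 else 0)"

definition lin_form :: "('b \<Rightarrow> 'k) \<Rightarrow> ('b \<Rightarrow> 'k) \<Rightarrow> 'k::field" where
  "lin_form \<phi> v = (\<Sum>x | v x \<noteq> 0. v x * \<phi> x)"

definition lin_ext :: "('b \<Rightarrow> 'c \<Rightarrow> 'k) \<Rightarrow> ('b \<Rightarrow> 'k) \<Rightarrow> 'c \<Rightarrow> 'k::field" where
  "lin_ext \<phi> v = (\<lambda>y. lin_form (\<lambda>x. \<phi> x y) v)"

definition tensor :: "('b \<Rightarrow> 'k) \<Rightarrow> ('c \<Rightarrow> 'k) \<Rightarrow> 'b \<times> 'c \<Rightarrow> 'k::field" where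
  "tensor v w = (\<lambda>(x, y). v x * w y)"

text \<open>
  \<open>on_factor i t\<close> is a linear map \<open>t\<close> applied to the tensor factor with index \<open>i\<close> and the identity on
  all other factors.
\<close>

definition on_factor ::
    "'i \<Rightarrow> (('b \<Rightarrow> 'k) \<Rightarrow> 'b \<Rightarrow> 'k) \<Rightarrow> (('i \<Rightarrow> 'b) \<Rightarrow> 'k) \<Rightarrow> ('i \<Rightarrow> 'b) \<Rightarrow> 'k::field" where
  "on_factor i t m = (\<lambda>\<gamma>. t (\<lambda>x. m (\<gamma>(i := x))) (\<gamma> i))"

text \<open>
  \<open>quot_image V W\<close> is the image of the subspace \<open>V\<close> under the projection from the ambient space to its
  quotient by \<open>W\<close>; for \<open>W \<subseteq> V\<close> this is \<open>V / W\<close>. The unused ring operations of the record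
  \<open>module\<close> are left undefined.
\<close>

definition subspace_vs :: "('b \<Rightarrow> 'k) set \<Rightarrow> ('k::field, 'b \<Rightarrow> 'k) module" where
  "subspace_vs V = \<lparr>carrier = V, monoid.mult = undefined, monoid.one = undefined,
     ring.zero = 0, ring.add = (+), smult = fscale\<rparr>"

definition quot_image ::
    "('b \<Rightarrow> 'k) set \<Rightarrow> ('b \<Rightarrow> 'k) set \<Rightarrow> ('k::field, ('b \<Rightarrow> 'k) set) module" where
  "quot_image V W = \<lparr>carrier = (\<lambda>v. v +o W) ` V, monoid.mult = undefined, monoid.one = undefined,
     ring.zero = W, ring.add = (+), smult = (\<lambda>c A. \<Union>v\<in>A. fscale c v +o W)\<rparr>"

definition linearly_isomorphic :: "('k::field, 'v) module \<Rightarrow> ('k, 'w) module \<Rightarrow> bool" where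
  "linearly_isomorphic V W \<longleftrightarrow> (\<exists>\<Phi>. bij_betw \<Phi> (carrier V) (carrier W)
     \<and> (\<forall>x\<in>carrier V. \<forall>y\<in>carrier V. \<Phi> (add V x y) = add W (\<Phi> x) (\<Phi> y))
     \<and> (\<forall>c. \<forall>x\<in>carrier V. \<Phi> (smult V c x) = smult W c (\<Phi> x)))"


section \<open>The Hopf algebra of a group and its characters\<close>

text \<open>
  The elements of \<open>G\<close> are group-like, so \<open>h\<^sub>(\<^sub>1\<^sub>) \<otimes> \<dots> \<otimes> h\<^sub>(\<^sub>n\<^sub>)\<close> is the sum of the \<open>h x\<close> times
  \<open>x \<otimes> \<dots> \<otimes> x\<close>. A multilinear expression in \<open>h\<^sub>(\<^sub>1\<^sub>), \<dots>, h\<^sub>(\<^sub>n\<^sub>)\<close> is therefore the linear extension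
  (\<open>lin_ext\<close> or \<open>lin_form\<close>) in \<open>h\<close> of the expression in which each \<open>h\<^sub>(\<^sub>r\<^sub>)\<close> is replaced by the
  same basis element \<open>x\<close>. All uses of Sweedler notation below are expanded in this way.
\<close>

abbreviation grp_alg :: "('a, 'b) monoid_scheme \<Rightarrow> ('a \<Rightarrow> 'k::field) set" where
  "grp_alg G \<equiv> free_vs (carrier G)"

definition kmult :: "('a, 'b) monoid_scheme \<Rightarrow> ('a \<Rightarrow> 'k) \<Rightarrow> ('a \<Rightarrow> 'k) \<Rightarrow> 'a \<Rightarrow> 'k::field" where
  "kmult G a b = lin_ext (\<lambda>x. lin_ext (\<lambda>y. single (x \<otimes>\<^bsub>G\<^esub> y)) b) a"

definition antipode :: "('a, 'b) monoid_scheme \<Rightarrow> ('a \<Rightarrow> 'k) \<Rightarrow> 'a \<Rightarrow> 'k::field" where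
  "antipode G = lin_ext (\<lambda>x. single (inv\<^bsub>G\<^esub> x))"

definition counit :: "('a, 'b) monoid_scheme \<Rightarrow> ('a \<Rightarrow> 'k) \<Rightarrow> 'k::field" where
  "counit G = restrict (lin_form (\<lambda>x. 1)) (grp_alg G)"

definition algebra_maps :: "('a, 'b) monoid_scheme \<Rightarrow> (('a \<Rightarrow> 'k::field) \<Rightarrow> 'k) set" where
  "algebra_maps G = {\<alpha> \<in> extensional (grp_alg G).
     (\<forall>a\<in>grp_alg G. \<forall>b\<in>grp_alg G. \<alpha> (a + b) = \<alpha> a + \<alpha> b) \<and>
     (\<forall>c. \<forall>a\<in>grp_alg G. \<alpha> (fscale c a) = c * \<alpha> a) \<and>
     (\<forall>a\<in>grp_alg G. \<forall>b\<in>grp_alg G. \<alpha> (kmult G a b) = \<alpha> a * \<alpha> b) \<and>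
     \<alpha> (single \<one>\<^bsub>G\<^esub>) = 1}"

definition char_group :: "('a, 'b) monoid_scheme \<Rightarrow> (('a \<Rightarrow> 'k::field) \<Rightarrow> 'k) monoid" where
  "char_group G = \<lparr>carrier = algebra_maps G,
     monoid.mult = (\<lambda>\<alpha> \<beta>. restrict (lin_form (\<lambda>x. \<alpha> (single x) * \<beta> (single x))) (grp_alg G)),
     monoid.one = counit G\<rparr>"

definition pair_in_involution ::
    "('a, 'b) monoid_scheme \<Rightarrow> 'a \<Rightarrow> (('a \<Rightarrow> 'k::field) \<Rightarrow> 'k) \<Rightarrow> bool" where
  "pair_in_involution G p \<chi> \<longleftrightarrow> p \<in> carrier G \<and> \<chi> \<in> carrier (char_group G) \<and>
     (\<forall>h\<in>grp_alg G. antipode G (antipode G h) =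
        lin_ext (\<lambda>x. fscale ((inv\<^bsub>char_group G\<^esub> \<chi>) (single x) * \<chi> (single x))
          (kmult G (kmult G (single p) (single x)) (single (inv\<^bsub>G\<^esub> p)))) h)"

text \<open>
  An involutive Hopf bimodule with underlying space \<open>grp_alg G\<close>. The two-sided coaction
  \<open>bi_coact M m\<close> is \<open>m\<^sub>[\<^sub>-\<^sub>1\<^sub>] \<otimes> m\<^sub>[\<^sub>0\<^sub>] \<otimes> m\<^sub>[\<^sub>1\<^sub>]\<close>.
\<close>

record ('a, 'k) hopf_bimodule =
  bi_lact :: "('a \<Rightarrow> 'k) \<Rightarrow> ('a \<Rightarrow> 'k) \<Rightarrow> 'a \<Rightarrow> 'k"
  bi_ract :: "('a \<Rightarrow> 'k) \<Rightarrow> ('a \<Rightarrow> 'k) \<Rightarrow> 'a \<Rightarrow> 'k"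
  bi_coact :: "('a \<Rightarrow> 'k) \<Rightarrow> 'a \<times> 'a \<times> 'a \<Rightarrow> 'k"
  bi_inv :: "('a \<Rightarrow> 'k) \<Rightarrow> 'a \<Rightarrow> 'k"

definition induced_bimodule ::
    "('a, 'b) monoid_scheme \<Rightarrow> 'a \<Rightarrow> (('a \<Rightarrow> 'k::field) \<Rightarrow> 'k) \<Rightarrow> 'k \<Rightarrow> ('a, 'k) hopf_bimodule" where
  "induced_bimodule G p \<chi> \<zeta> = \<lparr>
     bi_lact = (\<lambda>h m. kmult G h m),
     bi_ract = (\<lambda>m h. lin_ext
       (\<lambda>x. fscale ((inv\<^bsub>char_group G\<^esub> \<chi>) (single x)) (kmult G m (single x))) h),
     bi_coact = lin_ext (\<lambda>x. tensor (single x) (tensor (single x) (kmult G (single x) (single p)))),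
     bi_inv = lin_ext (\<lambda>x. fscale (\<zeta> * \<chi> (single x))
       (kmult G (single (inv\<^bsub>G\<^esub> p)) (antipode G (single x))))\<rparr>"


section \<open>Kitaev graphs\<close>

text \<open>
  The total order of the half-edges is the order of their type. As \<open>\<iota>\<close> and \<open>\<rho>\<close> are permutations
  in the sense of \<open>permutes\<close>, they are the identity outside the set of half-edges.
\<close>

record 'h ciliated_graph =
  halfedges :: "'h set"
  iota :: "'h \<Rightarrow> 'h"
  rho :: "'h \<Rightarrow> 'h"
  cilia :: "'h set"
  pt :: "'h"

definition face_perm :: "('h, 'z) ciliated_graph_scheme \<Rightarrow> 'h \<Rightarrow> 'h" where
  "face_perm \<Gamma> = inv_into UNIV (rho \<Gamma>) \<circ> iota \<Gamma>"

definition vertex_of :: "('h, 'z) ciliated_graph_scheme \<Rightarrow> 'h \<Rightarrow> 'h set" where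
  "vertex_of \<Gamma> h = orbit (rho \<Gamma>) h"

definition edge_of :: "('h, 'z) ciliated_graph_scheme \<Rightarrow> 'h \<Rightarrow> 'h set" where
  "edge_of \<Gamma> h = orbit (iota \<Gamma>) h"

definition face_of :: "('h, 'z) ciliated_graph_scheme \<Rightarrow> 'h \<Rightarrow> 'h set" where
  "face_of \<Gamma> h = orbit (face_perm \<Gamma>) h"

definition vertices :: "('h, 'z) ciliated_graph_scheme \<Rightarrow> 'h set set" where
  "vertices \<Gamma> = vertex_of \<Gamma> ` halfedges \<Gamma>"

definition edges :: "('h, 'z) ciliated_graph_scheme \<Rightarrow> 'h set set" where
  "edges \<Gamma> = edge_of \<Gamma> ` halfedges \<Gamma>"

definition faces :: "('h, 'z) ciliated_graph_scheme \<Rightarrow> 'h set set" where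
  "faces \<Gamma> = face_of \<Gamma> ` halfedges \<Gamma>"

definition ribbon_graph :: "('h, 'z) ciliated_graph_scheme \<Rightarrow> bool" where
  "ribbon_graph \<Gamma> \<longleftrightarrow> finite (halfedges \<Gamma>) \<and>
     iota \<Gamma> permutes halfedges \<Gamma> \<and> rho \<Gamma> permutes halfedges \<Gamma> \<and>
     (\<forall>h\<in>halfedges \<Gamma>. iota \<Gamma> (iota \<Gamma> h) = h \<and> iota \<Gamma> h \<noteq> h)"

definition connected_graph :: "('h, 'z) ciliated_graph_scheme \<Rightarrow> bool" where
  "connected_graph \<Gamma> \<longleftrightarrow> (let r = {(h, iota \<Gamma> h) | h. True} \<union> {(h, rho \<Gamma> h) | h. True} in
     \<forall>h\<in>halfedges \<Gamma>. \<forall>k\<in>halfedges \<Gamma>. (h, k) \<in> (r \<union> converse r)\<^sup>*)"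

definition kitaev_graph :: "('h::linorder, 'z) ciliated_graph_scheme \<Rightarrow> bool" where
  "kitaev_graph \<Gamma> \<longleftrightarrow> ribbon_graph \<Gamma> \<and> connected_graph \<Gamma> \<and> cilia \<Gamma> \<subseteq> halfedges \<Gamma> \<and>
     bij_betw (vertex_of \<Gamma>) (cilia \<Gamma>) (vertices \<Gamma>) \<and>
     bij_betw (\<lambda>c. face_of \<Gamma> (inv_into UNIV (rho \<Gamma>) c)) (cilia \<Gamma>) (faces \<Gamma>) \<and>
     pt \<Gamma> \<in> cilia \<Gamma> \<and>
     (\<forall>h\<in>halfedges \<Gamma>. \<forall>k\<in>halfedges \<Gamma>. edge_of \<Gamma> h \<noteq> edge_of \<Gamma> k \<longrightarrow>
        (h < k \<longleftrightarrow> iota \<Gamma> h < iota \<Gamma> k))"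

definition is_source :: "('h::linorder, 'z) ciliated_graph_scheme \<Rightarrow> 'h \<Rightarrow> bool" where
  "is_source \<Gamma> h \<longleftrightarrow> h = min h (iota \<Gamma> h)"

text \<open>The genus of the closed surface of \<open>\<Gamma>\<close>, computed from its Euler characteristic.\<close>

definition genus :: "('h, 'z) ciliated_graph_scheme \<Rightarrow> rat" where
  "genus \<Gamma> = 1 - (1 / 2) *
     (of_nat (card (vertices \<Gamma>)) - of_nat (card (edges \<Gamma>)) + of_nat (card (faces \<Gamma>)))"

definition kappa_infty :: "nat \<Rightarrow> nat" where
  "kappa_infty n = (if odd n then n + 1 else n - 1)"

definition RK :: "nat ciliated_graph set" where
  "RK = {\<Gamma>. kitaev_graph \<Gamma> \<and> halfedges \<Gamma> \<subseteq> {1..} \<and>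
     kappa_infty ` halfedges \<Gamma> \<subseteq> halfedges \<Gamma> \<and>
     (\<forall>h\<in>halfedges \<Gamma>. iota \<Gamma> h = kappa_infty h)}"


section \<open>Module-comodules and bitensor products\<close>

text \<open>
  In the following two records the algebra and the coalgebra are spaces with bases of type \<open>'c\<close>.
\<close>

record ('n, 'c, 'k) left_modcomod =
  lbasis :: "'n set"
  lact :: "('c \<Rightarrow> 'k) \<Rightarrow> ('n \<Rightarrow> 'k) \<Rightarrow> 'n \<Rightarrow> 'k"
  lcoact :: "('n \<Rightarrow> 'k) \<Rightarrow> 'c \<times> 'n \<Rightarrow> 'k"

record ('x, 'c, 'k) right_modcomod =
  rbasis :: "'x set"
  ract :: "('x \<Rightarrow> 'k) \<Rightarrow> ('c \<Rightarrow> 'k) \<Rightarrow> 'x \<Rightarrow> 'k"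
  rcoact :: "('x \<Rightarrow> 'k) \<Rightarrow> 'x \<times> 'c \<Rightarrow> 'k"

definition cotensor ::
    "('x, 'c, 'k) right_modcomod \<Rightarrow> ('n, 'c, 'k::field) left_modcomod \<Rightarrow> ('x \<times> 'n \<Rightarrow> 'k) set" where
  "cotensor X N = {t \<in> free_vs (rbasis X \<times> lbasis N). \<forall>u c n.
     rcoact X (\<lambda>u'. t (u', n)) (u, c) = lcoact N (\<lambda>n'. t (u, n')) (c, n)}"

definition tensor_relations ::
    "'c set \<Rightarrow> ('x, 'c, 'k) right_modcomod \<Rightarrow> ('n, 'c, 'k::field) left_modcomod \<Rightarrow>
     ('x \<times> 'n \<Rightarrow> 'k) set" where
  "tensor_relations A X N = fv.span {tensor (ract X x a) n - tensor x (lact N a n) | x a n.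
     x \<in> free_vs (rbasis X) \<and> a \<in> free_vs A \<and> n \<in> free_vs (lbasis N)}"

definition Bit ::
    "'c set \<Rightarrow> ('x, 'c, 'k) right_modcomod \<Rightarrow> ('n, 'c, 'k::field) left_modcomod \<Rightarrow>
     ('k, ('x \<times> 'n \<Rightarrow> 'k) set) module" where
  "Bit A X N = quot_image (cotensor X N) (tensor_relations A X N)"

text \<open>
  The module-comodule given by the field itself, a character \<open>\<zeta>\<close> and a group-like \<open>q\<close>. Any one-element
  set can serve as its basis.
\<close>

definition one_dim :: "(('c \<Rightarrow> 'k) \<Rightarrow> 'k) \<Rightarrow> 'c \<Rightarrow> ('x, 'c, 'k::field) right_modcomod" where
  "one_dim \<zeta> q = \<lparr>rbasis = {undefined}, ract = (\<lambda>v h. fscale (\<zeta> h) v),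
     rcoact = (\<lambda>v. tensor v (single q))\<rparr>"


section \<open>The extended Hilbert space\<close>

definition half_act ::
    "('a, 'b) monoid_scheme \<Rightarrow> ('a, 'k::field) hopf_bimodule \<Rightarrow> ('h::linorder, 'z) ciliated_graph_scheme \<Rightarrow>
     'h \<Rightarrow> ('a \<Rightarrow> 'k) \<Rightarrow> (('h set \<Rightarrow> 'a) \<Rightarrow> 'k) \<Rightarrow> ('h set \<Rightarrow> 'a) \<Rightarrow> 'k" where
  "half_act G M \<Gamma> h a = on_factor (edge_of \<Gamma> h)
     (\<lambda>m. if is_source \<Gamma> h then bi_ract M m (antipode G a) else bi_lact M a m)"

text \<open>
  The one-sided coactions on \<open>M\<close> are recovered from the two-sided one by applying the counit to the
  remaining outer factor.
\<close>

definition half_coact ::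
    "('a, 'b) monoid_scheme \<Rightarrow> ('a, 'k::field) hopf_bimodule \<Rightarrow> ('h::linorder, 'z) ciliated_graph_scheme \<Rightarrow>
     'h \<Rightarrow> (('a \<Rightarrow> 'k) \<Rightarrow> 'k) \<Rightarrow> (('h set \<Rightarrow> 'a) \<Rightarrow> 'k) \<Rightarrow> ('h set \<Rightarrow> 'a) \<Rightarrow> 'k" where
  "half_coact G M \<Gamma> h \<alpha> = on_factor (edge_of \<Gamma> h) (\<lambda>m. lin_ext (\<lambda>(x, y, z). fscale
     (if is_source \<Gamma> h then \<alpha> (single x) * counit G (single z)
      else counit G (single x) * \<alpha> (antipode G (single z))) (single y)) (bi_coact M m))"

text \<open>
  Both families of operators are applied along a cyclically ordered vertex or face, read as the list
  \<open>support \<pi> h = [h, \<pi> h, \<pi> (\<pi> h), \<dots>]\<close>; \<open>fold\<close> applies the operator of the first entry first.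
\<close>

definition cilium_act ::
    "('a, 'b) monoid_scheme \<Rightarrow> ('a, 'k::field) hopf_bimodule \<Rightarrow> ('h::linorder, 'z) ciliated_graph_scheme \<Rightarrow>
     'h \<Rightarrow> ('a \<Rightarrow> 'k) \<Rightarrow> (('h set \<Rightarrow> 'a) \<Rightarrow> 'k) \<Rightarrow> ('h set \<Rightarrow> 'a) \<Rightarrow> 'k" where
  "cilium_act G M \<Gamma> c a m =
     lin_ext (\<lambda>x. fold (\<lambda>h. half_act G M \<Gamma> h (single x)) (support (rho \<Gamma>) c) m) a"

text \<open>
  The comultiplication of the dual of the group algebra is dual to multiplication, so
  \<open>\<alpha>\<^sub>(\<^sub>1\<^sub>) \<otimes> \<dots> \<otimes> \<alpha>\<^sub>(\<^sub>j\<^sub>)\<close> is the sum over all lists \<open>[x\<^sub>1, \<dots>, x\<^sub>j]\<close> of elements of \<open>G\<close> of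
  \<open>\<alpha> (x\<^sub>1 \<cdots> x\<^sub>j)\<close> times the tensor product of the dual basis vectors \<open>\<lambda>a. a x\<^sub>r\<close>. Hence
  \<open>holonomy G M \<Gamma> c \<alpha>\<close> is \<open>T\<^sub>k\<^sub>j (\<alpha>\<^sub>(\<^sub>1\<^sub>)) \<cdots> T\<^sub>k\<^sub>1 (\<alpha>\<^sub>(\<^sub>j\<^sub>))\<close>, where \<open>k\<^sub>1\<close> receives the last
  entry of the list.
\<close>

definition holonomy ::
    "('a, 'b) monoid_scheme \<Rightarrow> ('a, 'k::field) hopf_bimodule \<Rightarrow> ('h::linorder, 'z) ciliated_graph_scheme \<Rightarrow>
     'h \<Rightarrow> (('a \<Rightarrow> 'k) \<Rightarrow> 'k) \<Rightarrow> (('h set \<Rightarrow> 'a) \<Rightarrow> 'k) \<Rightarrow> ('h set \<Rightarrow> 'a) \<Rightarrow> 'k" where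
  "holonomy G M \<Gamma> c \<alpha> m = (let ks = support (face_perm \<Gamma>) (inv_into UNIV (rho \<Gamma>) c) in
     \<Sum>xs | length xs = length ks \<and> set xs \<subseteq> carrier G.
       fscale (\<alpha> (single (foldr (\<otimes>\<^bsub>G\<^esub>) xs \<one>\<^bsub>G\<^esub>)))
         (fold (\<lambda>(k, x). half_coact G M \<Gamma> k (\<lambda>a. a x)) (zip ks (rev xs)) m))"

text \<open>
  \<open>cilium_coact\<close> is the coaction \<open>\<delta>\<^sub>c\<close> with \<open>(\<alpha> \<otimes> id) (\<delta>\<^sub>c m) = holonomy G M \<Gamma> c \<alpha> m\<close> for all
  \<open>\<alpha>\<close>; its coefficients in the first factor are found by taking dual basis vectors for \<open>\<alpha>\<close>.
\<close>

definition cilium_coact ::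
    "('a, 'b) monoid_scheme \<Rightarrow> ('a, 'k::field) hopf_bimodule \<Rightarrow> ('h::linorder, 'z) ciliated_graph_scheme \<Rightarrow>
     'h \<Rightarrow> (('h set \<Rightarrow> 'a) \<Rightarrow> 'k) \<Rightarrow> 'a \<times> ('h set \<Rightarrow> 'a) \<Rightarrow> 'k" where
  "cilium_coact G M \<Gamma> c m =
     (\<lambda>(x, \<gamma>). if x \<in> carrier G then holonomy G M \<Gamma> c (\<lambda>a. a x) m \<gamma> else 0)"

text \<open>The basis of the tensor product of one copy of \<open>grp_alg G\<close> for each cilium.\<close>

definition cilia_basis :: "('a, 'b) monoid_scheme \<Rightarrow> ('h, 'z) ciliated_graph_scheme \<Rightarrow> ('h \<Rightarrow> 'a) set" where
  "cilia_basis G \<Gamma> = cilia \<Gamma> \<rightarrow>\<^sub>E carrier G"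

text \<open>
  The structures of the individual cilia commute, so the order in which they are composed is
  immaterial. The value at \<open>\<kappa>\<close> of the combined coaction is obtained by extracting from the coaction of
  each cilium \<open>c\<close> the coefficient of the group element \<open>\<kappa> c\<close>.
\<close>

definition ext_hilbert ::
    "('a, 'b) monoid_scheme \<Rightarrow> ('a, 'k::field) hopf_bimodule \<Rightarrow> ('h::linorder, 'z) ciliated_graph_scheme \<Rightarrow>
     ('h set \<Rightarrow> 'a, 'h \<Rightarrow> 'a, 'k) left_modcomod" where
  "ext_hilbert G M \<Gamma> = \<lparr>lbasis = edges \<Gamma> \<rightarrow>\<^sub>E carrier G,
     lact = (\<lambda>b m. lin_ext (\<lambda>\<kappa>. fold (\<lambda>c. cilium_act G M \<Gamma> c (single (\<kappa> c)))
        (sorted_list_of_set (cilia \<Gamma>)) m) b),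
     lcoact = (\<lambda>m (\<kappa>, \<gamma>). if \<kappa> \<in> cilia_basis G \<Gamma> then
        fold (\<lambda>c m' \<gamma>'. cilium_coact G M \<Gamma> c m' (\<kappa> c, \<gamma>')) (sorted_list_of_set (cilia \<Gamma>)) m \<gamma>
        else 0)\<rparr>"


section \<open>The protected space\<close>

definition cilia_tensor ::
    "('a, 'b) monoid_scheme \<Rightarrow> ('h::linorder, 'z) ciliated_graph_scheme \<Rightarrow>
     ('h \<Rightarrow> ('x, 'a, 'k::field) right_modcomod) \<Rightarrow> ('h \<Rightarrow> 'x, 'h \<Rightarrow> 'a, 'k) right_modcomod" where
  "cilia_tensor G \<Gamma> Z = \<lparr>rbasis = (\<Pi>\<^sub>E c\<in>cilia \<Gamma>. rbasis (Z c)),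
     ract = (\<lambda>v b. lin_ext (\<lambda>\<kappa>. fold (\<lambda>c. on_factor c (\<lambda>w. ract (Z c) w (single (\<kappa> c))))
        (sorted_list_of_set (cilia \<Gamma>)) v) b),
     rcoact = (\<lambda>v (u, \<kappa>). if \<kappa> \<in> cilia_basis G \<Gamma> then
        fold (\<lambda>c. on_factor c (\<lambda>w y. rcoact (Z c) w (y, \<kappa> c))) (sorted_list_of_set (cilia \<Gamma>)) v u
        else 0)\<rparr>"

definition Prot ::
    "('a, 'b) monoid_scheme \<Rightarrow> 'a \<Rightarrow> (('a \<Rightarrow> 'k::field) \<Rightarrow> 'k) \<Rightarrow> ('a, 'k) hopf_bimodule \<Rightarrow>
     ('h::linorder, 'z) ciliated_graph_scheme \<Rightarrow> ('x, 'a, 'k) right_modcomod \<Rightarrow>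
     ('k, (('h \<Rightarrow> 'x) \<times> ('h set \<Rightarrow> 'a) \<Rightarrow> 'k) set) module" where
  "Prot G p \<chi> M \<Gamma> X = Bit (cilia_basis G \<Gamma>)
     (cilia_tensor G \<Gamma> (\<lambda>c. if c = pt \<Gamma> then X
        else one_dim (\<chi> [^]\<^bsub>char_group G\<^esub> (2::int)) (p [^]\<^bsub>G\<^esub> (-2::int))))
     (ext_hilbert G M \<Gamma>)"


section \<open>Group presentations and the extended surface group\<close>

text \<open>
  A word is a list of letters \<open>(x, b)\<close>; this letter stands for the generator \<open>x\<close> if \<open>b\<close> is true and
  for its inverse otherwise. A relation is a pair of words.
\<close>

type_synonym 'x word = "('x \<times> bool) list"

definition words :: "'x set \<Rightarrow> 'x word set" where
  "words X = lists (X \<times> UNIV)"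

inductive pres_eq :: "'x set \<Rightarrow> ('x word \<times> 'x word) set \<Rightarrow> 'x word \<Rightarrow> 'x word \<Rightarrow> bool"
  for X R where
  refl: "w \<in> words X \<Longrightarrow> pres_eq X R w w"
| sym: "pres_eq X R u v \<Longrightarrow> pres_eq X R v u"
| trans: "pres_eq X R u v \<Longrightarrow> pres_eq X R v w \<Longrightarrow> pres_eq X R u w"
| cancel: "u \<in> words X \<Longrightarrow> v \<in> words X \<Longrightarrow> x \<in> X \<Longrightarrow>
    pres_eq X R (u @ [(x, b), (x, \<not> b)] @ v) (u @ v)"
| rel: "u \<in> words X \<Longrightarrow> v \<in> words X \<Longrightarrow> (l, r) \<in> R \<Longrightarrow> l \<in> words X \<Longrightarrow> r \<in> words X \<Longrightarrow>
    pres_eq X R (u @ l @ v) (u @ r @ v)"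

definition word_class :: "'x set \<Rightarrow> ('x word \<times> 'x word) set \<Rightarrow> 'x word \<Rightarrow> 'x word set" where
  "word_class X R u = {v. pres_eq X R u v}"

definition presented_group :: "'x set \<Rightarrow> ('x word \<times> 'x word) set \<Rightarrow> 'x word set monoid" where
  "presented_group X R = \<lparr>carrier = word_class X R ` words X,
     monoid.mult = (\<lambda>A B. \<Union>u\<in>A. \<Union>v\<in>B. word_class X R (u @ v)),
     monoid.one = word_class X R []\<rparr>"

datatype surf_gen = Alpha nat | Beta nat | Xi

definition surf_gens :: "nat \<Rightarrow> surf_gen set" where
  "surf_gens g = insert Xi (Alpha ` {1..g} \<union> Beta ` {1..g})"

text \<open>The word \<open>[\<beta>\<^sub>g, \<alpha>\<^sub>g\<^sup>-\<^sup>1] \<cdots> [\<beta>\<^sub>1, \<alpha>\<^sub>1\<^sup>-\<^sup>1]\<close>.\<close>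

definition surf_word :: "nat \<Rightarrow> surf_gen word" where
  "surf_word g = concat (map
     (\<lambda>i. [(Beta i, True), (Alpha i, False), (Beta i, False), (Alpha i, True)]) (rev [1..<g + 1]))"

text \<open>
  For \<open>g = 0\<close> there are no relations, which yields the infinite cyclic group generated by \<open>Xi\<close>
  (see \<open>surface_group_0\<close> below).
\<close>

definition surf_rels :: "nat \<Rightarrow> (surf_gen word \<times> surf_gen word) set" where
  "surf_rels g = (if g = 0 then {} else
     insert (surf_word g, [(Xi, True)])
       {([(Xi, True), (y, True)], [(y, True), (Xi, True)]) | y. y \<in> Alpha ` {1..g} \<union> Beta ` {1..g}})"

definition surface_group :: "nat \<Rightarrow> surf_gen word set monoid" where
  "surface_group g = presented_group (surf_gens g) (surf_rels g)"

definition surface_x :: "nat \<Rightarrow> surf_gen word set" where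
  "surface_x g = word_class (surf_gens g) (surf_rels g) [(Xi, True)]"

lemma pres_eq_words: "pres_eq X R u v \<Longrightarrow> u \<in> words X \<and> v \<in> words X"
  by (induction rule: pres_eq.induct) (auto simp: words_def)

lemma pres_eq_context:
  assumes "pres_eq X R u v" "s \<in> words X" "t \<in> words X"
  shows "pres_eq X R (s @ u @ t) (s @ v @ t)"
  using assms
proof (induction rule: pres_eq.induct)
  case (refl w)
  then show ?case by (intro pres_eq.refl) (auto simp: words_def)
next
  case (sym u v)
  then show ?case by (blast intro: pres_eq.sym)
next
  case (trans u v w)
  then show ?case by (blast intro: pres_eq.trans)
next
  case (cancel u v x b)
  then have "s @ u \<in> words X" "v @ t \<in> words X" by (auto simp: words_def)
  from pres_eq.cancel[OF this cancel.hyps(3), of R b] show ?case by simp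
next
  case (rel u v l r)
  then have "s @ u \<in> words X" "v @ t \<in> words X" by (auto simp: words_def)
  from pres_eq.rel[OF this rel.hyps(3-5)] show ?case by simp
qed

lemma pres_eq_append:
  assumes "pres_eq X R u u'" "pres_eq X R v v'"
  shows "pres_eq X R (u @ v) (u' @ v')"
proof -
  have w: "u' \<in> words X" "v \<in> words X" "[] \<in> words X"
    using pres_eq_words[OF assms(1)] pres_eq_words[OF assms(2)] by (simp_all add: words_def)
  show ?thesis
    using pres_eq_context[OF assms(1) w(3) w(2)] pres_eq_context[OF assms(2) w(1) w(3)]
    by (auto intro: pres_eq.trans)
qed

lemma word_class_eq_iff:
  assumes "u \<in> words X"
  shows "word_class X R u = word_class X R v \<longleftrightarrow> pres_eq X R u v"
  using assms by (auto simp: word_class_def intro: pres_eq.intros)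

lemma presented_group_mult:
  assumes "u \<in> words X" "v \<in> words X"
  shows "word_class X R u \<otimes>\<^bsub>presented_group X R\<^esub> word_class X R v = word_class X R (u @ v)"
proof -
  have "word_class X R (u' @ v') = word_class X R (u @ v)"
    if "u' \<in> word_class X R u" "v' \<in> word_class X R v" for u' v'
  proof -
    have "pres_eq X R (u @ v) (u' @ v')"
      using that by (simp add: word_class_def pres_eq_append)
    then show ?thesis
      using pres_eq_words word_class_eq_iff by metis
  qed
  moreover have "u \<in> word_class X R u" "v \<in> word_class X R v"
    using assms by (auto simp: word_class_def intro: pres_eq.refl)
  ultimately have "(\<Union>u'\<in>word_class X R u. \<Union>v'\<in>word_class X R v. word_class X R (u' @ v'))
      = word_class X R (u @ v)" by blast
  then show ?thesis by (simp add: presented_group_def)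
qed

lemma words_append: "u \<in> words X \<Longrightarrow> v \<in> words X \<Longrightarrow> u @ v \<in> words X"
  by (auto simp: words_def)

lemma word_left_inverse:
  assumes "w \<in> words X"
  shows "\<exists>v\<in>words X. pres_eq X R (v @ w) []"
  using assms
proof (induction w)
  case Nil
  then show ?case by (intro bexI[of _ "[]"]) (auto intro: pres_eq.refl simp: words_def)
next
  case (Cons a w)
  obtain x b where a: "a = (x, b)" by force
  from Cons.prems have x: "x \<in> X" and w: "w \<in> words X" by (auto simp: words_def a)
  from Cons.IH[OF w] obtain v where v: "v \<in> words X" "pres_eq X R (v @ w) []" by blast
  have "pres_eq X R (v @ [(x, \<not> b), (x, \<not> \<not> b)] @ w) (v @ w)"
    by (rule pres_eq.cancel[OF v(1) w x])
  then have "pres_eq X R ((v @ [(x, \<not> b)]) @ a # w) []"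
    using v(2) by (auto simp: a intro: pres_eq.trans)
  moreover have "v @ [(x, \<not> b)] \<in> words X" using v(1) x by (auto simp: words_def)
  ultimately show ?case by blast
qed

lemma group_presented_group: "group (presented_group X R)"
proof (rule groupI)
  let ?P = "presented_group X R"
  have c: "carrier ?P = word_class X R ` words X" and o: "\<one>\<^bsub>?P\<^esub> = word_class X R []"
    by (simp_all add: presented_group_def)
  have e: "[] \<in> words X" by (simp add: words_def)
  show "\<one>\<^bsub>?P\<^esub> \<in> carrier ?P" by (auto simp: c o words_def)
  fix A assume "A \<in> carrier ?P"
  then obtain u where u: "u \<in> words X" "A = word_class X R u" by (auto simp: c)
  show "\<one>\<^bsub>?P\<^esub> \<otimes>\<^bsub>?P\<^esub> A = A" using u e by (simp add: o presented_group_mult)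
  from word_left_inverse[OF u(1)] obtain v where v: "v \<in> words X" "pres_eq X R (v @ u) []"
    by blast
  then have "word_class X R v \<otimes>\<^bsub>?P\<^esub> A = \<one>\<^bsub>?P\<^esub>"
    using u by (simp add: o presented_group_mult word_class_eq_iff words_append)
  then show "\<exists>B\<in>carrier ?P. B \<otimes>\<^bsub>?P\<^esub> A = \<one>\<^bsub>?P\<^esub>" using v(1) by (auto simp: c)
  fix B assume "B \<in> carrier ?P"
  then obtain w where w: "w \<in> words X" "B = word_class X R w" by (auto simp: c)
  show "A \<otimes>\<^bsub>?P\<^esub> B \<in> carrier ?P"
    using u w by (auto simp: presented_group_mult c words_append)
  fix C assume "C \<in> carrier ?P"
  then obtain z where z: "z \<in> words X" "C = word_class X R z" by (auto simp: c)
  show "A \<otimes>\<^bsub>?P\<^esub> B \<otimes>\<^bsub>?P\<^esub> C = A \<otimes>\<^bsub>?P\<^esub> (B \<otimes>\<^bsub>?P\<^esub> C)"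
    using u w z by (simp add: presented_group_mult words_append)
qed

lemma surface_group_0:
  "\<exists>\<phi>\<in>iso (surface_group 0) integer_group. \<phi> (surface_x 0) = 1"
proof -
  let ?X = "surf_gens 0" and ?R = "surf_rels 0"
  let ?s = "\<lambda>b. if b then 1 else - 1 :: int"
  define e where "e w = (\<Sum>(x, b)\<leftarrow>w. ?s b)" for w :: "surf_gen word"
  have X: "?X = {Xi}" and R: "?R = {}" by (auto simp: surf_gens_def surf_rels_def)
  have e_inv: "e u = e v" if "pres_eq ?X ?R u v" for u v
    using that by (induction rule: pres_eq.induct) (auto simp: e_def R)
  have e_app: "e (u @ v) = e u + e v" for u v by (simp add: e_def)
  define n where "n k = (if k \<ge> 0 then replicate (nat k) (Xi, True)
    else replicate (nat (- k)) (Xi, False))" for k :: int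
  have e_n: "e (n k) = k" for k by (simp add: n_def e_def sum_list_replicate)
  have n_w: "n k \<in> words ?X" for k by (auto simp: n_def words_def X)
  have n_pos: "n (int m) = replicate m (Xi, True)" for m by (simp add: n_def)
  have n_neg: "n (- int m) = replicate m (Xi, False)" for m
    by (cases "m = 0") (simp_all add: n_def)
  have cancel1: "pres_eq ?X ?R ((Xi, b) # (Xi, \<not> b) # w) w" if "w \<in> words ?X" for b w
    using pres_eq.cancel[of "[]" ?X w Xi ?R b] that by (simp add: X words_def)
  have refl1: "pres_eq ?X ?R (n k) (n k)" for k using n_w by (rule pres_eq.refl)
  have step: "pres_eq ?X ?R ((Xi, b) # n k) (n (?s b + k))" for b k
  proof (cases k)
    case (nonneg m)
    show ?thesis
    proof (cases b)
      case True
      then have "(Xi, b) # n k = n (int (Suc m))" by (simp only: nonneg n_pos replicate_Suc)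
      moreover have "?s b + k = int (Suc m)" using True nonneg by simp
      ultimately show ?thesis using refl1 by metis
    next
      case False
      show ?thesis
      proof (cases m)
        case 0
        then have "(Xi, b) # n k = n (- int 1)" using False n_pos[of 0] n_neg[of 1] nonneg by simp
        moreover have "?s b + k = - int 1" using False nonneg 0 by simp
        ultimately show ?thesis using refl1 by metis
      next
        case (Suc j)
        then have "(Xi, b) # n k = (Xi, b) # (Xi, \<not> b) # n (int j)"
          using False by (simp only: nonneg n_pos replicate_Suc) simp
        moreover have "?s b + k = int j" using False nonneg Suc by simp
        ultimately show ?thesis using cancel1[OF n_w] by metis
      qed
    qed
  next
    case (neg m)
    show ?thesis
    proof (cases b)
      case True
      then have "(Xi, b) # n k = (Xi, b) # (Xi, \<not> b) # n (- int m)"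
        by (simp only: neg n_neg replicate_Suc) simp
      moreover have "?s b + k = - int m" using True neg by simp
      ultimately show ?thesis using cancel1[OF n_w] by metis
    next
      case False
      then have "(Xi, b) # n k = n (- int (Suc (Suc m)))"
        by (simp only: neg n_neg replicate_Suc) 
      moreover have "?s b + k = - int (Suc (Suc m))" using False neg by simp
      ultimately show ?thesis using refl1 by metis
    qed
  qed
  have norm: "pres_eq ?X ?R w (n (e w))" if "w \<in> words ?X" for w
    using that
  proof (induction w)
    case Nil
    then show ?case by (auto simp: e_def n_def intro: pres_eq.refl)
  next
    case (Cons a w)
    then obtain b where a: "a = (Xi, b)" and w: "w \<in> words ?X"
      by (auto simp: words_def X)
    have "pres_eq ?X ?R (a # w) (a # n (e w))"
      using pres_eq_context[OF Cons.IH[OF w], of "[a]" "[]"] by (simp add: a words_def X)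
    also have "e (a # w) = ?s b + e w" by (simp add: e_def a)
    ultimately show ?case using step[of b "e w"] by (metis a pres_eq.trans)
  qed
  define \<phi> where "\<phi> A = e (SOME u. u \<in> A)" for A
  have \<phi>: "\<phi> (word_class ?X ?R u) = e u" if "u \<in> words ?X" for u
  proof -
    have "u \<in> word_class ?X ?R u" using that by (auto simp: word_class_def intro: pres_eq.refl)
    then have "(SOME v. v \<in> word_class ?X ?R u) \<in> word_class ?X ?R u" by (rule someI)
    then show ?thesis using e_inv by (auto simp: \<phi>_def word_class_def)
  qed
  have c: "carrier (surface_group 0) = word_class ?X ?R ` words ?X"
    by (simp add: surface_group_def presented_group_def)
  have "inj_on \<phi> (carrier (surface_group 0))"
  proof (rule inj_onI)
    fix A B assume AB: "A \<in> carrier (surface_group 0)" "B \<in> carrier (surface_group 0)" "\<phi> A = \<phi> B"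
    then obtain u v where uv: "u \<in> words ?X" "v \<in> words ?X"
      "A = word_class ?X ?R u" "B = word_class ?X ?R v" by (auto simp: c)
    with AB(3) have "e u = e v" by (simp add: \<phi>)
    then have "pres_eq ?X ?R u v"
      using norm[OF uv(1)] norm[OF uv(2)] by (metis pres_eq.sym pres_eq.trans)
    then show "A = B" using uv by (simp add: word_class_eq_iff)
  qed
  moreover have "k \<in> \<phi> ` carrier (surface_group 0)" for k
    using \<phi>[OF n_w] e_n n_w by (metis c image_eqI)
  moreover have "\<phi> \<in> hom (surface_group 0) integer_group"
  proof (rule homI)
    fix A B assume "A \<in> carrier (surface_group 0)" "B \<in> carrier (surface_group 0)"
    then obtain u v where "u \<in> words ?X" "v \<in> words ?X"
      "A = word_class ?X ?R u" "B = word_class ?X ?R v" by (auto simp: c)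
    then show "\<phi> (A \<otimes>\<^bsub>surface_group 0\<^esub> B) = \<phi> A \<otimes>\<^bsub>integer_group\<^esub> \<phi> B"
      by (simp add: surface_group_def presented_group_mult words_append \<phi> e_app)
  qed simp
  moreover have "\<phi> (surface_x 0) = 1"
    using \<phi>[of "[(Xi, True)]"] by (simp add: surface_x_def words_def X e_def)
  ultimately show ?thesis by (intro bexI[of _ \<phi>]) (auto simp: iso_def bij_betw_def)
qed

text \<open>Homomorphisms are made extensional so that each has exactly one representing function.\<close>

definition Hom_grp :: "('c, 'd) monoid_scheme \<Rightarrow> ('a, 'b) monoid_scheme \<Rightarrow> ('c \<Rightarrow> 'a) set" where
  "Hom_grp K G = hom K G \<inter> extensional (carrier K)"

definition Omega ::
    "('a, 'b) monoid_scheme \<Rightarrow> nat \<Rightarrow> (surf_gen word set \<Rightarrow> 'a, 'a, 'k::field) left_modcomod" where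
  "Omega G g = \<lparr>lbasis = Hom_grp (surface_group g) G,
     lact = (\<lambda>a. lin_ext (\<lambda>f. lin_ext (\<lambda>h. single
        (\<lambda>y\<in>carrier (surface_group g). h \<otimes>\<^bsub>G\<^esub> f y \<otimes>\<^bsub>G\<^esub> inv\<^bsub>G\<^esub> h)) a)),
     lcoact = lin_ext (\<lambda>f. tensor (single (f (surface_x g))) (single f))\<rparr>"

definition graded_part :: "'c \<Rightarrow> ('n, 'c, 'k::field) left_modcomod \<Rightarrow> ('n \<Rightarrow> 'k) set" where
  "graded_part q N = {v \<in> free_vs (lbasis N). lcoact N v = tensor (single q) v}"

definition char_kernel :: "('a, 'b) monoid_scheme \<Rightarrow> (('a \<Rightarrow> 'k::field) \<Rightarrow> 'k) \<Rightarrow> ('a \<Rightarrow> 'k) set" where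
  "char_kernel G \<alpha> = {a \<in> grp_alg G. \<alpha> a = 0}"

definition act_span ::
    "('n, 'c, 'k::field) left_modcomod \<Rightarrow> ('c \<Rightarrow> 'k) set \<Rightarrow> ('n \<Rightarrow> 'k) set \<Rightarrow> ('n \<Rightarrow> 'k) set" where
  "act_span N I V = fv.span {lact N a v | a v. a \<in> I \<and> v \<in> V}"

end

theory Submission
  imports Defs
begin

text \<open>
  Both sides are computed on a basis on which a finite group acts monomially, i.e. by permutations up
  to scalars. For such an action, coinvariants and invariants have a basis indexed by the same
  orbits, those whose stabilizers act by the trivial scalar. No averaging is involved, which is why
  the first isomorphism needs no assumption on the characteristic.

  On the Kitaev side the basis consists of the colourings of the half-edges by elements of the group
  whose holonomy around each face is the prescribed power of p, acted upon by gauge transformations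
  at the cilia. Reading the faces as words in the half-edges presents the surface as a collection of
  glued polygons. Merging the faces along common edges, cancelling adjacent sides that are glued to
  each other and splitting off handles as in the classification of surfaces identifies the flat
  colourings, up to gauge transformations that are trivial at the distinguished cilium, with lists
  of g pairs whose commutators multiply to a power of p. By the Euler characteristic this power is
  2g, so these lists are the homomorphisms from the surface group that are homogeneous of degree
  p^(2g). Stabilizers act by the scalar chi^(2g) of the value at the distinguished cilium, so the two
  notions of good orbit agree.
\<close>

subsection \<open>Coinvariants and invariants of monomial actions\<close>

text \<open>The scalars of the two actions cannot be matched vector by vector: on the graph side the
  scalar of a gauge transformation depends on its values at all cilia, on the surface side only on
  one element of G. Rescaling basis vectors changes the scalars along an orbit but not the character
  by which a stabilizer acts, and the dimensions of coinvariants and invariants depend only on the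
  orbits and these characters. Hence both sides are compared with the free space on the good orbits
  instead of directly with each other. Cutting and pasting is done on words whose corners are
  labelled. The labels are carried along for two reasons: gauge transformations are functions of the
  corner, and an edge can be gauged away only if no other side meets one of its ends. Handles are
  pulled to the front of the word, which turns their coordinates into loops at the base corner;
  gauge transformations then act on them by simultaneous conjugation, just as G acts on
  homomorphisms from the surface group.\<close>

lemma linearly_isomorphic_trans:
  assumes "linearly_isomorphic U V" "linearly_isomorphic V W"
  shows "linearly_isomorphic U W"
proof -
  obtain f where f: "bij_betw f (carrier U) (carrier V)"
    "\<And>x y. x \<in> carrier U \<Longrightarrow> y \<in> carrier U \<Longrightarrow> f (add U x y) = add V (f x) (f y)"
    "\<And>c x. x \<in> carrier U \<Longrightarrow> f (smult U c x) = smult V c (f x)"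
    using assms(1) unfolding linearly_isomorphic_def by blast
  obtain h where h: "bij_betw h (carrier V) (carrier W)"
    "\<And>x y. x \<in> carrier V \<Longrightarrow> y \<in> carrier V \<Longrightarrow> h (add V x y) = add W (h x) (h y)"
    "\<And>c x. x \<in> carrier V \<Longrightarrow> h (smult V c x) = smult W c (h x)"
    using assms(2) unfolding linearly_isomorphic_def by blast
  have "f x \<in> carrier V" if "x \<in> carrier U" for x using f(1) that by (auto simp: bij_betw_def)
  then show ?thesis
    unfolding linearly_isomorphic_def
    by (intro exI[of _ "h \<circ> f"]) (use bij_betw_trans[OF f(1) h(1)] in \<open>simp add: f h\<close>)
qed

text \<open>The records carry no module axioms, so closure of \<open>U\<close> is assumed: the
  inverse map respects a sum or a multiple only if that sum or multiple stays in the carrier of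
  \<open>U\<close>.\<close>

lemma linearly_isomorphic_sym:
  assumes "linearly_isomorphic U V"
    and "\<And>x y. x \<in> carrier U \<Longrightarrow> y \<in> carrier U \<Longrightarrow> add U x y \<in> carrier U"
    and "\<And>c x. x \<in> carrier U \<Longrightarrow> smult U c x \<in> carrier U"
  shows "linearly_isomorphic V U"
proof -
  obtain f where f: "bij_betw f (carrier U) (carrier V)"
    "\<And>x y. x \<in> carrier U \<Longrightarrow> y \<in> carrier U \<Longrightarrow> f (add U x y) = add V (f x) (f y)"
    "\<And>c x. x \<in> carrier U \<Longrightarrow> f (smult U c x) = smult V c (f x)"
    using assms(1) unfolding linearly_isomorphic_def by blast
  let ?h = "inv_into (carrier U) f"
  have fh: "f (?h x) = x" "?h x \<in> carrier U" if "x \<in> carrier V" for x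
    using f(1) that by (auto simp: bij_betw_def f_inv_into_f inv_into_into)
  have hf: "?h (f x) = x" if "x \<in> carrier U" for x
    using f(1) that by (simp add: bij_betw_inv_into_left)
  have "?h (add V x y) = add U (?h x) (?h y)" if "x \<in> carrier V" "y \<in> carrier V" for x y
    using hf[of "add U (?h x) (?h y)"] fh that assms(2) f(2) by auto
  moreover have "?h (smult V c x) = smult U c (?h x)" if "x \<in> carrier V" for x c
    using hf[of "smult U c (?h x)"] fh that assms(3) f(3) by auto
  ultimately show ?thesis
    unfolding linearly_isomorphic_def using bij_betw_inv_into[OF f(1)] by blast
qed

section \<open>Finitely supported functions, cosets and quotients\<close>

lemma fscale_apply [simp]: "fscale c v x = c * v x"
  by (simp add: fscale_def)

lemma finite_support_free_vs:
  "finite S \<Longrightarrow> v \<in> free_vs S \<longleftrightarrow> (\<forall>x. x \<notin> S \<longrightarrow> v x = 0)"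
  unfolding free_vs_def by (auto intro: finite_subset)

lemma subspace_free_vs: "fv.subspace (free_vs S)"
proof (rule fv.subspaceI)
  fix v w :: "'b \<Rightarrow> 'k::field" assume "v \<in> free_vs S" "w \<in> free_vs S"
  moreover from this have "finite {x. v x + w x \<noteq> 0}"
    by (auto simp: free_vs_def intro: finite_subset[of _ "{x. v x \<noteq> 0} \<union> {x. w x \<noteq> 0}"])
  moreover have "{x. v x + w x \<noteq> 0} \<subseteq> {x. v x \<noteq> 0} \<union> {x. w x \<noteq> 0}" by auto
  ultimately show "v + w \<in> free_vs S" by (simp add: free_vs_def) blast
qed (auto simp: free_vs_def elim: finite_subset[rotated])

lemma single_in_free_vs: "x \<in> S \<Longrightarrow> single x \<in> free_vs S"
  by (auto simp: free_vs_def single_def)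

lemma sum_fun_apply: "(\<Sum>x\<in>S. f x) y = (\<Sum>x\<in>S. f x y)"
  by (induction S rule: infinite_finite_induct) auto

lemma sum_fscale_single:
  assumes "finite S" "v \<in> free_vs S"
  shows "v = (\<Sum>x\<in>S. fscale (v x) (single x))"
proof
  fix y
  have "(\<Sum>x\<in>S. fscale (v x) (single x)) y = (\<Sum>x\<in>S. v x * single x y)"
    by (simp add: sum_fun_apply)
  also have "\<dots> = (\<Sum>x\<in>S. if y = x then v x else 0)" by (intro sum.cong) (auto simp: single_def)
  also have "\<dots> = v y" using assms by (simp add: finite_support_free_vs)
  finally show "v y = (\<Sum>x\<in>S. fscale (v x) (single x)) y" by simp
qed

lemma coset_add:
  assumes "fv.subspace W"
  shows "(v +o W) + (w +o W) = (v + w) +o W"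
proof -
  have "W + W = W"
    using fv.subspace_add[OF assms] fv.subspace_0[OF assms] by (force simp: set_plus_def)
  then show ?thesis by (simp add: set_plus_rearrange)
qed

lemma coset_eq:
  assumes "fv.subspace W" "v - w \<in> W"
  shows "v +o W = w +o W"
proof -
  have "v + x \<in> w +o W" if "x \<in> W" for x
    using fv.subspace_add[OF assms(1) assms(2) that]
    by (auto simp: elt_set_plus_def intro!: bexI[of _ "v - w + x"])
  moreover have "w + x \<in> v +o W" if "x \<in> W" for x
    using fv.subspace_diff[OF assms(1) that assms(2)]
    by (auto simp: elt_set_plus_def intro!: bexI[of _ "x - (v - w)"])
  ultimately show ?thesis by (auto simp: elt_set_plus_def)
qed

lemma coset_scale:
  assumes "fv.subspace W"
  shows "(\<Union>x\<in>v +o W. fscale c x +o W) = fscale c v +o W"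
proof -
  have "fscale c x +o W = fscale c v +o W" if "x \<in> v +o W" for x
  proof (rule coset_eq[OF assms])
    from that obtain u where "u \<in> W" "x = v + u" by (auto simp: elt_set_plus_def)
    then have "fscale c x - fscale c v = fscale c u" by (simp add: fun_eq_iff algebra_simps)
    then show "fscale c x - fscale c v \<in> W"
      using fv.subspace_scale[OF assms \<open>u \<in> W\<close>] by simp
  qed
  moreover have "v \<in> v +o W"
    using fv.subspace_0[OF assms] by (auto simp: elt_set_plus_def)
  ultimately show ?thesis by blast
qed

text \<open>First isomorphism theorem for the image of \<open>V\<close> in the quotient by
  \<open>W\<close>. In a bitensor product the relations reach outside the cotensor product, so
  \<open>F\<close> has to kill all of \<open>W\<close>, whereas its kernel is compared with
  \<open>W\<close> only inside \<open>V\<close>.\<close>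

lemma quot_image_isomorphic:
  fixes F :: "('b \<Rightarrow> 'k::field) \<Rightarrow> 'c \<Rightarrow> 'k"
  assumes W: "fv.subspace W" and V: "fv.subspace V"
    and add: "\<And>v w. F (v + w) = F v + F w" and scale: "\<And>c v. F (fscale c v) = fscale c (F v)"
    and kernel: "\<And>v. v \<in> W \<Longrightarrow> F v = 0" "\<And>v. v \<in> V \<Longrightarrow> F v = 0 \<Longrightarrow> v \<in> W"
    and surj: "F ` V = U"
  shows "linearly_isomorphic (quot_image V W) (subspace_vs U)"
proof -
  define \<Phi> where "\<Phi> A = F (SOME v. v \<in> A)" for A
  have \<Phi>: "\<Phi> (v +o W) = F v" for v
  proof -
    have "v \<in> v +o W" using fv.subspace_0[OF W] by (auto simp: elt_set_plus_def)
    then have "(SOME u. u \<in> v +o W) \<in> v +o W" using someI[of "\<lambda>u. u \<in> v +o W" v] by blast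
    then obtain w where "w \<in> W" "(SOME u. u \<in> v +o W) = v + w" by (auto simp: elt_set_plus_def)
    then show ?thesis by (simp add: \<Phi>_def add kernel)
  qed
  have "inj_on \<Phi> ((\<lambda>v. v +o W) ` V)"
  proof (rule inj_onI, clarsimp simp: \<Phi>)
    fix v w assume vw: "v \<in> V" "w \<in> V" "F v = F w"
    have "F (v - w) = F v - F w"
      using add[of "v - w" w] by (simp add: algebra_simps)
    then have "v - w \<in> W" using vw kernel(2)[of "v - w"] fv.subspace_diff[OF V] by simp
    then show "v +o W = w +o W" by (rule coset_eq[OF W])
  qed
  moreover have "\<Phi> ` (\<lambda>v. v +o W) ` V = U" using surj by (simp add: image_image \<Phi>)
  ultimately show ?thesis
    unfolding linearly_isomorphic_def
    by (intro exI[of _ \<Phi>])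
      (auto simp: quot_image_def subspace_vs_def bij_betw_def coset_add coset_scale W \<Phi> add scale)
qed

lemma quot_image_closed:
  assumes W: "fv.subspace W" and V: "fv.subspace V" and x: "x \<in> carrier (quot_image V W)"
  shows "y \<in> carrier (quot_image V W) \<Longrightarrow> add (quot_image V W) x y \<in> carrier (quot_image V W)"
    and "smult (quot_image V W) c x \<in> carrier (quot_image V W)"
proof -
  obtain v where v: "v \<in> V" "x = v +o W" using x by (auto simp: quot_image_def)
  show "smult (quot_image V W) c x \<in> carrier (quot_image V W)"
    using fv.subspace_scale[OF V v(1), of c]
    unfolding quot_image_def v by (simp add: coset_scale[OF W])
  assume "y \<in> carrier (quot_image V W)"
  then obtain w where w: "w \<in> V" "y = w +o W" by (auto simp: quot_image_def)
  show "add (quot_image V W) x y \<in> carrier (quot_image V W)"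
    using fv.subspace_add[OF V v(1) w(1)]
    unfolding quot_image_def v w by (simp add: coset_add[OF W])
qed

lemma free_vs_isomorphic:
  assumes f: "bij_betw f A B"
  shows "linearly_isomorphic (subspace_vs (free_vs A) :: ('k::field, _) module) (subspace_vs (free_vs B))"
proof -
  define \<Phi> where "\<Phi> v = (\<lambda>y. if y \<in> B then v (inv_into A f y) else (0::'k))" for v
  have g: "inv_into A f y \<in> A" "f (inv_into A f y) = y" if "y \<in> B" for y
    using f that by (auto simp: bij_betw_def inv_into_into f_inv_into_f)
  have g': "f x \<in> B" "inv_into A f (f x) = x" if "x \<in> A" for x
    using f that by (auto simp: bij_betw_def)
  have in_B: "\<Phi> v \<in> free_vs B" if "v \<in> free_vs A" for v
  proof -
    have "{y. \<Phi> v y \<noteq> 0} \<subseteq> f ` {x. v x \<noteq> 0}" using g by (force simp: \<Phi>_def split: if_splits)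
    then show ?thesis
      using that by (auto simp: free_vs_def \<Phi>_def split: if_splits intro: finite_subset)
  qed
  have onto: "\<exists>v\<in>free_vs A. \<Phi> v = w" if "w \<in> free_vs B" for w
  proof
    let ?v = "\<lambda>x. if x \<in> A then w (f x) else 0"
    have "{x. ?v x \<noteq> 0} \<subseteq> inv_into A f ` {y. w y \<noteq> 0}"
      using g' by (force split: if_splits)
    then show "?v \<in> free_vs A"
      using that by (auto simp: free_vs_def split: if_splits intro: finite_subset)
    show "\<Phi> ?v = w" using that g by (auto simp: \<Phi>_def free_vs_def fun_eq_iff)
  qed
  have "inj_on \<Phi> (free_vs A)"
  proof (rule inj_onI, rule ext)
    fix v w x assume vw: "v \<in> free_vs A" "w \<in> free_vs A" "\<Phi> v = \<Phi> w"
    show "v x = w x"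
    proof (cases "x \<in> A")
      case True
      then show ?thesis using fun_cong[OF vw(3), of "f x"] g' by (simp add: \<Phi>_def)
    next
      case False
      then have "v x = 0" "w x = 0" using vw by (auto simp: free_vs_def)
      then show ?thesis by simp
    qed
  qed
  then have "bij_betw \<Phi> (free_vs A) (free_vs B)"
    unfolding bij_betw_def using in_B onto by blast
  then show ?thesis
    unfolding linearly_isomorphic_def
    by (intro exI[of _ \<Phi>]) (auto simp: subspace_vs_def \<Phi>_def fun_eq_iff)
qed

text \<open>
  R x c y stands for the identification of the basis vector x with c times the basis vector y. The
  class of x survives exactly when x is not identified with a multiple c x for c other than 1.
\<close>

locale weighted_equiv =
  fixes S :: "'b set" and R :: "'b \<Rightarrow> 'k::field \<Rightarrow> 'b \<Rightarrow> bool"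
  assumes finite_S: "finite S"
    and refl: "x \<in> S \<Longrightarrow> R x 1 x"
    and sym: "x \<in> S \<Longrightarrow> R x c y \<Longrightarrow> R y (inverse c) x"
    and trans: "x \<in> S \<Longrightarrow> R x c y \<Longrightarrow> R y d z \<Longrightarrow> R x (c * d) z"
    and nonzero: "x \<in> S \<Longrightarrow> R x c y \<Longrightarrow> c \<noteq> 0"
    and stable: "x \<in> S \<Longrightarrow> R x c y \<Longrightarrow> y \<in> S"
begin

definition good :: "'b \<Rightarrow> bool" where
  "good x \<longleftrightarrow> (\<forall>c. R x c x \<longrightarrow> c = 1)"

definition cls :: "'b \<Rightarrow> 'b set" where
  "cls x = {y. \<exists>c. R x c y}"

definition good_classes :: "'b set set" where
  "good_classes = cls ` {x \<in> S. good x}"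

definition rep :: "'b set \<Rightarrow> 'b" where
  "rep C = (SOME x. x \<in> C)"

text \<open>Modulo the relations, \<open>single x\<close> becomes \<open>weight x\<close> times the
  representative of its class. The value 0 at bad \<open>x\<close> reflects that such basis vectors
  vanish in the quotient.\<close>

definition weight :: "'b \<Rightarrow> 'k" where
  "weight x = (if x \<in> S \<and> good x then THE c. R x c (rep (cls x)) else 0)"

lemma cls_self: "x \<in> S \<Longrightarrow> x \<in> cls x"
  using refl by (auto simp: cls_def)

lemma cls_eq:
  assumes "x \<in> S" "R x c y"
  shows "cls x = cls y"
proof -
  have y: "y \<in> S" "R y (inverse c) x" using assms stable sym by auto
  show ?thesis using trans assms y unfolding cls_def by blast
qed

lemma cls_subset: "x \<in> S \<Longrightarrow> cls x \<subseteq> S"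
  using stable by (auto simp: cls_def)

lemma rep_in_cls: "x \<in> S \<Longrightarrow> rep (cls x) \<in> cls x"
  unfolding rep_def by (rule someI) (rule cls_self)

lemma cls_rep: "x \<in> S \<Longrightarrow> cls (rep (cls x)) = cls x"
  using rep_in_cls[of x] cls_eq[of x _ "rep (cls x)"] unfolding cls_def[of x] by blast

text \<open>Going from \<open>x\<close> to \<open>y\<close> with scalar \<open>c\<close> and back
  with the inverse of \<open>d\<close> is a loop at \<open>x\<close>, and loops at a good point have
  scalar 1.\<close>

lemma good_unique:
  assumes "x \<in> S" "good x" "R x c y" "R x d y"
  shows "c = d"
proof -
  have "R x (c * inverse d) x" using assms sym trans by blast
  then show ?thesis using assms nonzero by (auto simp: good_def field_simps)
qed

text \<open>Prolonging the path from \<open>x\<close> to \<open>y\<close> by a loop at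
  \<open>y\<close> gives a second scalar between the same two points, which uniqueness at
  \<open>x\<close> forces to equal the first.\<close>

lemma good_cong:
  assumes "x \<in> S" "R x c y"
  shows "good x \<longleftrightarrow> good y"
proof -
  have *: "good y" if xy: "x \<in> S" "R x c y" "good x" for x y c
  proof -
    have y: "y \<in> S" "R y (inverse c) x" "c \<noteq> 0" using xy stable sym nonzero by auto
    have "d = 1" if "R y d y" for d
    proof -
      have "R x (c * d) y" using trans xy that by blast
      then have "c * d = c" using good_unique xy by blast
      then show ?thesis using y by simp
    qed
    then show ?thesis by (simp add: good_def)
  qed
  show ?thesis using *[OF assms] *[OF stable[OF assms] sym[OF assms]] by blast
qed

lemma weight_rel:
  assumes "x \<in> S" "good x"
  shows "R x (weight x) (rep (cls x))"
proof -
  obtain c where c: "R x c (rep (cls x))" using rep_in_cls[OF assms(1)] by (auto simp: cls_def)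
  have "R x (THE c. R x c (rep (cls x))) (rep (cls x))"
    by (rule theI[of _ c]) (use c good_unique assms in auto)
  then show ?thesis using assms by (simp add: weight_def)
qed

lemma weight_eq:
  assumes "x \<in> S" "R x c y"
  shows "weight x = c * weight y"
proof (cases "good x")
  case True
  have y: "y \<in> S" "good y" using stable assms good_cong True by auto
  have "R x (c * weight y) (rep (cls x))"
    using trans[OF assms weight_rel[OF y]] cls_eq[OF assms] by simp
  then show ?thesis using good_unique weight_rel assms True by blast
next
  case False
  then show ?thesis using good_cong[OF assms] by (simp add: weight_def)
qed

lemma good_class_rep:
  assumes "C \<in> good_classes"
  shows "rep C \<in> S" "good (rep C)" "cls (rep C) = C" "weight (rep C) = 1" "C \<subseteq> S" "rep C \<in> C"
proof -
  obtain x where x: "x \<in> S" "good x" "C = cls x" using assms by (auto simp: good_classes_def)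
  obtain c where c: "R x c (rep C)" using rep_in_cls[OF x(1)] x(3) by (auto simp: cls_def)
  show r: "rep C \<in> S" "good (rep C)" "cls (rep C) = C" "C \<subseteq> S" "rep C \<in> C"
    using x c stable good_cong cls_rep cls_subset rep_in_cls by auto
  show "weight (rep C) = 1" using weight_rel[OF r(1,2)] r(2) by (simp add: good_def r(3))
qed

text \<open>The coordinates of the coset of \<open>v\<close> with respect to the representatives of
  the good classes.\<close>

definition class_sum :: "('b \<Rightarrow> 'k) \<Rightarrow> 'b set \<Rightarrow> 'k" where
  "class_sum v = (\<lambda>C. if C \<in> good_classes then \<Sum>x\<in>C. v x * weight x else 0)"

lemma finite_good_classes: "finite good_classes"
  by (simp add: good_classes_def finite_S)

lemma sum_in_class:
  assumes "C \<in> good_classes"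
  shows "(\<Sum>x\<in>C. f x) = (\<Sum>x\<in>S. if cls x = C then f x else (0::'k))"
proof -
  have "{x \<in> S. cls x = C} = C"
  proof (intro equalityI subsetI)
    fix x assume "x \<in> C"
    then obtain c where "R (rep C) c x" using good_class_rep[OF assms] by (auto simp: cls_def)
    then have "cls x = C" "x \<in> S"
      using good_class_rep[OF assms] cls_eq[of "rep C" c x] stable by auto
    then show "x \<in> {x \<in> S. cls x = C}" by simp
  qed (use cls_self in blast)
  then have "sum f C = sum f {x \<in> S. cls x = C}" by simp
  also have "\<dots> = (\<Sum>x\<in>S. if cls x = C then f x else 0)"
    by (rule sum.inter_filter[OF finite_S])
  finally show ?thesis .
qed

text \<open>\<open>W\<close> is pinned down from two sides. By \<open>rel\<close> it contains all
  identifications; by \<open>kills\<close> it is no larger than their span, expressed dually: every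
  functional \<open>w\<close> that respects the identifications vanishes on \<open>W\<close>. Thus
  generators of \<open>W\<close> that are not themselves identifications of basis vectors can be
  handled by testing them.\<close>

lemma coinvariants_isomorphic:
  assumes W: "fv.subspace W"
    and rel: "\<And>x c y. x \<in> S \<Longrightarrow> R x c y \<Longrightarrow> single x - fscale c (single y) \<in> W"
    and kills: "\<And>w v. (\<And>x. x \<notin> S \<Longrightarrow> w x = 0) \<Longrightarrow>
        (\<And>x c y. x \<in> S \<Longrightarrow> R x c y \<Longrightarrow> w x = c * w y) \<Longrightarrow> v \<in> W \<Longrightarrow>
        (\<Sum>x\<in>S. v x * w x) = 0"
  shows "linearly_isomorphic (quot_image (free_vs S) W) (subspace_vs (free_vs good_classes))"
proof (rule quot_image_isomorphic[OF W subspace_free_vs, where F = class_sum])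
  show "class_sum (v + w) = class_sum v + class_sum w" for v w
    by (auto simp: class_sum_def algebra_simps sum.distrib)
  show "class_sum (fscale c v) = fscale c (class_sum v)" for c v
    by (auto simp: class_sum_def sum_distrib_left mult.assoc)
  show "class_sum v = 0" if v: "v \<in> W" for v
  proof
    fix C
    show "class_sum v C = 0 C"
    proof (cases "C \<in> good_classes")
      case True
      \<comment> \<open>The coordinate at \<open>C\<close> is itself a functional respecting the
        identifications, so \<open>kills\<close> applies to it.\<close>
      let ?w = "\<lambda>x. if x \<in> S \<and> cls x = C then weight x else 0"
      have "(\<Sum>x\<in>S. v x * ?w x) = 0"
        by (rule kills[OF _ _ v]) (auto simp: weight_eq stable dest: cls_eq)
      moreover have "class_sum v C = (\<Sum>x\<in>S. v x * ?w x)"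
        using True by (auto simp: class_sum_def sum_in_class intro!: sum.cong)
      ultimately show ?thesis by simp
    qed (simp add: class_sum_def)
  qed
  show "v \<in> W" if v: "v \<in> free_vs S" "class_sum v = 0" for v
  proof -
    \<comment> \<open>A loop with scalar \<open>c\<close> puts \<open>1 - c\<close> times
      \<open>single x\<close> into \<open>W\<close>, and \<open>1 - c\<close> is invertible in a
      field.\<close>
    have bad: "single x \<in> W" if x: "x \<in> S" "\<not> good x" for x
    proof -
      obtain c where c: "R x c x" "c \<noteq> 1" using x by (auto simp: good_def)
      have "fscale (inverse (1 - c)) (single x - fscale c (single x)) \<in> W"
        by (intro fv.subspace_scale[OF W] rel x c)
      also have "single x - fscale c (single x) = fscale (1 - c) (single x)"
        by (auto simp: fun_eq_iff algebra_simps)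
      also have "fscale (inverse (1 - c)) \<dots> = single x" using c by simp
      finally show ?thesis .
    qed
    \<comment> \<open>Replacing every basis vector by its multiple of the representative changes
      \<open>v\<close> only by an element of \<open>W\<close>; what remains is a combination of
      representatives whose coefficients are the entries of \<open>class_sum v\<close>.\<close>
    let ?r = "\<lambda>x. fscale (weight x) (single (rep (cls x)))"
    have step: "fscale (v x) (single x - ?r x) \<in> W" if "x \<in> S" for x
    proof (cases "good x")
      case True
      then show ?thesis using that W by (intro fv.subspace_scale rel weight_rel)
    next
      case False
      then have "single x - ?r x = single x" by (auto simp: weight_def fun_eq_iff)
      then show ?thesis using bad[OF that False] by (simp only: fv.subspace_scale W)
    qed
    have cls_good: "cls x \<in> good_classes \<longleftrightarrow> good x" if x: "x \<in> S" for x
    proof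
      assume "cls x \<in> good_classes"
      then have "good (rep (cls x))" by (rule good_class_rep)
      moreover obtain c where "R x c (rep (cls x))" using rep_in_cls[OF x] by (auto simp: cls_def)
      ultimately show "good x" using good_cong[OF x] by blast
    qed (use x in \<open>auto simp: good_classes_def\<close>)
    have "(\<Sum>x\<in>S. fscale (v x) (?r x)) = 0"
    proof
      fix y
      have "(\<Sum>x\<in>S. fscale (v x) (?r x)) y = (\<Sum>x\<in>S. v x * weight x * single (rep (cls x)) y)"
        by (simp add: sum_fun_apply mult.assoc)
      also have "\<dots> = (\<Sum>x\<in>S. if good x then v x * weight x * single (rep (cls x)) y else 0)"
        by (intro sum.cong) (auto simp: weight_def)
      also have "\<dots> = (\<Sum>x\<in>S. \<Sum>C\<in>good_classes. if cls x = C then v x * weight x * single (rep C) y else 0)"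
        using cls_good by (intro sum.cong) (auto simp: finite_good_classes weight_def)
      also have "\<dots> = (\<Sum>C\<in>good_classes. class_sum v C * single (rep C) y)"
        by (subst sum.swap)
          (auto simp: class_sum_def sum_in_class sum_distrib_right intro!: sum.cong)
      also have "\<dots> = 0" using v(2) by simp
      finally show "(\<Sum>x\<in>S. fscale (v x) (?r x)) y = 0 y" by simp
    qed
    moreover have "v = (\<Sum>x\<in>S. fscale (v x) (single x - ?r x)) + (\<Sum>x\<in>S. fscale (v x) (?r x))"
      using sum_fscale_single[OF finite_S v(1)]
      by (simp add: sum.distrib[symmetric] fv.scale_right_diff_distrib)
    ultimately have "v = (\<Sum>x\<in>S. fscale (v x) (single x - ?r x))" by simp
    moreover have "(\<Sum>x\<in>S. fscale (v x) (single x - ?r x)) \<in> W"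
      by (intro fv.subspace_sum W step)
    ultimately show ?thesis by argo
  qed
  show "class_sum ` free_vs S = free_vs good_classes"
  proof (intro equalityI subsetI)
    fix u :: "'b set \<Rightarrow> 'k" assume u: "u \<in> free_vs good_classes"
    \<comment> \<open>A preimage of \<open>u\<close> concentrated on the representatives, which have
      weight 1.\<close>
    let ?v = "\<lambda>x. if x \<in> S \<and> good x \<and> rep (cls x) = x then u (cls x) else 0"
    have "class_sum ?v C = u C" for C
    proof (cases "C \<in> good_classes")
      case True
      have "(\<Sum>x\<in>C. ?v x * weight x) = (\<Sum>x\<in>C. if x = rep C then u C else 0)"
      proof (intro sum.cong HOL.refl)
        fix x assume "x \<in> C"
        then have x: "x \<in> S" "cls x = C" "good x"
          using good_class_rep[OF True] cls_eq[of "rep C" _ x] good_cong[of "rep C" _ x]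
          by (auto simp: cls_def)
        then show "?v x * weight x = (if x = rep C then u C else 0)"
          using good_class_rep[OF True] by auto
      qed
      also have "\<dots> = u C"
        using good_class_rep[OF True] finite_S by (simp add: finite_subset)
      finally show ?thesis using True by (simp add: class_sum_def)
    qed (use u in \<open>auto simp: class_sum_def free_vs_def\<close>)
    moreover have "?v \<in> free_vs S" by (auto simp: finite_support_free_vs finite_S)
    ultimately show "u \<in> class_sum ` free_vs S" by (intro image_eqI[of _ _ ?v]) auto
  qed (auto simp: finite_support_free_vs finite_good_classes class_sum_def)
qed

text \<open>A function with this transformation rule is determined on a class by its value at the
  representative, and a loop with scalar other than 1 forces it to vanish.\<close>

lemma invariants_isomorphic:
  "linearly_isomorphic
    (subspace_vs {f \<in> free_vs S. \<forall>x\<in>S. \<forall>c y. R x c y \<longrightarrow> f y = c * f x})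
    (subspace_vs (free_vs good_classes))" (is "linearly_isomorphic (subspace_vs ?I) _")
proof -
  define \<Phi> where "\<Phi> f = (\<lambda>C. if C \<in> good_classes then f (rep C) else 0)" for f :: "'b \<Rightarrow> 'k"
  have bad: "f x = 0" if "f \<in> ?I" "\<not> good x" for f x
  proof (cases "x \<in> S")
    case True
    obtain c where "R x c x" "c \<noteq> 1" using \<open>\<not> good x\<close> by (auto simp: good_def)
    moreover from this have "f x = c * f x" using that True by blast
    ultimately show ?thesis by (metis mult_cancel_right1)
  qed (use that in \<open>auto simp: finite_support_free_vs finite_S\<close>)
  have "inj_on \<Phi> ?I"
  proof (rule inj_onI, rule ext)
    fix f h x assume fh: "f \<in> ?I" "h \<in> ?I" "\<Phi> f = \<Phi> h"
    show "f x = h x"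
    proof (cases "x \<in> S \<and> good x")
      case True
      have "f (rep (cls x)) = weight x * f x" "h (rep (cls x)) = weight x * h x"
        using fh True weight_rel by auto
      moreover have "f (rep (cls x)) = h (rep (cls x))"
        using fun_cong[OF fh(3), of "cls x"] True by (auto simp: \<Phi>_def good_classes_def)
      ultimately show ?thesis using nonzero[OF _ weight_rel] True by force
    next
      case False
      moreover have "f x = 0" "h x = 0" if "x \<notin> S"
        using fh(1,2) that by (auto simp: finite_support_free_vs finite_S)
      ultimately show ?thesis using bad[OF fh(1), of x] bad[OF fh(2), of x] by argo
    qed
  qed
  moreover have "\<Phi> ` ?I = free_vs good_classes"
  proof (intro equalityI subsetI)
    fix u :: "'b set \<Rightarrow> 'k" assume u: "u \<in> free_vs good_classes"
    \<comment> \<open>Dividing by the weight is forced: the path from \<open>x\<close> to its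
      representative has scalar \<open>weight x\<close>, so the value there must be
      \<open>weight x * f x\<close>.\<close>
    define f where "f x = (if x \<in> S \<and> good x then u (cls x) / weight x else 0)" for x
    have "f y = c * f x" if xy: "x \<in> S" "R x c y" for x c y
      using weight_eq[OF xy] stable[OF xy] good_cong[OF xy] cls_eq[OF xy] nonzero[OF xy] xy(1)
      by (auto simp: f_def)
    then have "f \<in> ?I" by (auto simp: finite_support_free_vs finite_S f_def)
    moreover have "\<Phi> f = u"
      using u good_class_rep by (auto simp: \<Phi>_def f_def fun_eq_iff free_vs_def)
    ultimately show "u \<in> \<Phi> ` ?I" using image_eqI[of u \<Phi> f ?I] by simp
  qed (auto simp: finite_support_free_vs finite_good_classes \<Phi>_def)
  ultimately show ?thesis
    unfolding linearly_isomorphic_def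
    by (intro exI[of _ \<Phi>]) (auto simp: subspace_vs_def bij_betw_def \<Phi>_def fun_eq_iff)
qed

end

text \<open>Only orbits and goodness are compared, never the scalars themselves. As
  \<open>\<Phi>\<close> preserves and reflects the relation, taking images of classes is injective
  even where \<open>\<Phi>\<close> is not.\<close>

lemma good_classes_isomorphic:
  assumes S: "weighted_equiv S R" and T: "weighted_equiv T Q"
    and surj: "\<Phi> ` S = T"
    and rel: "\<And>x y. x \<in> S \<Longrightarrow> y \<in> S \<Longrightarrow> (\<exists>c. R x c y) \<longleftrightarrow> (\<exists>c. Q (\<Phi> x) c (\<Phi> y))"
    and good: "\<And>x. x \<in> S \<Longrightarrow> weighted_equiv.good R x \<longleftrightarrow> weighted_equiv.good Q (\<Phi> x)"
  shows "linearly_isomorphic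
    (subspace_vs (free_vs (weighted_equiv.good_classes S R)) :: ('k::field, _) module)
    (subspace_vs (free_vs (weighted_equiv.good_classes T Q)))"
proof (rule free_vs_isomorphic)
  interpret S: weighted_equiv S R by (rule S)
  interpret T: weighted_equiv T Q by (rule T)
  have S_cls: "S.cls x = {y \<in> S. \<exists>c. R x c y}" if "x \<in> S" for x
    using S.cls_subset[OF that] by (auto simp: S.cls_def)
  have T_cls: "T.cls x = {y \<in> T. \<exists>c. Q x c y}" if "x \<in> T" for x
    using T.cls_subset[OF that] by (auto simp: T.cls_def)
  have img: "\<Phi> ` S.cls x = T.cls (\<Phi> x)" if x: "x \<in> S" for x
  proof -
    have "T.cls (\<Phi> x) = {y \<in> \<Phi> ` S. \<exists>c. Q (\<Phi> x) c y}"
      using T_cls[of "\<Phi> x"] x surj by blast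
    also have "\<dots> = \<Phi> ` {y \<in> S. \<exists>c. Q (\<Phi> x) c (\<Phi> y)}" by blast
    also have "{y \<in> S. \<exists>c. Q (\<Phi> x) c (\<Phi> y)} = S.cls x"
      using rel x unfolding S_cls[OF x] by blast
    finally show ?thesis by (rule HOL.sym)
  qed
  have "inj_on ((`) \<Phi>) S.good_classes"
  proof (rule inj_onI)
    fix C D assume "C \<in> S.good_classes" "D \<in> S.good_classes" and eq: "\<Phi> ` C = \<Phi> ` D"
    then obtain x y where xy: "x \<in> S" "y \<in> S" "C = S.cls x" "D = S.cls y"
      by (auto simp: S.good_classes_def)
    then have "\<Phi> x \<in> T" "\<Phi> y \<in> T" using surj by auto
    then have "\<exists>c. Q (\<Phi> x) c (\<Phi> y)"
      using eq img xy T.cls_self[of "\<Phi> y"] by (auto simp: T.cls_def)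
    then show "C = D" using rel xy S.cls_eq by metis
  qed
  moreover have "(`) \<Phi> ` S.good_classes = T.good_classes"
  proof -
    have "(`) \<Phi> ` S.good_classes = (\<lambda>x. T.cls (\<Phi> x)) ` {x \<in> S. S.good x}"
      by (auto simp: S.good_classes_def img image_image intro!: image_cong)
    also have "\<dots> = T.cls ` \<Phi> ` {x \<in> S. S.good x}" by (simp add: image_image)
    also have "\<Phi> ` {x \<in> S. S.good x} = {x \<in> T. T.good x}" using surj good by auto
    finally show ?thesis by (simp add: T.good_classes_def)
  qed
  ultimately show "bij_betw ((`) \<Phi>) S.good_classes T.good_classes" by (simp add: bij_betw_def)
qed

subsection \<open>Surfaces glued from polygons\<close>

text \<open>
  The side x of a polygon runs from the corner v (\<iota> x) to the corner v x.
\<close>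

fun lpath :: "('h \<Rightarrow> 'h) \<Rightarrow> ('h \<Rightarrow> 'c) \<Rightarrow> 'c \<Rightarrow> 'h list \<Rightarrow> 'c \<Rightarrow> bool" where
  "lpath \<iota> v a [] b \<longleftrightarrow> a = b"
| "lpath \<iota> v a (x # w) b \<longleftrightarrow> a = v (\<iota> x) \<and> lpath \<iota> v (v x) w b"

lemma lpath_append: "lpath \<iota> v a (u @ w) b \<longleftrightarrow> (\<exists>c. lpath \<iota> v a u c \<and> lpath \<iota> v c w b)"
  by (induction u arbitrary: a) auto

lemma lpath_cong:
  assumes "lpath \<iota> v a w b" "\<And>x. x \<in> set w \<Longrightarrow> v x = v' x \<and> v (\<iota> x) = v' (\<iota> x)"
  shows "lpath \<iota> v' a w b"
  using assms by (induction w arbitrary: a) auto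

lemma lpath_end: "lpath \<iota> v a w b \<Longrightarrow> b = a \<or> b \<in> v ` set w"
  by (induction w arbitrary: a) auto

text \<open>Let \<open>y\<close> be the side right after \<open>e\<close>. If its partner lies
  outside the block between \<open>e\<close> and \<open>\<iota> e\<close>, the two pairs interleave;
  otherwise \<open>y\<close> and its partner enclose a shorter block, and the descent ends with two
  adjacent partners.\<close>

lemma split_interleaved:
  assumes "B \<noteq> []" "\<And>x. x \<in> set (A @ e # B @ \<iota> e # C) \<Longrightarrow> \<iota> x \<in> set (A @ e # B @ \<iota> e # C) \<and> \<iota> x \<noteq> x"
    and "\<And>x. \<iota> (\<iota> x) = x" and "distinct (A @ e # B @ \<iota> e # C)"
  shows "(\<exists>A' y C'. A @ e # B @ \<iota> e # C = A' @ y # \<iota> y # C') \<or>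
    (\<exists>A' x B' y C' D' E'. A @ e # B @ \<iota> e # C = A' @ x # B' @ y # C' @ \<iota> x # D' @ \<iota> y # E')"
  using assms
proof (induction "length B" arbitrary: A e B C rule: less_induct)
  case less
  obtain y B1 where B: "B = y # B1" using less.prems(1) by (cases B) auto
  have iy: "\<iota> y \<in> set (A @ e # B @ \<iota> e # C)" "\<iota> y \<noteq> y" using less.prems(2)[of y] by (auto simp: B)
  have "\<iota> y \<noteq> e" using less.prems(3)[of y] less.prems(4) by (auto simp: B)
  moreover have "\<iota> y \<noteq> \<iota> e" using less.prems(3)[of y] less.prems(3)[of e] less.prems(4) by (auto simp: B)
  ultimately consider "\<iota> y \<in> set A" | "\<iota> y \<in> set B1" | "\<iota> y \<in> set C" using iy by (auto simp: B)
  then show ?case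
  proof cases
    case 1
    then obtain A1 A2 where A: "A = A1 @ \<iota> y # A2" by (meson split_list)
    have "A @ e # B @ \<iota> e # C = A1 @ \<iota> y # A2 @ e # [] @ \<iota> (\<iota> y) # B1 @ \<iota> e # C"
      by (simp add: A B less.prems(3))
    then show ?thesis by blast
  next
    case 2
    then obtain B2 B3 where B1: "B1 = B2 @ \<iota> y # B3" by (meson split_list)
    have eq: "A @ e # B @ \<iota> e # C = (A @ [e]) @ y # B2 @ \<iota> y # (B3 @ \<iota> e # C)"
      by (simp add: B B1)
    show ?thesis
    proof (cases "B2 = []")
      case True
      then show ?thesis unfolding eq by (metis append_Nil)
    next
      case False
      show ?thesis unfolding eq
        by (rule less.hyps) (use False less.prems in \<open>auto simp: B B1 simp flip: eq\<close>)
    qed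
  next
    case 3
    then obtain C1 C2 where C: "C = C1 @ \<iota> y # C2" by (meson split_list)
    have "A @ e # B @ \<iota> e # C = A @ e # [] @ y # B1 @ \<iota> e # C1 @ \<iota> y # C2"
      by (simp add: B C)
    then show ?thesis by blast
  qed
qed

text \<open>
  W is the word of the polygon that contains the base corner b, and the \<omega> i are the words of the
  others. The assumption universal says that v is the finest labelling of the corners compatible with
  the gluing: the quantified \<theta> and t are two-valued labellings of the glued corners, and they cannot
  separate two corners with the same label v. Without this the number of labels would not be
  determined by the words.
\<close>

locale polygons =
  fixes \<iota> :: "'h \<Rightarrow> 'h" and v :: "'h \<Rightarrow> 'c" and b :: 'c
    and H :: "'h set" and W :: "'h list" and I :: "'i set" and \<omega> :: "'i \<Rightarrow> 'h list"
  assumes invol: "\<iota> (\<iota> x) = x"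
    and finite_H: "finite H"
    and iota_closed: "x \<in> H \<Longrightarrow> \<iota> x \<in> H"
    and iota_fpf: "x \<in> H \<Longrightarrow> \<iota> x \<noteq> x"
    and finite_I: "finite I"
    and distinct_W: "distinct W"
    and distinct_face: "i \<in> I \<Longrightarrow> distinct (\<omega> i)"
    and disjoint_W: "i \<in> I \<Longrightarrow> set W \<inter> set (\<omega> i) = {}"
    and disjoint_face: "i \<in> I \<Longrightarrow> j \<in> I \<Longrightarrow> i \<noteq> j \<Longrightarrow> set (\<omega> i) \<inter> set (\<omega> j) = {}"
    and H_eq: "H = set W \<union> (\<Union>i\<in>I. set (\<omega> i))"
    and path_W: "lpath \<iota> v b W b"
    and path_face: "i \<in> I \<Longrightarrow> \<exists>a. lpath \<iota> v a (\<omega> i) a"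
    and connected: "J \<subseteq> I \<Longrightarrow> J \<noteq> {} \<Longrightarrow>
      \<exists>j\<in>J. \<exists>k\<in>set (\<omega> j). \<iota> k \<notin> (\<Union>j\<in>J. set (\<omega> j))"
    and universal: "lpath \<iota> \<theta> t W t \<Longrightarrow> (\<And>i. i \<in> I \<Longrightarrow> \<exists>a. lpath \<iota> \<theta> a (\<omega> i) a) \<Longrightarrow> x \<in> H \<Longrightarrow>
      (v x = b \<longrightarrow> \<theta> x = (t::bool)) \<and> (\<forall>y\<in>H. v x = v y \<longrightarrow> \<theta> x = \<theta> y)"
begin

text \<open>Connectedness with \<open>J = I\<close> yields a side of another polygon whose partner
  lies on the base polygon. Gluing along it replaces \<open>e\<close> by \<open>D @ C\<close>, the
  boundary of the other polygon read from behind \<open>\<iota> e\<close> round to its front. Both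
  ends of the removed edge are still met by remaining sides or are the base corner.\<close>

lemma merge_faces:
  assumes "I \<noteq> {}"
  obtains i A e B C D where "i \<in> I" "W = A @ e # B" "\<omega> i = C @ \<iota> e # D"
    "e \<in> H" "polygons \<iota> v b (H - {e, \<iota> e}) (A @ D @ C @ B) (I - {i}) \<omega>"
    "insert b (v ` (H - {e, \<iota> e})) = insert b (v ` H)"
proof -
  obtain i e' where i: "i \<in> I" "e' \<in> set (\<omega> i)" "\<iota> e' \<notin> (\<Union>j\<in>I. set (\<omega> j))"
    using connected[OF subset_refl assms] by blast
  define e where "e = \<iota> e'"
  have e: "\<iota> e \<in> set (\<omega> i)" "e \<notin> (\<Union>j\<in>I. set (\<omega> j))" using i by (simp_all add: e_def invol)
  have eH: "e \<in> H" using i iota_closed[of e'] by (auto simp: H_eq e_def)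
  then have "e \<in> set W" using e by (auto simp: H_eq)
  then obtain A B where W: "W = A @ e # B" by (meson split_list)
  obtain C D where w: "\<omega> i = C @ \<iota> e # D" using e(1) by (meson split_list)
  have ne: "\<iota> e \<noteq> e" using iota_fpf eH by blast
  have dW: "distinct (A @ e # B)" "set (A @ e # B) \<inter> set (C @ \<iota> e # D) = {}" "distinct (C @ \<iota> e # D)"
    using distinct_W disjoint_W[OF i(1)] distinct_face[OF i(1)] by (simp_all only: W w)
  have others: "e \<notin> set (\<omega> j)" "\<iota> e \<notin> set (\<omega> j)" "set (\<omega> j) \<inter> set (A @ D @ C @ B) = {}"
    if j: "j \<in> I - {i}" for j
    using disjoint_W[of j] disjoint_face[of i j] j i(1) e by (auto simp: W w)
  have H': "H - {e, \<iota> e} = set (A @ D @ C @ B) \<union> (\<Union>j\<in>I - {i}. set (\<omega> j))"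
  proof -
    have "H = set (A @ D @ C @ B) \<union> (\<Union>j\<in>I - {i}. set (\<omega> j)) \<union> {e, \<iota> e}"
      using i(1) unfolding H_eq by (auto simp: W w)
    then show ?thesis using others dW by auto
  qed
  have iota_ne: "\<iota> x \<noteq> e" "\<iota> x \<noteq> \<iota> e" if "x \<in> H - {e, \<iota> e}" for x
    using that invol[of x] invol[of e] by auto
  obtain a where a: "lpath \<iota> v a (C @ \<iota> e # D) a" using path_face[OF i(1)] w by auto
  have paths: "lpath \<iota> v b A (v (\<iota> e))" "lpath \<iota> v (v e) B b"
      "lpath \<iota> v a C (v e)" "lpath \<iota> v (v (\<iota> e)) D a"
    using path_W a by (auto simp: W lpath_append invol)
  show ?thesis
  proof (rule that[OF i(1) W w eH])
    show "polygons \<iota> v b (H - {e, \<iota> e}) (A @ D @ C @ B) (I - {i}) \<omega>"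
    proof (unfold_locales, goal_cases)
      case 1 then show ?case by (rule invol)
    next
      case 2 then show ?case using finite_H by simp
    next
      case (3 x) then show ?case using iota_closed iota_ne[of x] by auto
    next
      case (4 x) then show ?case using iota_fpf by auto
    next
      case 5 then show ?case using finite_I by simp
    next
      case 6 then show ?case using dW by auto
    next
      case (7 j) then show ?case using distinct_face by simp
    next
      case (8 j) then show ?case using others(3)[of j] by blast
    next
      case (9 j k) then show ?case using disjoint_face by simp
    next
      case 10 then show ?case by (rule H')
    next
      case 11 then show ?case using paths by (auto simp: lpath_append)
    next
      case (12 j) then show ?case using path_face by simp
    next
      case (13 J) then show ?case using connected[of J] by blast
    next
      case (14 \<theta> t x)
      obtain m1 m2 m3 where m: "lpath \<iota> \<theta> t A m1" "lpath \<iota> \<theta> m1 D m2" "lpath \<iota> \<theta> m2 C m3"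
          "lpath \<iota> \<theta> m3 B t"
        using 14(1) by (auto simp: lpath_append)
      \<comment> \<open>A labelling of the merged polygons extends over the removed edge:
        \<open>e\<close> runs from the end \<open>m1\<close> of \<open>A\<close> to the start
        \<open>m3\<close> of \<open>B\<close>, so these are the values at \<open>\<iota> e\<close>
        and \<open>e\<close>. Universality before merging then yields universality after it.\<close>
      define \<theta>' where "\<theta>' = \<theta>(e := m3, \<iota> e := m1)"
      let ?\<theta> = \<theta>'
      have vals: "\<theta>' e = m3" "\<theta>' (\<iota> e) = m1" using ne by (simp_all add: \<theta>'_def)
      have same: "\<theta>' z = \<theta> z" if "z \<in> H - {e, \<iota> e}" for z
        using ne that by (auto simp: \<theta>'_def)
      have cong: "lpath \<iota> ?\<theta> c u d" if u: "lpath \<iota> \<theta> c u d" "set u \<subseteq> H - {e, \<iota> e}" for c u d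
        using u(1) proof (rule lpath_cong)
        fix z assume "z \<in> set u"
        then have "z \<in> H - {e, \<iota> e}" using u(2) by blast
        moreover from this have "\<iota> z \<in> H - {e, \<iota> e}" using iota_ne[of z] iota_closed[of z] by blast
        ultimately show "\<theta> z = ?\<theta> z \<and> \<theta> (\<iota> z) = ?\<theta> (\<iota> z)"
          by (simp add: same)
      qed
      have sub: "set A \<subseteq> H - {e, \<iota> e}" "set D \<subseteq> H - {e, \<iota> e}" "set C \<subseteq> H - {e, \<iota> e}"
          "set B \<subseteq> H - {e, \<iota> e}" "\<And>j. j \<in> I - {i} \<Longrightarrow> set (\<omega> j) \<subseteq> H - {e, \<iota> e}"
        unfolding H' by auto
      note m' = cong[OF m(1) sub(1)] cong[OF m(2) sub(2)] cong[OF m(3) sub(3)] cong[OF m(4) sub(4)]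
      have main: "lpath \<iota> ?\<theta> t W t"
        unfolding W lpath_append lpath.simps vals using m'(1,4) by blast
      have  "\<exists>a. lpath \<iota> ?\<theta> a (\<omega> j) a" if j: "j \<in> I" for j
      proof (cases "j = i")
        case True
        have "lpath \<iota> ?\<theta> m2 (\<omega> i) m2"
          unfolding w lpath_append lpath.simps invol vals using m'(2,3) by blast
        then show ?thesis using True by blast
      next
        case False
        then obtain a where "lpath \<iota> \<theta> a (\<omega> j) a" using 14(2)[of j] j by blast
        then show ?thesis using cong[OF _ sub(5)[of j]] False j by blast
      qed
      then have "(v x = b \<longrightarrow> ?\<theta> x = t) \<and> (\<forall>y\<in>H. v x = v y \<longrightarrow> ?\<theta> x = ?\<theta> y)"
        by (intro universal[OF main]) (use 14(3) in auto)
      then have "(v x = b \<longrightarrow> \<theta>' x = t) \<and> (\<forall>y\<in>H - {e, \<iota> e}. v x = v y \<longrightarrow> \<theta>' x = \<theta>' y)"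
        by blast
      then show ?case using 14(3) by (simp add: same)
    qed
    \<comment> \<open>Each of the three corners is the end of a path that starts at \<open>b\<close>
      or at the preceding one, so it is either that start or a label occurring on the path.\<close>
    have "v (\<iota> e) \<in> insert b (v ` (H - {e, \<iota> e}))" 
      using lpath_end[OF paths(1)] by (auto simp: H')
    moreover have "a \<in> insert b (v ` (H - {e, \<iota> e}))"
      using lpath_end[OF paths(4)] calculation by (auto simp: H')
    moreover from this have "v e \<in> insert b (v ` (H - {e, \<iota> e}))"
      using lpath_end[OF paths(3)] by (auto simp: H')
    ultimately show "insert b (v ` (H - {e, \<iota> e})) = insert b (v ` H)" by auto
  qed
qed

end

section \<open>A single polygon: folding in a spike and cutting off a handle\<close>

locale polygon = polygons \<iota> v b H W "{} :: nat set" "\<lambda>_. []" for \<iota> :: "'h \<Rightarrow> 'h" and v :: "'h \<Rightarrow> 'c" and b H W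

lemma polygonI:
  assumes "\<And>x. \<iota> (\<iota> x) = x" "finite H" "\<And>x. x \<in> H \<Longrightarrow> \<iota> x \<in> H" "\<And>x. x \<in> H \<Longrightarrow> \<iota> x \<noteq> x"
    "distinct W" "set W = H" "lpath \<iota> v b W b"
    "\<And>\<theta> t x. lpath \<iota> \<theta> t W t \<Longrightarrow> x \<in> H \<Longrightarrow>
      (v x = b \<longrightarrow> \<theta> x = (t::bool)) \<and> (\<forall>y\<in>H. v x = v y \<longrightarrow> \<theta> x = \<theta> y)"
  shows "polygon \<iota> v b H W"
  by unfold_locales (use assms in auto)

lemma (in polygons) polygon:
  assumes "I = {}"
  shows "polygon \<iota> v b H W"
  by (rule polygonI) (use invol finite_H iota_closed iota_fpf distinct_W H_eq path_W universal assms in auto)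

context polygon
begin

lemma set_W: "set W = H"
  using H_eq by simp

lemma universal':
  assumes "lpath \<iota> \<theta> t W t" "x \<in> H"
  shows "(v x = b \<longrightarrow> \<theta> x = (t::bool)) \<and> (\<forall>y\<in>H. v x = v y \<longrightarrow> \<theta> x = \<theta> y)"
  by (rule universal[OF assms(1) _ assms(2)]) simp

lemma iota_inj: "\<iota> x = \<iota> y \<longleftrightarrow> x = y"
  by (metis invol)

text \<open>The corner between the adjacent sides \<open>y\<close> and \<open>\<iota> y\<close> is
  the tip of a spike: no other side ends there and it is not the base corner. Folding in the spike
  therefore removes exactly one corner. Excluding only \<open>y\<close> in the second claim also
  separates the tip from the foot of the spike.\<close>

lemma leaf:
  assumes W: "W = A @ y # \<iota> y # B"
  shows "polygon \<iota> v b (H - {y, \<iota> y}) (A @ B)"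
    and "v y \<notin> insert b (v ` (H - {y}))"
    and "v (\<iota> y) \<in> insert b (v ` (H - {y, \<iota> y}))"
    and "y \<in> H"
proof -
  show yH: "y \<in> H" using set_W by (auto simp: W)
  then have ne: "\<iota> y \<noteq> y" by (rule iota_fpf)
  have d: "distinct (A @ y # \<iota> y # B)" using distinct_W W by simp
  have H': "H - {y, \<iota> y} = set (A @ B)" using d set_W by (auto simp: W)
  have iota_ne: "\<iota> x \<noteq> y" "\<iota> x \<noteq> \<iota> y" if "x \<in> H - {y, \<iota> y}" for x
    using that invol[of x] invol[of y] by auto
  have paths: "lpath \<iota> v b A (v (\<iota> y))" "lpath \<iota> v (v (\<iota> y)) B b"
    using path_W by (auto simp: W lpath_append invol)
  show "polygon \<iota> v b (H - {y, \<iota> y}) (A @ B)"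
  proof (rule polygonI, goal_cases)
    case (8 \<theta> t x)
    obtain m where m: "lpath \<iota> \<theta> t A m" "lpath \<iota> \<theta> m B t" using 8(1) by (auto simp: lpath_append)
    define \<theta>' where "\<theta>' = \<theta>(y := m, \<iota> y := m)"
    let ?\<theta> = \<theta>'
    have vals: "\<theta>' y = m" "\<theta>' (\<iota> y) = m" using ne by (simp_all add: \<theta>'_def)
    have same: "\<theta>' z = \<theta> z" if "z \<in> H - {y, \<iota> y}" for z
      using ne that by (auto simp: \<theta>'_def)
    have cong: "lpath \<iota> ?\<theta> c u d" if u: "lpath \<iota> \<theta> c u d" "set u \<subseteq> H - {y, \<iota> y}" for c u d
      using u(1) proof (rule lpath_cong)
        fix z assume "z \<in> set u"
        then have "z \<in> H - {y, \<iota> y}" using u(2) by blast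
        moreover from this have "\<iota> z \<in> H - {y, \<iota> y}" using iota_ne[of z] iota_closed[of z] by blast
        ultimately show "\<theta> z = ?\<theta> z \<and> \<theta> (\<iota> z) = ?\<theta> (\<iota> z)"
          by (simp add: same)
      qed
    have "lpath \<iota> ?\<theta> t W t"
      unfolding W lpath_append lpath.simps invol vals using cong[OF m(1)] cong[OF m(2)] H' by auto
    then have "(v x = b \<longrightarrow> \<theta>' x = t) \<and> (\<forall>z\<in>H - {y, \<iota> y}. v x = v z \<longrightarrow> \<theta>' x = \<theta>' z)"
      using universal'[of ?\<theta> t x] 8(2) by blast
    then show ?case using 8(2) by (simp add: same)
  next
    case 1 then show ?case by (rule invol)
  next
    case 2 then show ?case using finite_H by simp
  next
    case (3 z) then show ?case using iota_closed[of z] iota_ne[of z] by auto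
  next
    case (4 z) then show ?case using iota_fpf by auto
  next
    case 5 then show ?case using d by auto
  next
    case 6 then show ?case by (rule H'[symmetric])
  next
    case 7 then show ?case unfolding lpath_append using paths by blast
  qed
  \<comment> \<open>The indicator of \<open>y\<close> is a labelling compatible with the word,
    because the path reaches the value True by \<open>y\<close> and leaves it at once by
    \<open>\<iota> y\<close>. Universality forbids it to separate equal corners, so
    \<open>v y\<close> is shared with no other side.\<close>
  let ?\<theta> = "\<lambda>x. x = y"
  have False_path: "lpath \<iota> ?\<theta> False u False" if "set u \<subseteq> H - {y, \<iota> y}" for u
    using that by (induction u) (auto simp: iota_ne)
  have "lpath \<iota> ?\<theta> False W False"
    unfolding W lpath_append using H' ne False_path by (intro exI[of _ False]) (auto simp: invol)
  from universal'[OF this yH] show "v y \<notin> insert b (v ` (H - {y}))" by auto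
  show "v (\<iota> y) \<in> insert b (v ` (H - {y, \<iota> y}))" using lpath_end[OF paths(1)] by (auto simp: H')
qed

text \<open>The cut and paste step for two interleaved edges. The blocks are reordered such that
  each starts at the corner where the preceding one ends: \<open>D\<close> starts at the end of
  \<open>A\<close>, \<open>C\<close> at the end of \<open>D\<close>, and \<open>B\<close> at the end
  of \<open>C\<close>.\<close>

lemma handle:
  assumes W: "W = A @ x # B @ y # C @ \<iota> x # D @ \<iota> y # E"
  shows "polygon \<iota> v b (H - {x, \<iota> x, y, \<iota> y}) (A @ D @ C @ B @ E)"
    and "insert b (v ` (H - {x, \<iota> x, y, \<iota> y})) = insert b (v ` H)"
    and "x \<in> H" "y \<in> H" "card {x, \<iota> x, y, \<iota> y} = 4"
    and "lpath \<iota> v b A (v (\<iota> x))" "lpath \<iota> v (v x) B (v (\<iota> y))" "lpath \<iota> v (v y) C (v x)"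
      "lpath \<iota> v (v (\<iota> x)) D (v y)" "lpath \<iota> v (v (\<iota> y)) E b"
proof -
  show xy: "x \<in> H" "y \<in> H" using set_W by (auto simp: W)
  let ?H = "H - {x, \<iota> x, y, \<iota> y}"
  have d: "distinct (A @ x # B @ y # C @ \<iota> x # D @ \<iota> y # E)" using distinct_W W by simp
  then have ne: "x \<noteq> y" "x \<noteq> \<iota> x" "x \<noteq> \<iota> y" "y \<noteq> \<iota> x" "y \<noteq> \<iota> y" "\<iota> x \<noteq> \<iota> y" by auto
  then show "card {x, \<iota> x, y, \<iota> y} = 4" by simp
  have H': "?H = set (A @ D @ C @ B @ E)" using d set_W by (auto simp: W)
  have iota_ne: "\<iota> z \<noteq> x" "\<iota> z \<noteq> \<iota> x" "\<iota> z \<noteq> y" "\<iota> z \<noteq> \<iota> y" if "z \<in> ?H" for z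
    using that invol[of z] invol[of x] invol[of y] by auto
  show paths: "lpath \<iota> v b A (v (\<iota> x))" "lpath \<iota> v (v x) B (v (\<iota> y))" "lpath \<iota> v (v y) C (v x)"
      "lpath \<iota> v (v (\<iota> x)) D (v y)" "lpath \<iota> v (v (\<iota> y)) E b"
    using path_W by (auto simp: W lpath_append invol)
  show "polygon \<iota> v b ?H (A @ D @ C @ B @ E)"
  proof (rule polygonI, goal_cases)
    case (8 \<theta> t z)
    obtain m1 m2 m3 m4 where m: "lpath \<iota> \<theta> t A m1" "lpath \<iota> \<theta> m1 D m2" "lpath \<iota> \<theta> m2 C m3"
        "lpath \<iota> \<theta> m3 B m4" "lpath \<iota> \<theta> m4 E t" 
      using 8(1) by (auto simp: lpath_append)
    \<comment> \<open>The values at the four removed half-edges are read off at the junctions of the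
      new word: \<open>B\<close>, \<open>A\<close>, \<open>C\<close> and \<open>E\<close>
      respectively start or end at the corners of \<open>x\<close>, \<open>\<iota> x\<close>,
      \<open>y\<close> and \<open>\<iota> y\<close>.\<close>
    define \<theta>' where "\<theta>' = \<theta>(x := m3, \<iota> x := m1, y := m2, \<iota> y := m4)"
    let ?\<theta> = \<theta>'
    have vals: "\<theta>' x = m3" "\<theta>' (\<iota> x) = m1" "\<theta>' y = m2" "\<theta>' (\<iota> y) = m4"
      using ne by (simp_all add: \<theta>'_def)
    have same: "\<theta>' u = \<theta> u" if "u \<in> ?H" for u
      using ne that by (auto simp: \<theta>'_def)
    have cong: "lpath \<iota> ?\<theta> c u d" if u: "lpath \<iota> \<theta> c u d" "set u \<subseteq> ?H" for c u d
      using u(1) proof (rule lpath_cong)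
        fix z assume "z \<in> set u"
        then have "z \<in> ?H" using u(2) by blast
        moreover from this have "\<iota> z \<in> ?H" using iota_ne[of z] iota_closed[of z] by blast
        ultimately show "\<theta> z = ?\<theta> z \<and> \<theta> (\<iota> z) = ?\<theta> (\<iota> z)"
          by (simp add: same)
      qed
    have sub: "set A \<subseteq> ?H" "set D \<subseteq> ?H" "set C \<subseteq> ?H" "set B \<subseteq> ?H" "set E \<subseteq> ?H"
      unfolding H' by auto
    note m' = cong[OF m(1) sub(1)] cong[OF m(2) sub(2)] cong[OF m(3) sub(3)]
      cong[OF m(4) sub(4)] cong[OF m(5) sub(5)]
    have "lpath \<iota> ?\<theta> t W t"
      unfolding W lpath_append lpath.simps invol vals using m' by blast
    then have "(v z = b \<longrightarrow> \<theta>' z = t) \<and> (\<forall>u\<in>?H. v z = v u \<longrightarrow> \<theta>' z = \<theta>' u)"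
      using universal'[of ?\<theta> t z] 8(2) by blast
    then show ?case using 8(2) by (simp add: same)
  next
    case 1 then show ?case by (rule invol)
  next
    case 2 then show ?case using finite_H by simp
  next
    case (3 z) then show ?case using iota_closed[of z] iota_ne[of z] by auto
  next
    case (4 z) then show ?case using iota_fpf by auto
  next
    case 5 then show ?case using d by auto
  next
    case 6 then show ?case by (rule H'[symmetric])
  next
    case 7 then show ?case unfolding lpath_append using paths by blast
  qed
  \<comment> \<open>No corner is lost: the paths \<open>A\<close>, \<open>D\<close>,
    \<open>C\<close> and \<open>B\<close> reach the four ends one after the other, starting from the
    base corner.\<close>
  let ?V = "insert b (v ` ?H)"
  have "v (\<iota> x) \<in> ?V" using lpath_end[OF paths(1)] by (auto simp: H')
  moreover from this have "v y \<in> ?V" using lpath_end[OF paths(4)] by (auto simp: H')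
  moreover from this have "v x \<in> ?V" using lpath_end[OF paths(3)] by (auto simp: H')
  moreover from this have "v (\<iota> y) \<in> ?V" using lpath_end[OF paths(2)] by (auto simp: H')
  ultimately show "?V = insert b (v ` H)" by auto
qed

lemma leaf_or_handle:
  assumes "W \<noteq> []"
  shows "(\<exists>A y B. W = A @ y # \<iota> y # B) \<or>
    (\<exists>A x B y C D E. W = A @ x # B @ y # C @ \<iota> x # D @ \<iota> y # E)"
proof -
  obtain e W' where W: "W = e # W'" using assms by (cases W) auto
  have "e \<in> H" using set_W by (auto simp: W)
  then have "\<iota> e \<in> set W'" using iota_closed iota_fpf set_W by (force simp: W)
  then obtain B C where W': "W' = B @ \<iota> e # C" by (meson split_list)
  have eq: "W = [] @ e # B @ \<iota> e # C" by (simp add: W W')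
  show ?thesis
  proof (cases "B = []")
    case True
    then show ?thesis using eq by (metis append_Nil)
  next
    case False
    have "\<And>x. x \<in> set W \<Longrightarrow> \<iota> x \<in> set W \<and> \<iota> x \<noteq> x"
      using iota_closed iota_fpf by (simp add: set_W)
    then show ?thesis
      using split_interleaved[OF False, of "[]" e \<iota> C] invol distinct_W unfolding eq by blast
  qed
qed

end

subsection \<open>Colourings of polygons by group elements\<close>

context group
begin

lemma inv_cancel_left:
  "x \<in> carrier G \<Longrightarrow> y \<in> carrier G \<Longrightarrow> inv x \<otimes> (x \<otimes> y) = y"
  "x \<in> carrier G \<Longrightarrow> y \<in> carrier G \<Longrightarrow> x \<otimes> (inv x \<otimes> y) = y"
  by (simp_all flip: m_assoc)

lemmas word_simps = m_assoc inv_mult_group inv_cancel_left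

definition mprod :: "'a list \<Rightarrow> 'a" where
  "mprod xs = foldr (\<otimes>) xs \<one>"

lemma mprod_simps [simp]: "mprod [] = \<one>" "mprod (x # xs) = x \<otimes> mprod xs"
  by (simp_all add: mprod_def)

lemma mprod_closed [simp]: "set xs \<subseteq> carrier G \<Longrightarrow> mprod xs \<in> carrier G"
  by (induction xs) auto

lemma mprod_append:
  "set xs \<subseteq> carrier G \<Longrightarrow> set ys \<subseteq> carrier G \<Longrightarrow> mprod (xs @ ys) = mprod xs \<otimes> mprod ys"
  by (induction xs) (auto simp: m_assoc)

definition comm :: "'a \<times> 'a \<Rightarrow> 'a" where
  "comm = (\<lambda>(a, b). a \<otimes> b \<otimes> inv a \<otimes> inv b)"

definition conj :: "'a \<Rightarrow> 'a \<times> 'a \<Rightarrow> 'a \<times> 'a" where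
  "conj h = (\<lambda>(a, b). (h \<otimes> a \<otimes> inv h, h \<otimes> b \<otimes> inv h))"

lemma comm_closed [simp]: "a \<in> carrier G \<Longrightarrow> b \<in> carrier G \<Longrightarrow> comm (a, b) \<in> carrier G"
  by (simp add: comm_def)

section \<open>Colourings, gauge transformations and holonomies\<close>

definition colourings :: "('h \<Rightarrow> 'h) \<Rightarrow> 'h set \<Rightarrow> ('h \<Rightarrow> 'a) set" where
  "colourings \<iota> H = {\<tau> \<in> H \<rightarrow>\<^sub>E carrier G. \<forall>k\<in>H. \<tau> (\<iota> k) = inv \<tau> k}"

definition gauge :: "('h \<Rightarrow> 'h) \<Rightarrow> ('h \<Rightarrow> 'c) \<Rightarrow> 'h set \<Rightarrow> ('c \<Rightarrow> 'a) \<Rightarrow> ('h \<Rightarrow> 'a) \<Rightarrow> 'h \<Rightarrow> 'a" where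
  "gauge \<iota> v H \<kappa> \<tau> = (\<lambda>k\<in>H. \<kappa> (v (\<iota> k)) \<otimes> \<tau> k \<otimes> inv \<kappa> (v k))"

lemma colourings_iff:
  "\<tau> \<in> colourings \<iota> H \<longleftrightarrow>
    \<tau> \<in> extensional H \<and> (\<forall>k\<in>H. \<tau> k \<in> carrier G \<and> \<tau> (\<iota> k) = inv \<tau> k)"
  unfolding colourings_def PiE_def Pi_def by blast

lemma colourings_closed: "\<tau> \<in> colourings \<iota> H \<Longrightarrow> k \<in> H \<Longrightarrow> \<tau> k \<in> carrier G"
  unfolding colourings_iff by blast

lemma colourings_inv: "\<tau> \<in> colourings \<iota> H \<Longrightarrow> k \<in> H \<Longrightarrow> \<tau> (\<iota> k) = inv \<tau> k"
  unfolding colourings_iff by blast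

lemma colourings_restrict:
  assumes "\<tau> \<in> colourings \<iota> H" "H' \<subseteq> H" "\<And>k. k \<in> H' \<Longrightarrow> \<iota> k \<in> H'"
  shows "restrict \<tau> H' \<in> colourings \<iota> H'"
  unfolding colourings_iff
proof (intro conjI ballI)
  fix k assume "k \<in> H'"
  then show "restrict \<tau> H' k \<in> carrier G" "restrict \<tau> H' (\<iota> k) = inv restrict \<tau> H' k"
    using assms(3)[of k] colourings_closed[OF assms(1), of k] colourings_inv[OF assms(1), of k] assms(2)
    by auto
qed simp

lemma colourings_eqI:
  assumes "\<tau> \<in> colourings \<iota> H" "\<tau>' \<in> colourings \<iota> H" "\<And>k. k \<in> H \<Longrightarrow> \<tau> k = \<tau>' k"
  shows "\<tau> = \<tau>'"
  by (rule extensionalityI[of _ H]) (use assms in \<open>simp_all add: colourings_iff\<close>)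

lemma gauge_colourings:
  assumes "\<And>c. \<kappa> c \<in> carrier G" "\<And>k. \<iota> (\<iota> k) = k" "\<And>k. k \<in> H \<Longrightarrow> \<iota> k \<in> H" "\<tau> \<in> colourings \<iota> H"
  shows "gauge \<iota> v H \<kappa> \<tau> \<in> colourings \<iota> H"
  unfolding colourings_iff
proof (intro conjI ballI)
  fix k assume "k \<in> H"
  then show "gauge \<iota> v H \<kappa> \<tau> k \<in> carrier G" "gauge \<iota> v H \<kappa> \<tau> (\<iota> k) = inv gauge \<iota> v H \<kappa> \<tau> k"
    using assms(1-3) colourings_closed[OF assms(4), of k] colourings_inv[OF assms(4), of k]
    by (simp_all add: gauge_def word_simps)
qed (simp add: gauge_def)

lemma gauge_gauge:
  assumes "\<And>c. \<kappa> c \<in> carrier G" "\<And>c. \<kappa>' c \<in> carrier G" "\<tau> \<in> colourings \<iota> H"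
  shows "gauge \<iota> v H \<kappa> (gauge \<iota> v H \<kappa>' \<tau>) = gauge \<iota> v H (\<lambda>c. \<kappa> c \<otimes> \<kappa>' c) \<tau>"
proof
  fix k
  show "gauge \<iota> v H \<kappa> (gauge \<iota> v H \<kappa>' \<tau>) k = gauge \<iota> v H (\<lambda>c. \<kappa> c \<otimes> \<kappa>' c) \<tau> k"
    using assms(1,2) colourings_closed[OF assms(3), of k]
    by (cases "k \<in> H") (simp_all add: gauge_def word_simps)
qed

lemma gauge_one:
  assumes "\<tau> \<in> colourings \<iota> H" "\<And>k. k \<in> H \<Longrightarrow> \<iota> k \<in> H"
  shows "gauge \<iota> v H (\<lambda>_. \<one>) \<tau> = \<tau>"
  by (rule extensionalityI[of _ H])
    (use assms(1) colourings_closed[OF assms(1)] in \<open>simp_all add: gauge_def colourings_iff\<close>)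

lemma gauge_restrict:
  assumes "H' \<subseteq> H"
  shows "restrict (gauge \<iota> v H \<kappa> \<tau>) H' = gauge \<iota> v H' \<kappa> (restrict \<tau> H')"
  using assms by (intro ext) (auto simp: gauge_def)

definition hol :: "('h \<Rightarrow> 'a) \<Rightarrow> 'h list \<Rightarrow> 'a" where
  "hol \<tau> w = mprod (map \<tau> w)"

lemma hol_simps [simp]: "hol \<tau> [] = \<one>" "hol \<tau> (x # w) = \<tau> x \<otimes> hol \<tau> w"
  by (simp_all add: hol_def)

lemma hol_closed: "\<tau> \<in> colourings \<iota> H \<Longrightarrow> set w \<subseteq> H \<Longrightarrow> hol \<tau> w \<in> carrier G"
  unfolding hol_def by (rule mprod_closed) (auto simp: colourings_closed)

lemma hol_append:
  "\<tau> \<in> colourings \<iota> H \<Longrightarrow> set u \<subseteq> H \<Longrightarrow> set w \<subseteq> H \<Longrightarrow> hol \<tau> (u @ w) = hol \<tau> u \<otimes> hol \<tau> w"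
  unfolding hol_def map_append by (rule mprod_append) (auto simp: colourings_closed)

lemma hol_cong: "(\<And>x. x \<in> set w \<Longrightarrow> \<tau> x = \<tau>' x) \<Longrightarrow> hol \<tau> w = hol \<tau>' w"
  unfolding hol_def by (metis map_eq_conv)

text \<open>The factors at the intermediate corners of the path telescope.\<close>

lemma hol_gauge:
  assumes "lpath \<iota> v a w b" "set w \<subseteq> H" "\<And>c. \<kappa> c \<in> carrier G" "\<tau> \<in> colourings \<iota> H"
  shows "hol (gauge \<iota> v H \<kappa> \<tau>) w = \<kappa> a \<otimes> hol \<tau> w \<otimes> inv \<kappa> b"
  using assms(1,2)
proof (induction w arbitrary: a)
  case (Cons x w)
  then have "\<tau> x \<in> carrier G" "hol \<tau> w \<in> carrier G"
    using colourings_closed[OF assms(4)] hol_closed[OF assms(4)] by auto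
  moreover have "hol (gauge \<iota> v H \<kappa> \<tau>) w = \<kappa> (v x) \<otimes> hol \<tau> w \<otimes> inv \<kappa> b"
    using Cons by simp
  moreover have "gauge \<iota> v H \<kappa> \<tau> x = \<kappa> a \<otimes> \<tau> x \<otimes> inv \<kappa> (v x)"
    using Cons.prems by (simp add: gauge_def)
  ultimately show ?case using assms(3) by (simp add: word_simps)
qed (use assms in simp)

section \<open>Normal form for one polygon\<close>

definition handles :: "nat \<Rightarrow> ('a \<times> 'a) list set" where
  "handles n = {hs. length hs = n \<and> set hs \<subseteq> carrier G \<times> carrier G}"

lemma handles_0: "handles 0 = {[]}"
  by (auto simp: handles_def)

definition comms :: "('a \<times> 'a) list \<Rightarrow> 'a" where
  "comms hs = mprod (map comm hs)"

text \<open>The count is the Euler characteristic of the surface glued from one polygon: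
  \<open>card H\<close> is twice the number E of edges, so it reads V - E + 1 = 2 - 2n. A spike
  costs one edge and one corner and leaves the handles alone; an interleaved pair costs two edges
  and no corner and contributes one handle. The other clauses identify colourings modulo gauge
  transformations trivial at \<open>b\<close> with \<open>handles n\<close>, compatibly with the
  value of gauge transformations at \<open>b\<close>.\<close>

lemma polygon_normal_form:
  fixes \<iota> :: "'h \<Rightarrow> 'h" and v :: "'h \<Rightarrow> 'c"
  assumes "polygon \<iota> v b H W"
  shows "\<exists>n \<Phi>. card H + 2 = 4 * n + 2 * card (insert b (v ` H)) \<and>
    \<Phi> ` colourings \<iota> H = handles n \<and>
    (\<forall>\<tau>\<in>colourings \<iota> H. hol \<tau> W = comms (\<Phi> \<tau>)) \<and>
    (\<forall>\<kappa>. (\<forall>c. \<kappa> c \<in> carrier G) \<longrightarrow> (\<forall>\<tau>\<in>colourings \<iota> H.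
      \<Phi> (gauge \<iota> v H \<kappa> \<tau>) = map (conj (\<kappa> b)) (\<Phi> \<tau>))) \<and>
    (\<forall>\<tau>\<in>colourings \<iota> H. \<forall>\<tau>'\<in>colourings \<iota> H. \<Phi> \<tau> = \<Phi> \<tau>' \<longrightarrow>
      (\<exists>\<kappa>. (\<forall>c. \<kappa> c \<in> carrier G) \<and> \<kappa> b = \<one> \<and> \<tau>' = gauge \<iota> v H \<kappa> \<tau>))"
    (is "\<exists>n \<Phi>. ?P H W n \<Phi>")
  using assms
proof (induction "length W" arbitrary: H W rule: less_induct)
  case less
  interpret polygon \<iota> v b H W by (rule less.prems)
  consider (empty) "W = []" | (cancelling) A y B where "W = A @ y # \<iota> y # B"
    | (interleaved) A x B y C D E where "W = A @ x # B @ y # C @ \<iota> x # D @ \<iota> y # E"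
    using leaf_or_handle by blast
  then show ?case
  proof cases
    case empty
    then have H: "H = {}" using set_W by simp
    have "?P H W 0 (\<lambda>_. [])"
      unfolding handles_0 using H empty by (auto simp: comms_def colourings_def gauge_def)
    then show ?thesis by blast
  next
    case (cancelling A y B)
    note l = leaf[OF cancelling]
    let ?H = "H - {y, \<iota> y}"
    have H': "?H \<subseteq> H" "\<And>k. k \<in> ?H \<Longrightarrow> \<iota> k \<in> ?H" using iota_closed iota_inj invol by auto
    obtain n \<Phi> where IH: "?P ?H (A @ B) n \<Phi>" using less.hyps[OF _ l(1)] cancelling by auto
    note IH1 = IH[THEN conjunct1] and IH2 = IH[THEN conjunct2, THEN conjunct1]
      and IH3 = IH[THEN conjunct2, THEN conjunct2, THEN conjunct1]
      and IH4 = IH[THEN conjunct2, THEN conjunct2, THEN conjunct2, THEN conjunct1]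
      and IH5 = IH[THEN conjunct2, THEN conjunct2, THEN conjunct2, THEN conjunct2]
    have ne: "\<iota> y \<noteq> y" "\<iota> y \<in> H" using l(4) iota_fpf iota_closed by auto
    define r where "r \<tau> = restrict \<tau> ?H" for \<tau> :: "'h \<Rightarrow> 'a"
    have r: "r \<tau> \<in> colourings \<iota> ?H" if "\<tau> \<in> colourings \<iota> H" for \<tau>
      unfolding r_def using colourings_restrict[OF that H'] .
    have gr: "r (gauge \<iota> v H \<kappa> \<tau>) = gauge \<iota> v ?H \<kappa> (r \<tau>)" for \<kappa> \<tau>
      unfolding r_def by (rule gauge_restrict[OF H'(1)])
    have subs: "set A \<subseteq> ?H" "set B \<subseteq> ?H" using distinct_W set_W by (auto simp: cancelling)
    have subsH: "set A \<subseteq> H" "set B \<subseteq> H" using subs by auto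
    have hol_r: "hol (r \<tau>) w = hol \<tau> w" if "set w \<subseteq> ?H" for \<tau> :: "'h \<Rightarrow> 'a" and w
    proof (rule hol_cong)
      fix z assume "z \<in> set w"
      then have "z \<in> ?H" using that by blast
      then show "r \<tau> z = \<tau> z" by (simp add: r_def)
    qed
    have "?P H W n (\<Phi> \<circ> r)"
    proof (intro conjI ballI allI impI)
      have V: "insert b (v ` H) = insert (v y) (insert b (v ` ?H))"
        using l(3,4) ne(2) by auto
      moreover have "v y \<notin> insert b (v ` ?H)" using l(2) by auto
      ultimately have "card (insert b (v ` H)) = Suc (card (insert b (v ` ?H)))"
        using finite_H by simp
      moreover have "card H = card ?H + 2"
      proof -
        have "card {y, \<iota> y} = 2" using ne by simp
        moreover have "{y, \<iota> y} \<subseteq> H" using l(4) ne by simp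
        ultimately show ?thesis
          using card_Diff_subset[of "{y, \<iota> y}" H] card_mono[OF finite_H, of "{y, \<iota> y}"] by simp
      qed
      ultimately show "card H + 2 = 4 * n + 2 * card (insert b (v ` H))" using IH1 by simp
      have "r ` colourings \<iota> H = colourings \<iota> ?H"
      proof (intro equalityI subsetI)
        fix \<sigma> assume s: "\<sigma> \<in> colourings \<iota> ?H"
        \<comment> \<open>The colour of the cancelled edge is forgotten by \<open>r\<close>; the
          unit is a choice that is its own inverse.\<close>
        define \<tau> where "\<tau> = (\<lambda>k\<in>H. if k \<in> ?H then \<sigma> k else \<one>)"
        have "\<tau> k \<in> carrier G \<and> \<tau> (\<iota> k) = inv \<tau> k" if k: "k \<in> H" for k
        proof (cases "k \<in> ?H")
          case True
          then show ?thesis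
            using k H'(2)[OF True] iota_closed[OF k] colourings_closed[OF s] colourings_inv[OF s]
            by (simp add: \<tau>_def)
        next
          case False
          then have "k = y \<or> k = \<iota> y" using k by blast
          then have "\<iota> k \<notin> ?H" using invol by auto
          then have "\<tau> (\<iota> k) = \<one>" "\<tau> k = \<one>"
            using k False iota_closed[OF k] by (auto simp: \<tau>_def)
          then show ?thesis by simp
        qed
        moreover have "\<tau> \<in> extensional H" by (simp add: \<tau>_def)
        ultimately have t: "\<tau> \<in> colourings \<iota> H" unfolding colourings_def PiE_def Pi_def by blast
        moreover have "\<sigma> = r \<tau>"
          by (rule colourings_eqI[OF s r[OF t]]) (simp add: \<tau>_def r_def)
        ultimately show "\<sigma> \<in> r ` colourings \<iota> H" by blast
      qed (use r in auto)
      then show "(\<Phi> \<circ> r) ` colourings \<iota> H = handles n" using IH2 by (metis image_comp)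
      fix \<tau> assume t: "\<tau> \<in> colourings \<iota> H"
      have "hol \<tau> W = hol \<tau> A \<otimes> (\<tau> y \<otimes> (inv (\<tau> y) \<otimes> hol \<tau> B))"
        using subsH ne l(4) unfolding cancelling
        by (subst hol_append[OF t]) (auto simp: colourings_inv[OF t])
      also have "\<dots> = hol \<tau> (A @ B)"
        using subsH l(4) hol_closed[OF t] colourings_closed[OF t]
        by (subst hol_append[OF t]) (auto simp: inv_cancel_left)
      also have "\<dots> = hol (r \<tau>) (A @ B)" by (rule hol_r[symmetric]) (simp only: set_append Un_least subs)
      finally show "hol \<tau> W = comms ((\<Phi> \<circ> r) \<tau>)" using IH3 r[OF t] by simp
      {
        fix \<kappa> :: "'c \<Rightarrow> 'a" assume "\<forall>c. \<kappa> c \<in> carrier G"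
        then show "(\<Phi> \<circ> r) (gauge \<iota> v H \<kappa> \<tau>) = map (conj (\<kappa> b)) ((\<Phi> \<circ> r) \<tau>)"
          using IH4 r[OF t] by (simp add: gr)
      }
      fix \<tau>' assume t': "\<tau>' \<in> colourings \<iota> H" and eq: "(\<Phi> \<circ> r) \<tau> = (\<Phi> \<circ> r) \<tau>'"
      obtain \<kappa> where \<kappa>: "\<forall>c. \<kappa> c \<in> carrier G" "\<kappa> b = \<one>" "r \<tau>' = gauge \<iota> v ?H \<kappa> (r \<tau>)"
        using IH5 eq r[OF t] r[OF t'] by (metis comp_apply)
      define \<sigma> where "\<sigma> = gauge \<iota> v H \<kappa> \<tau>"
      have s: "\<sigma> \<in> colourings \<iota> H"
        unfolding \<sigma>_def by (rule gauge_colourings[OF _ invol iota_closed t]) (use \<kappa>(1) in simp_all)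
      have agree: "\<sigma> k = \<tau>' k" if "k \<in> ?H" for k
        using fun_cong[OF \<kappa>(3), of k] that unfolding \<sigma>_def gr[symmetric] by (simp add: r_def)
      note sy = colourings_closed[OF s l(4)] colourings_closed[OF t' l(4)]
      \<comment> \<open>no other side meets the corner v y, so gauging there changes only the colour of y\<close>
      define \<kappa>' where "\<kappa>' c = (if c = v y then inv (\<tau>' y) \<otimes> \<sigma> y else \<one>)" for c
      have \<kappa>': "\<kappa>' c \<in> carrier G" "\<kappa>' b = \<one>" for c
        using sy l(2) by (auto simp: \<kappa>'_def)
      have one: "\<kappa>' (v k) = \<one>" if k: "k \<in> H - {y}" for k
      proof -
        have "v k \<in> insert b (v ` (H - {y}))" using k by blast
        then have "v k \<noteq> v y" using l(2) by metis
        then show ?thesis by (simp add: \<kappa>'_def)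
      qed
      have "\<tau>' = gauge \<iota> v H \<kappa>' \<sigma>"
      proof (rule colourings_eqI[OF t'])
        show g: "gauge \<iota> v H \<kappa>' \<sigma> \<in> colourings \<iota> H"
          by (rule gauge_colourings[OF \<kappa>'(1) invol iota_closed s])
        have at_y: "\<tau>' y = gauge \<iota> v H \<kappa>' \<sigma> y"
          using l(4) one[of "\<iota> y"] ne sy by (simp add: gauge_def \<kappa>'_def word_simps)
        fix k assume k: "k \<in> H"
        consider "k \<in> ?H" | "k = y" | "k = \<iota> y" using k by auto
        then show "\<tau>' k = gauge \<iota> v H \<kappa>' \<sigma> k"
        proof cases
          case 1
          then show ?thesis
            using one[of k] one[of "\<iota> k"] H'(2)[OF 1] k agree[OF 1] colourings_closed[OF s k]
            by (simp add: gauge_def)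
        next
          case 3
          then show ?thesis using at_y colourings_inv[OF t' l(4)] colourings_inv[OF g l(4)] by simp
        qed (use at_y in simp)
      qed
      also have "\<dots> = gauge \<iota> v H (\<lambda>c. \<kappa>' c \<otimes> \<kappa> c) \<tau>"
        unfolding \<sigma>_def by (rule gauge_gauge) (use \<kappa> \<kappa>' t in auto)
      finally show "\<exists>\<kappa>. (\<forall>c. \<kappa> c \<in> carrier G) \<and> \<kappa> b = \<one> \<and> \<tau>' = gauge \<iota> v H \<kappa> \<tau>"
        using \<kappa> \<kappa>' by (intro exI[of _ "\<lambda>c. \<kappa>' c \<otimes> \<kappa> c"]) simp
    qed
    then show ?thesis by blast
  next
    case (interleaved A x B y C D E)
    note h = handle[OF interleaved]
    let ?H = "H - {x, \<iota> x, y, \<iota> y}"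
    have H': "?H \<subseteq> H" "\<And>k. k \<in> ?H \<Longrightarrow> \<iota> k \<in> ?H" using iota_closed iota_inj invol by auto
    let ?W = "A @ D @ C @ B @ E"
    obtain n \<Phi> where IH: "?P ?H ?W n \<Phi>" using less.hyps[OF _ h(1)] interleaved by auto
    note IH1 = IH[THEN conjunct1] and IH2 = IH[THEN conjunct2, THEN conjunct1]
      and IH3 = IH[THEN conjunct2, THEN conjunct2, THEN conjunct1]
      and IH4 = IH[THEN conjunct2, THEN conjunct2, THEN conjunct2, THEN conjunct1]
      and IH5 = IH[THEN conjunct2, THEN conjunct2, THEN conjunct2, THEN conjunct2]
    have ne: "x \<noteq> y" "x \<noteq> \<iota> x" "x \<noteq> \<iota> y" "y \<noteq> \<iota> x" "y \<noteq> \<iota> y" "\<iota> x \<noteq> \<iota> y"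
      using distinct_W by (auto simp: interleaved)
    have iH: "\<iota> x \<in> H" "\<iota> y \<in> H" using h(3,4) iota_closed by auto
    define r where "r \<tau> = restrict \<tau> ?H" for \<tau> :: "'h \<Rightarrow> 'a"
    have r: "r \<tau> \<in> colourings \<iota> ?H" if "\<tau> \<in> colourings \<iota> H" for \<tau>
      unfolding r_def using colourings_restrict[OF that H'] .
    have gr: "r (gauge \<iota> v H \<kappa> \<tau>) = gauge \<iota> v ?H \<kappa> (r \<tau>)" for \<kappa> \<tau>
      unfolding r_def by (rule gauge_restrict[OF H'(1)])
    have subs: "set A \<subseteq> ?H" "set B \<subseteq> ?H" "set C \<subseteq> ?H" "set D \<subseteq> ?H" "set E \<subseteq> ?H"
      using distinct_W set_W by (auto simp: interleaved)
    have subsH: "set A \<subseteq> H" "set B \<subseteq> H" "set C \<subseteq> H" "set D \<subseteq> H" "set E \<subseteq> H"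
      using subs by auto
    have hol_r: "hol (r \<tau>) w = hol \<tau> w" if "set w \<subseteq> ?H" for \<tau> :: "'h \<Rightarrow> 'a" and w
    proof (rule hol_cong)
      fix z assume "z \<in> set w"
      then have "z \<in> ?H" using that by blast
      then show "r \<tau> z = \<tau> z" by (simp add: r_def)
    qed
    \<comment> \<open>chosen such that A x B y C x\<inverse> D y\<inverse> E = [a, b'] A D C B E\<close>
    define a where "a \<tau> = hol \<tau> A \<otimes> \<tau> x \<otimes> inv (hol \<tau> C) \<otimes> inv (hol \<tau> D) \<otimes> inv (hol \<tau> A)" for \<tau>
    define b' where "b' \<tau> = hol \<tau> A \<otimes> hol \<tau> D \<otimes> hol \<tau> C \<otimes> hol \<tau> B \<otimes> \<tau> y \<otimes> inv (hol \<tau> D) \<otimes> inv (hol \<tau> A)"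
      for \<tau>
    let ?\<Phi> = "\<lambda>\<tau>. (a \<tau>, b' \<tau>) # \<Phi> (r \<tau>)"
    have cl: "hol \<tau> A \<in> carrier G" "hol \<tau> B \<in> carrier G" "hol \<tau> C \<in> carrier G" "hol \<tau> D \<in> carrier G"
        "hol \<tau> E \<in> carrier G" "\<tau> x \<in> carrier G" "\<tau> y \<in> carrier G" "\<tau> (\<iota> x) = inv \<tau> x" "\<tau> (\<iota> y) = inv \<tau> y"
      if "\<tau> \<in> colourings \<iota> H" for \<tau>
      using hol_closed[OF that] colourings_closed[OF that] colourings_inv[OF that] subsH h by auto
    have equiv: "a (gauge \<iota> v H \<kappa> \<tau>) = \<kappa> b \<otimes> a \<tau> \<otimes> inv \<kappa> b"
        "b' (gauge \<iota> v H \<kappa> \<tau>) = \<kappa> b \<otimes> b' \<tau> \<otimes> inv \<kappa> b"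
      if \<kappa>: "\<forall>c. \<kappa> c \<in> carrier G" and t: "\<tau> \<in> colourings \<iota> H" for \<kappa> \<tau>
    proof -
      have hg: "hol (gauge \<iota> v H \<kappa> \<tau>) w = \<kappa> s \<otimes> hol \<tau> w \<otimes> inv \<kappa> e"
        if "lpath \<iota> v s w e" "set w \<subseteq> H" for s w e
        by (rule hol_gauge[OF that]) (use \<kappa> t in auto)
      have kc: "\<kappa> c \<in> carrier G" for c using \<kappa> by blast
      note hgs = hg[OF h(6) subsH(1)] hg[OF h(7) subsH(2)] hg[OF h(8) subsH(3)] hg[OF h(9) subsH(4)]
      show "a (gauge \<iota> v H \<kappa> \<tau>) = \<kappa> b \<otimes> a \<tau> \<otimes> inv \<kappa> b"
           "b' (gauge \<iota> v H \<kappa> \<tau>) = \<kappa> b \<otimes> b' \<tau> \<otimes> inv \<kappa> b"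
        unfolding a_def b'_def hgs using h(3,4) cl(1-7)[OF t] kc
        by (simp_all add: gauge_def word_simps)
    qed
    have "?P H W (Suc n) ?\<Phi>"
    proof (intro conjI ballI allI impI)
      have "card H = card ?H + 4"
      proof -
        have "{x, \<iota> x, y, \<iota> y} \<subseteq> H" using h(3,4) iH by simp
        then show ?thesis
          using card_Diff_subset[of "{x, \<iota> x, y, \<iota> y}" H] card_mono[OF finite_H, of "{x, \<iota> x, y, \<iota> y}"] h(5)
          by simp
      qed
      then show "card H + 2 = 4 * Suc n + 2 * card (insert b (v ` H))" using IH1 h(2) by simp
      show "?\<Phi> ` colourings \<iota> H = handles (Suc n)"
      proof (intro equalityI subsetI)
        fix hs assume "hs \<in> ?\<Phi> ` colourings \<iota> H"
        then obtain \<tau> where t: "\<tau> \<in> colourings \<iota> H" "hs = ?\<Phi> \<tau>" by blast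
        have "\<Phi> (r \<tau>) \<in> handles n" using IH2 r[OF t(1)] by blast
        then show "hs \<in> handles (Suc n)" using cl[OF t(1)] by (simp add: t(2) handles_def a_def b'_def)
      next
        fix hs assume "hs \<in> handles (Suc n)"
        then obtain a0 b0 hs' where hs: "hs = (a0, b0) # hs'" "hs' \<in> handles n"
            "a0 \<in> carrier G" "b0 \<in> carrier G"
          by (cases hs) (auto simp: handles_def)
        obtain \<sigma> where s: "\<sigma> \<in> colourings \<iota> ?H" "\<Phi> \<sigma> = hs'" using IH2 hs(2) by (metis imageE)
        have cls: "hol \<sigma> A \<in> carrier G" "hol \<sigma> B \<in> carrier G" "hol \<sigma> C \<in> carrier G" "hol \<sigma> D \<in> carrier G"
          using hol_closed[OF s(1)] subs by auto
        \<comment> \<open>\<open>X\<close> and \<open>Y\<close> are the solutions of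
          \<open>a \<tau> = a0\<close> and \<open>b' \<tau> = b0\<close> for the colours of
          \<open>x\<close> and \<open>y\<close>.\<close>
        define X where "X = inv (hol \<sigma> A) \<otimes> a0 \<otimes> hol \<sigma> A \<otimes> hol \<sigma> D \<otimes> hol \<sigma> C"
        define Y where "Y = inv (hol \<sigma> A \<otimes> hol \<sigma> D \<otimes> hol \<sigma> C \<otimes> hol \<sigma> B) \<otimes> b0 \<otimes> hol \<sigma> A \<otimes> hol \<sigma> D"
        have XY: "X \<in> carrier G" "Y \<in> carrier G" using cls hs by (simp_all add: X_def Y_def)
        define \<tau> where "\<tau> = (\<lambda>k\<in>H. if k = x then X else if k = \<iota> x then inv X else
            if k = y then Y else if k = \<iota> y then inv Y else \<sigma> k)"
        have vals: "\<tau> x = X" "\<tau> (\<iota> x) = inv X" "\<tau> y = Y" "\<tau> (\<iota> y) = inv Y"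
          using ne h(3,4) iH by (auto simp: \<tau>_def)
        have vals': "\<tau> k = \<sigma> k" if "k \<in> ?H" for k using that by (auto simp: \<tau>_def)
        have t: "\<tau> \<in> colourings \<iota> H"
        proof -
          have cases: "k = x \<or> k = \<iota> x \<or> k = y \<or> k = \<iota> y \<or> k \<in> ?H" if "k \<in> H" for k using that by auto
          have "\<tau> k \<in> carrier G \<and> \<tau> (\<iota> k) = inv \<tau> k" if "k \<in> H" for k
            using cases[OF that] XY colourings_closed[OF s(1)] colourings_inv[OF s(1)] H'(2)
            by (elim disjE) (simp_all only: vals invol inv_inv inv_closed vals')
          moreover have "\<tau> \<in> extensional H" by (simp add: \<tau>_def)
          ultimately show ?thesis unfolding colourings_def PiE_def Pi_def by blast
        qed
        have rs: "r \<tau> = \<sigma>"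
          by (rule colourings_eqI[OF r[OF t] s(1)]) (simp add: r_def vals')
        have "hol \<tau> w = hol \<sigma> w" if "set w \<subseteq> ?H" for w
          by (rule hol_cong) (use that vals' in blast)
        then have "a \<tau> = a0" "b' \<tau> = b0"
          using subs cls hs XY by (simp_all add: a_def b'_def vals X_def Y_def word_simps)
        then have "hs = ?\<Phi> \<tau>" using s(2) by (simp add: hs(1) rs)
        then show "hs \<in> ?\<Phi> ` colourings \<iota> H" using t by blast
      qed
      fix \<tau> assume t: "\<tau> \<in> colourings \<iota> H"
      note c = cl[OF t]
      have ap: "hol \<tau> (u @ w) = hol \<tau> u \<otimes> hol \<tau> w" if "set u \<subseteq> H" "set w \<subseteq> H" for u w
        using hol_append[OF t that] .
      have "hol \<tau> W = hol \<tau> A \<otimes> (\<tau> x \<otimes> (hol \<tau> B \<otimes> (\<tau> y \<otimes> (hol \<tau> C \<otimes> (inv \<tau> x \<otimes>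
          (hol \<tau> D \<otimes> (inv \<tau> y \<otimes> hol \<tau> E)))))))"
        using subsH h(3,4) iH by (simp add: interleaved ap c(8,9))
      moreover have "hol \<tau> ?W = hol \<tau> A \<otimes> (hol \<tau> D \<otimes> (hol \<tau> C \<otimes> (hol \<tau> B \<otimes> hol \<tau> E)))"
        using subsH by (simp add: ap)
      moreover have "comm (a \<tau>, b' \<tau>) \<otimes> (hol \<tau> A \<otimes> (hol \<tau> D \<otimes> (hol \<tau> C \<otimes> (hol \<tau> B \<otimes> hol \<tau> E))))
          = hol \<tau> A \<otimes> (\<tau> x \<otimes> (hol \<tau> B \<otimes> (\<tau> y \<otimes> (hol \<tau> C \<otimes> (inv \<tau> x \<otimes>
          (hol \<tau> D \<otimes> (inv \<tau> y \<otimes> hol \<tau> E)))))))"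
        using c(1-7) by (simp add: comm_def a_def b'_def word_simps)
      moreover have "hol (r \<tau>) ?W = hol \<tau> ?W" by (rule hol_r) (simp only: set_append Un_least subs)
      moreover have "hol (r \<tau>) ?W = comms (\<Phi> (r \<tau>))" using IH3 r[OF t] by blast
      ultimately show "hol \<tau> W = comms (?\<Phi> \<tau>)" by (simp add: comms_def)
      {
        fix \<kappa> :: "'c \<Rightarrow> 'a" assume \<kappa>: "\<forall>c. \<kappa> c \<in> carrier G"
        then show "?\<Phi> (gauge \<iota> v H \<kappa> \<tau>) = map (conj (\<kappa> b)) (?\<Phi> \<tau>)"
          using IH4 r[OF t] \<kappa> equiv[OF \<kappa> t] by (simp add: gr conj_def)
      }
      fix \<tau>' assume t': "\<tau>' \<in> colourings \<iota> H" and eq: "?\<Phi> \<tau> = ?\<Phi> \<tau>'"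
      obtain \<kappa> where \<kappa>: "\<forall>c. \<kappa> c \<in> carrier G" "\<kappa> b = \<one>" "r \<tau>' = gauge \<iota> v ?H \<kappa> (r \<tau>)"
        using IH5 eq r[OF t] r[OF t'] by (metis comp_apply list.inject)
      define \<sigma> where "\<sigma> = gauge \<iota> v H \<kappa> \<tau>"
      have s: "\<sigma> \<in> colourings \<iota> H"
        unfolding \<sigma>_def by (rule gauge_colourings[OF _ invol iota_closed t]) (use \<kappa>(1) in simp_all)
      have agree: "\<sigma> k = \<tau>' k" if "k \<in> ?H" for k
        using fun_cong[OF \<kappa>(3), of k] that unfolding \<sigma>_def gr[symmetric] by (simp add: r_def)
      have hs: "hol \<sigma> w = hol \<tau>' w" if "set w \<subseteq> ?H" for w
        by (rule hol_cong) (use that agree in blast)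
      \<comment> \<open>Unlike for a spike no further gauge transformation is needed: since
        \<open>\<kappa> b = \<one>\<close>, the handle coordinates of \<open>\<sigma>\<close> are
        those of \<open>\<tau>\<close>, and together with the remaining colours they determine the
        colours of \<open>x\<close> and \<open>y\<close>.\<close>
      have "a \<sigma> = \<kappa> b \<otimes> a \<tau> \<otimes> inv \<kappa> b" "b' \<sigma> = \<kappa> b \<otimes> b' \<tau> \<otimes> inv \<kappa> b"
        unfolding \<sigma>_def by (rule equiv[OF \<kappa>(1) t])+
      then have "a \<sigma> = a \<tau>'" "b' \<sigma> = b' \<tau>'" using eq \<kappa>(2) c by (auto simp: a_def b'_def)
      then have xy: "\<sigma> x = \<tau>' x" "\<sigma> y = \<tau>' y"
        using cl[OF s] cl[OF t'] subs by (simp_all add: a_def b'_def hs m_assoc)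
      have "\<tau>' = \<sigma>"
      proof (rule colourings_eqI[OF t' s])
        fix k assume "k \<in> H"
        then consider "k \<in> ?H" | "k = x" | "k = \<iota> x" | "k = y" | "k = \<iota> y" by blast
        then show "\<tau>' k = \<sigma> k"
          by cases (simp_all add: agree xy cl(8,9)[OF s] cl(8,9)[OF t'])
      qed
      then show "\<exists>\<kappa>. (\<forall>c. \<kappa> c \<in> carrier G) \<and> \<kappa> b = \<one> \<and> \<tau>' = gauge \<iota> v H \<kappa> \<tau>"
        using \<kappa> by (auto simp: \<sigma>_def)
    qed
    then show ?thesis by (intro exI)
  qed
qed

section \<open>Central elements and several polygons with prescribed holonomy\<close>

definition central :: "'a \<Rightarrow> bool" where
  "central z \<longleftrightarrow> z \<in> carrier G \<and> (\<forall>x\<in>carrier G. z \<otimes> x = x \<otimes> z)"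

lemma central_nat_pow:
  assumes "central z"
  shows "central (z [^] (n::nat))"
proof -
  have z: "z \<in> carrier G" "\<And>x. x \<in> carrier G \<Longrightarrow> z \<otimes> x = x \<otimes> z" using assms by (auto simp: central_def)
  have "z [^] n \<otimes> x = x \<otimes> z [^] n" if x: "x \<in> carrier G" for x
  proof (induction n)
    case (Suc n)
    have "z [^] n \<otimes> z \<otimes> x = z [^] n \<otimes> x \<otimes> z" using z x by (simp add: m_assoc)
    also have "\<dots> = x \<otimes> (z [^] n \<otimes> z)" using z x Suc by (simp add: m_assoc)
    finally show ?case by simp
  qed (use x in simp)
  then show ?thesis using z by (simp add: central_def)
qed

lemma central_inv:
  assumes "central z"
  shows "central (inv z)"
proof -
  have z: "z \<in> carrier G" "\<And>x. x \<in> carrier G \<Longrightarrow> z \<otimes> x = x \<otimes> z" using assms by (auto simp: central_def)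
  have "inv z \<otimes> x = x \<otimes> inv z" if x: "x \<in> carrier G" for x
  proof -
    have "inv z \<otimes> x = inv z \<otimes> (x \<otimes> z) \<otimes> inv z" using z(1) x by (simp add: m_assoc)
    also have "\<dots> = x \<otimes> inv z" using z(1) x by (simp add: z(2)[OF x, symmetric] word_simps)
    finally show ?thesis .
  qed
  then show ?thesis using z by (simp add: central_def)
qed

lemma central_int_pow: "central z \<Longrightarrow> central (z [^] (k::int))"
  unfolding int_pow_def2 by (metis central_nat_pow central_inv)

lemma central_closed: "central z \<Longrightarrow> z \<in> carrier G"
  by (simp add: central_def)

lemma central_comm: "central z \<Longrightarrow> x \<in> carrier G \<Longrightarrow> z \<otimes> x = x \<otimes> z"
  unfolding central_def by blast

lemma central_left_comm:
  assumes "central z" "x \<in> carrier G" "y \<in> carrier G"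
  shows "x \<otimes> (z \<otimes> y) = z \<otimes> (x \<otimes> y)"
proof -
  have "x \<otimes> (z \<otimes> y) = (z \<otimes> x) \<otimes> y"
    using assms by (simp add: central_closed central_comm m_assoc)
  then show ?thesis using assms by (simp add: central_closed m_assoc)
qed

text \<open>Along a closed path a gauge transformation conjugates the holonomy, which a central
  value survives. This makes the constraints on the faces gauge invariant.\<close>

lemma hol_gauge_central:
  assumes "central (hol \<tau> w)" "lpath \<iota> v a w a" "set w \<subseteq> H" "\<And>c. \<kappa> c \<in> carrier G" "\<tau> \<in> colourings \<iota> H"
  shows "hol (gauge \<iota> v H \<kappa> \<tau>) w = hol \<tau> w"
proof -
  have "\<kappa> a \<otimes> hol \<tau> w = hol \<tau> w \<otimes> \<kappa> a" by (rule central_comm[OF assms(1,4), symmetric])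
  then show ?thesis
    using assms(4)[of a] hol_gauge[OF assms(2-5)] hol_closed[OF assms(5,3)]
    by (simp add: m_assoc)
qed

definition constrained ::
    "('h \<Rightarrow> 'h) \<Rightarrow> 'h set \<Rightarrow> 'i set \<Rightarrow> ('i \<Rightarrow> 'h list) \<Rightarrow> ('i \<Rightarrow> 'a) \<Rightarrow> ('h \<Rightarrow> 'a) set" where
  "constrained \<iota> H I \<omega> d = {\<tau> \<in> colourings \<iota> H. \<forall>i\<in>I. hol \<tau> (\<omega> i) = d i}"

text \<open>
  When the face i is merged into W along the side e, its constraint determines the colour of e from
  the remaining ones; the central factor that this produces is carried along as a power of p.
\<close>

lemma polygons_normal_form:
  fixes \<iota> :: "'h \<Rightarrow> 'h" and v :: "'h \<Rightarrow> 'c" and \<omega> :: "'i \<Rightarrow> 'h list" and m :: "'i \<Rightarrow> int"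
  assumes "polygons \<iota> v b H W I \<omega>" and p: "central p"
  shows "\<exists>n \<Phi>. card H + 2 = 4 * n + 2 * card (insert b (v ` H)) + 2 * card I \<and>
    \<Phi> ` constrained \<iota> H I \<omega> (\<lambda>i. p [^] m i) = handles n \<and>
    (\<forall>\<tau>\<in>constrained \<iota> H I \<omega> (\<lambda>i. p [^] m i). hol \<tau> W \<otimes> p [^] sum m I = comms (\<Phi> \<tau>)) \<and>
    (\<forall>\<kappa>. (\<forall>c. \<kappa> c \<in> carrier G) \<longrightarrow> (\<forall>\<tau>\<in>constrained \<iota> H I \<omega> (\<lambda>i. p [^] m i).
      \<Phi> (gauge \<iota> v H \<kappa> \<tau>) = map (conj (\<kappa> b)) (\<Phi> \<tau>))) \<and>
    (\<forall>\<tau>\<in>constrained \<iota> H I \<omega> (\<lambda>i. p [^] m i). \<forall>\<tau>'\<in>constrained \<iota> H I \<omega> (\<lambda>i. p [^] m i).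
      \<Phi> \<tau> = \<Phi> \<tau>' \<longrightarrow> (\<exists>\<kappa>. (\<forall>c. \<kappa> c \<in> carrier G) \<and> \<kappa> b = \<one> \<and> \<tau>' = gauge \<iota> v H \<kappa> \<tau>))"
    (is "\<exists>n \<Phi>. ?P H W I n \<Phi>")
  using assms(1)
proof (induction "card I" arbitrary: H W I)
  case 0
  interpret polygons \<iota> v b H W I \<omega> by (rule 0(2))
  have I: "I = {}" using 0(1) finite_I by simp
  have c: "constrained \<iota> H I \<omega> d = colourings \<iota> H" for d by (simp add: constrained_def I)
  have pz: "p [^] sum m I = \<one>" by (simp add: I)
  obtain n \<Phi> where *: "card H + 2 = 4 * n + 2 * card (insert b (v ` H))"
    "\<Phi> ` colourings \<iota> H = handles n" "\<forall>\<tau>\<in>colourings \<iota> H. hol \<tau> W = comms (\<Phi> \<tau>)"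
    "\<forall>\<kappa>. (\<forall>c. \<kappa> c \<in> carrier G) \<longrightarrow> (\<forall>\<tau>\<in>colourings \<iota> H.
      \<Phi> (gauge \<iota> v H \<kappa> \<tau>) = map (conj (\<kappa> b)) (\<Phi> \<tau>))"
    "\<forall>\<tau>\<in>colourings \<iota> H. \<forall>\<tau>'\<in>colourings \<iota> H. \<Phi> \<tau> = \<Phi> \<tau>' \<longrightarrow>
      (\<exists>\<kappa>. (\<forall>c. \<kappa> c \<in> carrier G) \<and> \<kappa> b = \<one> \<and> \<tau>' = gauge \<iota> v H \<kappa> \<tau>)"
    using polygon_normal_form[OF polygon[OF I]] by blast
  have "hol \<tau> W \<otimes> p [^] sum m I = comms (\<Phi> \<tau>)" if "\<tau> \<in> colourings \<iota> H" for \<tau>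
    using *(3) that hol_closed[OF that, of W] H_eq by (simp add: pz)
  then have "?P H W I n \<Phi>" unfolding c using * by (simp add: I)
  then show ?case by (intro exI)
next
  case (Suc N)
  interpret polygons \<iota> v b H W I \<omega> by (rule Suc.prems)
  have "I \<noteq> {}" using Suc(2) by auto
  then obtain i A e B C D where i: "i \<in> I" and W: "W = A @ e # B" and w: "\<omega> i = C @ \<iota> e # D"
    and e: "e \<in> H" and sub: "polygons \<iota> v b (H - {e, \<iota> e}) (A @ D @ C @ B) (I - {i}) \<omega>"
    and V: "insert b (v ` (H - {e, \<iota> e})) = insert b (v ` H)"
    by (rule merge_faces)
  let ?H = "H - {e, \<iota> e}" and ?I = "I - {i}" and ?W = "A @ D @ C @ B"
  interpret s: polygons \<iota> v b ?H ?W ?I \<omega> by (rule sub)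
  have cI: "N = card ?I" "card I = Suc (card ?I)" using Suc(2) i finite_I by auto
  define S where "S = constrained \<iota> H I \<omega> (\<lambda>i. p [^] m i)"
  define S' where "S' = constrained \<iota> ?H ?I \<omega> (\<lambda>i. p [^] m i)"
  obtain n \<Phi> where IH: "?P ?H ?W ?I n \<Phi>" using Suc.hyps(1)[OF cI(1) sub] by (elim exE)
  note IH = IH[folded S'_def]
  have IH1: "card ?H + 2 = 4 * n + 2 * card (insert b (v ` ?H)) + 2 * card ?I"
    using IH[THEN conjunct1] .
  have IH2: "\<Phi> ` S' = handles n"
    using IH[THEN conjunct2, THEN conjunct1] .
  have IH3: "hol \<tau> ?W \<otimes> p [^] sum m ?I = comms (\<Phi> \<tau>)" if "\<tau> \<in> S'" for \<tau>
    using IH[THEN conjunct2, THEN conjunct2, THEN conjunct1, THEN bspec, OF that] .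
  note IH45 = IH[THEN conjunct2, THEN conjunct2, THEN conjunct2]
  have IH4: "\<Phi> (gauge \<iota> v ?H \<kappa> \<tau>) = map (conj (\<kappa> b)) (\<Phi> \<tau>)"
    if "\<forall>c. \<kappa> c \<in> carrier G" "\<tau> \<in> S'" for \<kappa> \<tau>
    using IH45[THEN conjunct1, THEN spec, THEN mp, OF that(1), THEN bspec, OF that(2)] .
  have IH5: "\<exists>\<kappa>. (\<forall>c. \<kappa> c \<in> carrier G) \<and> \<kappa> b = \<one> \<and> \<tau>' = gauge \<iota> v ?H \<kappa> \<tau>"
    if "\<tau> \<in> S'" "\<tau>' \<in> S'" "\<Phi> \<tau> = \<Phi> \<tau>'" for \<tau> \<tau>'
    using IH45[THEN conjunct2, THEN bspec, OF that(1), THEN bspec, OF that(2), THEN mp, OF that(3)] .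
  have ne: "\<iota> e \<noteq> e" "\<iota> e \<in> H" using e iota_fpf iota_closed by auto
  have H': "?H \<subseteq> H" by auto
  have subs: "set A \<subseteq> ?H" "set B \<subseteq> ?H" "set C \<subseteq> ?H" "set D \<subseteq> ?H" "\<And>j. j \<in> ?I \<Longrightarrow> set (\<omega> j) \<subseteq> ?H"
    using s.H_eq by auto
  have subsH: "set A \<subseteq> H" "set B \<subseteq> H" "set C \<subseteq> H" "set D \<subseteq> H" using subs by auto
  define z where "z = p [^] m i"
  have z: "central z" "z \<in> carrier G" unfolding z_def using p central_int_pow central_closed by auto
  define r where "r \<tau> = restrict \<tau> ?H" for \<tau> :: "'h \<Rightarrow> 'a"
  have S: "\<tau> \<in> colourings \<iota> H" "hol \<tau> (\<omega> i) = z" "\<And>j. j \<in> ?I \<Longrightarrow> hol \<tau> (\<omega> j) = p [^] m j"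
    if "\<tau> \<in> S" for \<tau> using that i by (auto simp: S_def constrained_def z_def)
  have hol_r: "hol (r \<tau>) u = hol \<tau> u" if "set u \<subseteq> ?H" for \<tau> u
  proof (rule hol_cong)
    fix k assume "k \<in> set u"
    then have "k \<in> ?H" using that by blast
    then show "r \<tau> k = \<tau> k" by (simp add: r_def)
  qed
  have r: "r \<tau> \<in> S'" if t: "\<tau> \<in> S" for \<tau>
  proof -
    have "r \<tau> \<in> colourings \<iota> ?H"
      unfolding r_def by (rule colourings_restrict[OF S(1)[OF t] H' s.iota_closed])
    then show ?thesis using S(3)[OF t] hol_r subs(5) by (simp add: S'_def constrained_def)
  qed
  have gr: "r (gauge \<iota> v H \<kappa> \<tau>) = gauge \<iota> v ?H \<kappa> (r \<tau>)" for \<kappa> \<tau>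
    unfolding r_def by (rule gauge_restrict[OF H'])
  have val_e: "\<tau> e = hol \<tau> D \<otimes> (inv z \<otimes> hol \<tau> C)" if t: "\<tau> \<in> S" for \<tau>
  proof -
    have c: "hol \<tau> C \<in> carrier G" "hol \<tau> D \<in> carrier G" "\<tau> e \<in> carrier G"
      using hol_closed[OF S(1)[OF t]] colourings_closed[OF S(1)[OF t] e] subsH by auto
    have "z = hol \<tau> C \<otimes> (inv \<tau> e \<otimes> hol \<tau> D)"
      using S(2)[OF t] hol_append[OF S(1)[OF t], of C "\<iota> e # D"] subsH ne(2)
        colourings_inv[OF S(1)[OF t] e] by (simp add: w)
    then show ?thesis using c by (simp add: word_simps)
  qed
  \<comment> \<open>Substituting \<open>val_e\<close> turns \<open>e\<close> into \<open>D\<close>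
    and \<open>C\<close> with \<open>inv z\<close> between them; the extra factor \<open>z\<close>
    on the right cancels it because \<open>z\<close> is central.\<close>
  have hol_W: "hol \<tau> W \<otimes> z = hol \<tau> ?W" if t: "\<tau> \<in> S" for \<tau>
  proof -
    note t' = S(1)[OF t]
    have c: "hol \<tau> A \<in> carrier G" "hol \<tau> B \<in> carrier G" "hol \<tau> C \<in> carrier G" "hol \<tau> D \<in> carrier G"
      using hol_closed[OF t'] subsH by auto
    have "hol \<tau> W = hol \<tau> A \<otimes> (hol \<tau> D \<otimes> (inv z \<otimes> (hol \<tau> C \<otimes> hol \<tau> B)))"
      using hol_append[OF t', of A "e # B"] subsH e c z by (simp add: W val_e[OF t] m_assoc)
    moreover have "hol \<tau> ?W = hol \<tau> A \<otimes> (hol \<tau> D \<otimes> (hol \<tau> C \<otimes> hol \<tau> B))"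
      using subsH by (simp add: hol_append[OF t'])
    moreover have "inv z \<otimes> (hol \<tau> C \<otimes> hol \<tau> B) \<otimes> z = hol \<tau> C \<otimes> hol \<tau> B"
      using c z by (simp add: m_assoc central_comm[OF z(1), symmetric])
        (simp add: central_left_comm[OF z(1)] inv_cancel_left)
    ultimately show ?thesis using c z by (simp add: m_assoc)
  qed
  have "?P H W I n (\<Phi> \<circ> r)"
    unfolding S_def[symmetric]
  proof (intro conjI ballI allI impI)
    have "card H = card ?H + 2"
    proof -
      have "card {e, \<iota> e} = 2" using ne by simp
      moreover have "{e, \<iota> e} \<subseteq> H" using e ne by simp
      ultimately show ?thesis
        using card_Diff_subset[of "{e, \<iota> e}" H] card_mono[OF finite_H, of "{e, \<iota> e}"] by simp
    qed
    then show "card H + 2 = 4 * n + 2 * card (insert b (v ` H)) + 2 * card I"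
      using IH1 V cI(2) by simp
    have "S' \<subseteq> r ` S"
    proof
      fix \<sigma> assume s: "\<sigma> \<in> S'"
      then have s': "\<sigma> \<in> colourings \<iota> ?H" by (simp add: S'_def constrained_def)
      define E where "E = hol \<sigma> D \<otimes> (inv z \<otimes> hol \<sigma> C)"
      have c: "hol \<sigma> C \<in> carrier G" "hol \<sigma> D \<in> carrier G" "E \<in> carrier G"
        using hol_closed[OF s'] subs z by (auto simp: E_def)
      define \<tau> where "\<tau> = (\<lambda>k\<in>H. if k = e then E else if k = \<iota> e then inv E else \<sigma> k)"
      have vals: "\<tau> e = E" "\<tau> (\<iota> e) = inv E" using e ne by (auto simp: \<tau>_def)
      have vals': "\<tau> k = \<sigma> k" if "k \<in> ?H" for k using that by (auto simp: \<tau>_def)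
      have "\<tau> k \<in> carrier G \<and> \<tau> (\<iota> k) = inv \<tau> k" if "k \<in> H" for k
      proof -
        from that consider "k \<in> ?H" | "k = e" | "k = \<iota> e" by blast
        then show ?thesis
          by cases (use c s.iota_closed colourings_closed[OF s'] colourings_inv[OF s'] in
            \<open>simp_all only: vals vals' invol inv_inv inv_closed\<close>)
      qed
      moreover have "\<tau> \<in> extensional H" by (simp add: \<tau>_def)
      ultimately have t: "\<tau> \<in> colourings \<iota> H" unfolding colourings_iff by blast
      have hol_t: "hol \<tau> u = hol \<sigma> u" if "set u \<subseteq> ?H" for u
        by (rule hol_cong) (use that vals' in blast)
      have "hol \<tau> (\<omega> i) = hol \<sigma> C \<otimes> (inv E \<otimes> hol \<sigma> D)"
        using hol_append[OF t, of C "\<iota> e # D"] subsH ne(2) subs by (simp add: w hol_t vals)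
      also have "\<dots> = z" using c z by (simp add: E_def word_simps)
      finally have "hol \<tau> (\<omega> j) = p [^] m j" if "j \<in> I" for j
        using s that subs(5)[of j] hol_t[of "\<omega> j"]
        by (cases "j = i") (auto simp: z_def S'_def constrained_def)
      then have "\<tau> \<in> S" using t by (simp add: S_def constrained_def)
      moreover have "r \<tau> = \<sigma>"
        by (rule colourings_eqI[OF _ s'])
          (use r[OF \<open>\<tau> \<in> S\<close>] in \<open>simp_all add: r_def vals' S'_def constrained_def\<close>)
      ultimately show "\<sigma> \<in> r ` S" by blast
    qed
    then have "r ` S = S'" using r by blast
    then show "(\<Phi> \<circ> r) ` S = handles n" using IH2 by (metis image_comp)
    fix \<tau> assume t: "\<tau> \<in> S"
    have "sum m I = m i + sum m ?I" using i finite_I by (simp add: sum.remove)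
    then have "hol \<tau> W \<otimes> p [^] sum m I = hol \<tau> W \<otimes> z \<otimes> p [^] sum m ?I"
      using central_closed[OF p] hol_closed[OF S(1)[OF t], of W] H_eq z
      by (simp add: int_pow_mult z_def m_assoc)
    also have "\<dots> = hol (r \<tau>) ?W \<otimes> p [^] sum m ?I"
      by (subst hol_r) (simp_all only: set_append Un_least subs hol_W[OF t])
    finally show "hol \<tau> W \<otimes> p [^] sum m I = comms ((\<Phi> \<circ> r) \<tau>)" using IH3[OF r[OF t]] by simp
    {
      fix \<kappa> :: "'c \<Rightarrow> 'a" assume \<kappa>: "\<forall>c. \<kappa> c \<in> carrier G"
      then show "(\<Phi> \<circ> r) (gauge \<iota> v H \<kappa> \<tau>) = map (conj (\<kappa> b)) ((\<Phi> \<circ> r) \<tau>)"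
        using IH4[OF \<kappa> r[OF t]] by (simp add: gr)
    }
    fix \<tau>' assume t': "\<tau>' \<in> S" and eq: "(\<Phi> \<circ> r) \<tau> = (\<Phi> \<circ> r) \<tau>'"
    obtain \<kappa> where \<kappa>: "\<forall>c. \<kappa> c \<in> carrier G" "\<kappa> b = \<one>" "r \<tau>' = gauge \<iota> v ?H \<kappa> (r \<tau>)"
      using IH5[OF r[OF t] r[OF t']] eq by auto
    define \<sigma> where "\<sigma> = gauge \<iota> v H \<kappa> \<tau>"
    have sc: "\<sigma> \<in> colourings \<iota> H"
      unfolding \<sigma>_def by (rule gauge_colourings[OF _ invol iota_closed S(1)[OF t]]) (use \<kappa>(1) in simp_all)
    have "hol \<sigma> (\<omega> j) = p [^] m j" if j: "j \<in> I" for j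
    proof -
      have eq: "hol \<tau> (\<omega> j) = p [^] m j" using t j by (simp add: S_def constrained_def)
      obtain a where "lpath \<iota> v a (\<omega> j) a" using path_face[OF j] by blast
      then show ?thesis
        unfolding \<sigma>_def eq[symmetric]
        by (rule hol_gauge_central[rotated])
          (use eq j H_eq \<kappa>(1) S(1)[OF t] p in \<open>auto simp: central_int_pow\<close>)
    qed
    then have s: "\<sigma> \<in> S" using sc by (simp add: S_def constrained_def)
    have agree: "\<sigma> k = \<tau>' k" if "k \<in> ?H" for k
      using fun_cong[OF \<kappa>(3), of k] that unfolding \<sigma>_def gr[symmetric] by (simp add: r_def)
    have hs: "hol \<sigma> u = hol \<tau>' u" if "set u \<subseteq> ?H" for u
      by (rule hol_cong) (use that agree in blast)
    have at_e: "\<sigma> e = \<tau>' e" using val_e[OF s] val_e[OF t'] hs subs by simp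
    have "\<tau>' = \<sigma>"
    proof (rule colourings_eqI[OF S(1)[OF t'] sc])
      fix k assume "k \<in> H"
      then consider "k \<in> ?H" | "k = e" | "k = \<iota> e" by blast
      then show "\<tau>' k = \<sigma> k"
        by cases (simp_all add: agree at_e colourings_inv[OF S(1)[OF t'] e] colourings_inv[OF sc e])
    qed
    then show "\<exists>\<kappa>. (\<forall>c. \<kappa> c \<in> carrier G) \<and> \<kappa> b = \<one> \<and> \<tau>' = gauge \<iota> v H \<kappa> \<tau>"
      using \<kappa> by (auto simp: \<sigma>_def)
  qed
  then show ?case by (intro exI)
qed

subsection \<open>Homomorphisms from surface groups\<close>

definition weval :: "('x \<Rightarrow> 'a) \<Rightarrow> 'x word \<Rightarrow> 'a" where
  "weval s w = mprod (map (\<lambda>(x, b). if b then s x else inv s x) w)"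

lemma weval_simps [simp]:
  "weval s [] = \<one>" "weval s ((x, b) # w) = (if b then s x else inv s x) \<otimes> weval s w"
  by (simp_all add: weval_def)

lemma weval_closed:
  "(\<And>x. x \<in> X \<Longrightarrow> s x \<in> carrier G) \<Longrightarrow> w \<in> words X \<Longrightarrow> weval s w \<in> carrier G"
  by (induction w) (auto simp: words_def)

lemma weval_append:
  assumes "\<And>x. x \<in> X \<Longrightarrow> s x \<in> carrier G" "u \<in> words X" "w \<in> words X"
  shows "weval s (u @ w) = weval s u \<otimes> weval s w"
  using assms(2)
proof (induction u)
  case Nil
  then show ?case using weval_closed[of X s, OF assms(1,3)] by simp
next
  case (Cons a u)
  then obtain x b where a: "a = (x, b)" "x \<in> X" "u \<in> words X" by (cases a) (auto simp: words_def)
  then show ?case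
    using Cons.IH assms(1)[of x] weval_closed[of X s, OF assms(1,3)] weval_closed[of X s, OF assms(1) a(3)]
    by (simp add: m_assoc)
qed

lemma weval_pres_eq:
  assumes s: "\<And>x. x \<in> X \<Longrightarrow> s x \<in> carrier G"
    and R: "\<And>l r. (l, r) \<in> R \<Longrightarrow> weval s l = weval s r"
    and "pres_eq X R u w"
  shows "weval s u = weval s w"
  using assms(3)
proof (induction rule: pres_eq.induct)
  case (cancel u v x b)
  have c: "weval s u \<in> carrier G" "weval s v \<in> carrier G"
    using weval_closed[of X s, OF s cancel(1)] weval_closed[of X s, OF s cancel(2)] by blast+
  have w: "[(x, b), (x, \<not> b)] \<in> words X" using cancel by (simp add: words_def)
  have "weval s (u @ [(x, b), (x, \<not> b)] @ v) = weval s u \<otimes> (weval s [(x, b), (x, \<not> b)] \<otimes> weval s v)"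
    using weval_append[of X s, OF s cancel(1) words_append[OF w cancel(2)]] weval_append[of X s, OF s w cancel(2)]
    by (simp only:)
  also have "weval s [(x, b), (x, \<not> b)] = \<one>" using s[OF cancel(3)] by simp
  finally show ?case using c weval_append[of X s, OF s cancel(1,2)] by simp
next
  case (rel u v l r)
  have "weval s (u @ y @ v) = weval s u \<otimes> (weval s y \<otimes> weval s v)" if "y \<in> words X" for y
    using weval_append[of X s, OF s rel(1) words_append[OF that rel(2)]] weval_append[of X s, OF s that rel(2)]
    by (simp only:)
  then show ?case using rel R by simp
qed simp_all

lemma hom_presented_group:
  assumes f: "f \<in> hom (presented_group X R) G" and w: "w \<in> words X"
  shows "f (word_class X R w) = weval (\<lambda>x. f (word_class X R [(x, True)])) w"
  using w
proof (induction w)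
  interpret P: group "presented_group X R" by (rule group_presented_group)
  interpret f: group_hom "presented_group X R" G f
    by unfold_locales (rule f)
  {
    case Nil
    have "word_class X R [] = \<one>\<^bsub>presented_group X R\<^esub>" by (simp add: presented_group_def)
    then show ?case by simp
  next
    case (Cons a w)
    then obtain x b where a: "a = (x, b)" "x \<in> X" "w \<in> words X" by (cases a) (auto simp: words_def)
    have l: "[(x, c)] \<in> words X" for c using a by (simp add: words_def)
    have cl: "u \<in> words X \<Longrightarrow> word_class X R u \<in> carrier (presented_group X R)" for u
      by (simp add: presented_group_def)
    have split: "f (word_class X R (u @ w)) = f (word_class X R u) \<otimes> f (word_class X R w)"
      if "u \<in> words X" "w \<in> words X" for u w
      using f.hom_mult[OF cl[OF that(1)] cl[OF that(2)]] that by (simp add: presented_group_mult)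
    \<comment> \<open>Cancelling in this order shows that the inverse letter goes to a left inverse
      of the image of \<open>x\<close>.\<close>
    have "pres_eq X R ([(x, False)] @ [(x, True)]) []"
      using pres_eq.cancel[of "[]" X "[]" x R False] a by (simp add: words_def)
    then have "f (word_class X R ([(x, False)] @ [(x, True)])) = f (word_class X R [])"
      using word_class_eq_iff[of "[(x, False)] @ [(x, True)]" X R "[]"] l words_append by metis
    also have "f (word_class X R []) = \<one>"
      using f.hom_one by (simp add: presented_group_def)
    finally have "f (word_class X R [(x, False)]) \<otimes> f (word_class X R [(x, True)]) = \<one>"
      unfolding split[OF l l] .
    then have "f (word_class X R [(x, False)]) = inv f (word_class X R [(x, True)])"
      using f.hom_closed cl l by (metis inv_equality)
    moreover have "f (word_class X R (a # w)) = f (word_class X R [(x, b)]) \<otimes> f (word_class X R w)"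
      using split[OF l a(3)] by (simp add: a)
    ultimately show ?case using Cons.IH[OF a(3)] by (simp add: a)
  }
qed

lemma presented_group_lift:
  assumes s: "\<And>x. x \<in> X \<Longrightarrow> s x \<in> carrier G"
    and R: "\<And>l r. (l, r) \<in> R \<Longrightarrow> weval s l = weval s r"
  shows "\<exists>f\<in>Hom_grp (presented_group X R) G. \<forall>x\<in>X. f (word_class X R [(x, True)]) = s x"
proof
  let ?P = "presented_group X R"
  \<comment> \<open>The class is evaluated on an arbitrary representative;
    \<open>weval_pres_eq\<close> makes the choice immaterial because \<open>s\<close> satisfies the
    relations.\<close>
  define f where "f = (\<lambda>A\<in>carrier ?P. weval s (SOME u. u \<in> A))"
  have f: "f (word_class X R u) = weval s u" if u: "u \<in> words X" for u
  proof -
    have "u \<in> word_class X R u" using u by (auto simp: word_class_def intro: pres_eq.refl)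
    then have "(SOME v. v \<in> word_class X R u) \<in> word_class X R u" by (rule someI)
    then have "weval s u = weval s (SOME v. v \<in> word_class X R u)"
      by (intro weval_pres_eq[of X s R, OF s R]) (auto simp: word_class_def)
    then show ?thesis using u by (simp add: f_def presented_group_def)
  qed
  have c: "\<exists>u\<in>words X. A = word_class X R u" if "A \<in> carrier ?P" for A
    using that by (auto simp: presented_group_def)
  have "f \<in> hom ?P G"
  proof (rule homI)
    fix A B assume "A \<in> carrier ?P" "B \<in> carrier ?P"
    then obtain u w where uw: "u \<in> words X" "w \<in> words X" "A = word_class X R u" "B = word_class X R w"
      using c by meson
    show "f A \<in> carrier G" using uw f weval_closed[of X s, OF s] by simp
    show "f (A \<otimes>\<^bsub>?P\<^esub> B) = f A \<otimes> f B"
      using uw by (simp add: presented_group_mult f words_append weval_append[of X s, OF s])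
  qed
  then show "f \<in> Hom_grp ?P G" by (simp add: Hom_grp_def f_def)
  show "\<forall>x\<in>X. f (word_class X R [(x, True)]) = s x"
    using s by (simp add: f words_def)
qed

lemma weval_surf_word:
  assumes "\<And>i. i \<in> {1..g} \<Longrightarrow> s (Alpha i) \<in> carrier G \<and> s (Beta i) \<in> carrier G"
  shows "weval s (surf_word g) = comms (map (\<lambda>i. (s (Beta i), inv s (Alpha i))) (rev [1..<g + 1]))"
proof -
  let ?w = "\<lambda>i. [(Beta i, True), (Alpha i, False), (Beta i, False), (Alpha i, True)]"
  let ?X = "Alpha ` {1..g} \<union> Beta ` {1..g}"
  have s: "s x \<in> carrier G" if "x \<in> ?X" for x using assms that by auto
  have "weval s (concat (map ?w is)) = comms (map (\<lambda>i. (s (Beta i), inv s (Alpha i))) is)"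
    if "set is \<subseteq> {1..g}" for "is"
    using that
  proof (induction "is")
    case (Cons i "is")
    have w: "?w i \<in> words ?X" "concat (map ?w is) \<in> words ?X" 
      using Cons.prems by (fastforce simp: words_def)+
    have "weval s (concat (map ?w (i # is))) = weval s (?w i) \<otimes> weval s (concat (map ?w is))"
      using weval_append[of ?X s, OF s w] by simp
    moreover have "weval s (?w i) = comm (s (Beta i), inv s (Alpha i))"
      using Cons.prems assms[of i] by (simp add: comm_def m_assoc)
    ultimately show ?case using Cons by (simp add: comms_def)
  qed (simp add: comms_def)
  from this[of "rev [1..<g + 1]"] show ?thesis
    by (simp add: surf_word_def atLeastLessThanSuc_atLeastAtMost del: upt_Suc)
qed

section \<open>Homomorphisms from the surface group as lists of handles\<close>

abbreviation surf_cls :: "nat \<Rightarrow> surf_gen \<Rightarrow> surf_gen word set" where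
  "surf_cls g x \<equiv> word_class (surf_gens g) (surf_rels g) [(x, True)]"

definition surf_homs :: "nat \<Rightarrow> 'a \<Rightarrow> (surf_gen word set \<Rightarrow> 'a) set" where
  "surf_homs g q = {f \<in> Hom_grp (surface_group g) G. f (surface_x g) = q}"

text \<open>The relator consists of commutators of \<open>Beta i\<close> with the inverse of
  \<open>Alpha i\<close>, in the order from \<open>g\<close> down to 1. With this order and the
  inverse in the second component its value is the product of the commutators of the list.\<close>

definition hom_handles :: "nat \<Rightarrow> (surf_gen word set \<Rightarrow> 'a) \<Rightarrow> ('a \<times> 'a) list" where
  "hom_handles g f = map (\<lambda>i. (f (surf_cls g (Beta i)), inv f (surf_cls g (Alpha i)))) (rev [1..<g + 1])"

definition conj_hom :: "nat \<Rightarrow> 'a \<Rightarrow> (surf_gen word set \<Rightarrow> 'a) \<Rightarrow> surf_gen word set \<Rightarrow> 'a" where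
  "conj_hom g h f = (\<lambda>y\<in>carrier (surface_group g). h \<otimes> f y \<otimes> inv h)"

lemma surf_cls_carrier: "x \<in> surf_gens g \<Longrightarrow> surf_cls g x \<in> carrier (surface_group g)"
  by (auto simp: surface_group_def presented_group_def words_def)

lemma Hom_grp_closed: "f \<in> Hom_grp K G \<Longrightarrow> y \<in> carrier K \<Longrightarrow> f y \<in> carrier G"
  by (auto simp: Hom_grp_def hom_def)

lemma conj_hom_Hom:
  assumes "h \<in> carrier G" "f \<in> Hom_grp (surface_group g) G"
  shows "conj_hom g h f \<in> Hom_grp (surface_group g) G"
proof -
  interpret P: group "surface_group g" unfolding surface_group_def by (rule group_presented_group)
  have "conj_hom g h f \<in> hom (surface_group g) G"
  proof (rule homI)
    fix x y assume xy: "x \<in> carrier (surface_group g)" "y \<in> carrier (surface_group g)"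
    then have "f (x \<otimes>\<^bsub>surface_group g\<^esub> y) = f x \<otimes> f y" "f x \<in> carrier G" "f y \<in> carrier G"
      using assms(2) by (auto simp: Hom_grp_def hom_def)
    then show "conj_hom g h f x \<in> carrier G"
      "conj_hom g h f (x \<otimes>\<^bsub>surface_group g\<^esub> y) = conj_hom g h f x \<otimes> conj_hom g h f y"
      using xy assms(1) by (simp_all add: conj_hom_def word_simps)
  qed
  then show ?thesis by (simp add: Hom_grp_def conj_hom_def)
qed

lemma surface_x_carrier: "surface_x g \<in> carrier (surface_group g)"
  using surf_cls_carrier[of Xi g] by (simp add: surface_x_def surf_gens_def)

lemma conj_hom_surf_homs:
  assumes "h \<in> carrier G" "f \<in> surf_homs g q" "central q"
  shows "conj_hom g h f \<in> surf_homs g q"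
proof -
  have "conj_hom g h f (surface_x g) = h \<otimes> q \<otimes> inv h"
    using assms surface_x_carrier by (simp add: conj_hom_def surf_homs_def)
  also have "\<dots> = q"
    using assms(1,3) by (simp add: central_comm[OF assms(3), symmetric] central_closed m_assoc)
  finally show ?thesis using assms conj_hom_Hom by (simp add: surf_homs_def)
qed

lemma hom_handles_conj:
  assumes "h \<in> carrier G" "f \<in> Hom_grp (surface_group g) G"
  shows "hom_handles g (conj_hom g h f) = map (conj h) (hom_handles g f)"
proof -
  have "conj_hom g h f (surf_cls g x) = h \<otimes> f (surf_cls g x) \<otimes> inv h"
    and "f (surf_cls g x) \<in> carrier G" if "x \<in> surf_gens g" for x
    using surf_cls_carrier[OF that] assms Hom_grp_closed by (simp_all add: conj_hom_def)
  then have "inv conj_hom g h f (surf_cls g (Alpha i)) = h \<otimes> inv f (surf_cls g (Alpha i)) \<otimes> inv h"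
    and "conj_hom g h f (surf_cls g (Beta i)) = h \<otimes> f (surf_cls g (Beta i)) \<otimes> inv h"
    if "i \<in> {1..g}" for i
    using assms(1) that by (simp_all add: surf_gens_def word_simps)
  then show ?thesis by (auto simp: hom_handles_def conj_def)
qed

text \<open>Once the central generator goes to \<open>q\<close>, only the images of the others are
  free. The relator becomes \<open>comms hs = q\<close>, and centrality of \<open>q\<close> supplies
  the commutation relations. For \<open>g = 0\<close> no relation ties the generator to the empty
  product, hence \<open>q0\<close>.\<close>

lemma hom_handles_bij:
  assumes q: "central q" and q0: "g = 0 \<Longrightarrow> q = \<one>"
  shows "bij_betw (hom_handles g) (surf_homs g q) {hs \<in> handles g. comms hs = q}"
proof -
  let ?X = "surf_gens g" and ?R = "surf_rels g"
  have gens: "Alpha i \<in> ?X" "Beta i \<in> ?X" if "i \<in> {1..g}" for i using that by (auto simp: surf_gens_def)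
  have closed: "f (surf_cls g x) \<in> carrier G" if "f \<in> surf_homs g q" "x \<in> ?X" for f x
    using that(1) Hom_grp_closed[OF _ surf_cls_carrier[OF that(2)]] by (simp add: surf_homs_def)
  have hom: "f \<in> hom (presented_group ?X ?R) G" if "f \<in> surf_homs g q" for f
    using that by (simp add: surf_homs_def Hom_grp_def surface_group_def)
  have into: "hom_handles g f \<in> {hs \<in> handles g. comms hs = q}" if f: "f \<in> surf_homs g q" for f
  proof -
    have "hom_handles g f \<in> handles g"
      using closed[OF f] gens by (auto simp: handles_def hom_handles_def)
    moreover have "comms (hom_handles g f) = q"
    proof (cases "g = 0")
      case True
      then show ?thesis using q0 by (simp add: hom_handles_def comms_def)
    next
      case False
      have w: "surf_word g \<in> words ?X" "[(Xi, True)] \<in> words ?X"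
        by (auto simp: surf_word_def words_def surf_gens_def)
      have "pres_eq ?X ?R ([] @ surf_word g @ []) ([] @ [(Xi, True)] @ [])"
        using w False by (intro pres_eq.rel) (auto simp: surf_rels_def words_def)
      then have "word_class ?X ?R (surf_word g) = surface_x g"
        using word_class_eq_iff[OF w(1)] by (simp add: surface_x_def)
      then have "q = f (word_class ?X ?R (surf_word g))" using f by (simp add: surf_homs_def)
      also have "\<dots> = comms (hom_handles g f)"
        unfolding hom_presented_group[OF hom[OF f] w(1)] hom_handles_def
        by (rule weval_surf_word) (use closed[OF f] gens in auto)
      finally show ?thesis by simp
    qed
    ultimately show ?thesis by simp
  qed
  moreover have "inj_on (hom_handles g) (surf_homs g q)"
  proof (rule inj_onI)
    fix f f' assume ff: "f \<in> surf_homs g q" "f' \<in> surf_homs g q" "hom_handles g f = hom_handles g f'"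
    have agree: "f (surf_cls g (Beta i)) = f' (surf_cls g (Beta i)) \<and>
        inv f (surf_cls g (Alpha i)) = inv f' (surf_cls g (Alpha i))" if "i \<in> {1..g}" for i
      using ff(3) that unfolding hom_handles_def map_eq_conv by (simp del: upt_Suc)
    have "f (surf_cls g x) = f' (surf_cls g x)" if x: "x \<in> ?X" for x
    proof (cases x)
      case Xi
      then show ?thesis using ff(1,2) by (simp add: surf_homs_def surface_x_def)
    next
      case (Alpha i)
      then have "i \<in> {1..g}" using x by (auto simp: surf_gens_def)
      then have "inv f (surf_cls g x) = inv f' (surf_cls g x)"
        using agree by (simp add: Alpha)
      then show ?thesis using closed ff x by (metis inv_inv)
    next
      case (Beta i)
      then have "i \<in> {1..g}" using x by (auto simp: surf_gens_def)
      then show ?thesis using agree by (simp add: Beta)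
    qed
    then have weval: "weval (\<lambda>x. f (surf_cls g x)) w = weval (\<lambda>x. f' (surf_cls g x)) w"
      if "w \<in> words ?X" for w
      using that by (induction w) (auto simp: words_def)
    show "f = f'"
    proof (rule extensionalityI[of _ "carrier (surface_group g)"])
      fix A assume "A \<in> carrier (surface_group g)"
      then obtain w where w: "w \<in> words ?X" "A = word_class ?X ?R w"
        by (auto simp: surface_group_def presented_group_def)
      then show "f A = f' A"
        using hom_presented_group[OF hom[OF ff(1)] w(1)] hom_presented_group[OF hom[OF ff(2)] w(1)] weval
        by simp
    qed (use ff in \<open>simp_all add: surf_homs_def Hom_grp_def\<close>)
  qed
  moreover have "hs \<in> hom_handles g ` surf_homs g q" if hs: "hs \<in> handles g" "comms hs = q" for hs
  proof -
    have len: "length hs = g" using hs by (simp add: handles_def)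
    \<comment> \<open>The list descends from index \<open>g\<close>, so the handle of index
      \<open>i\<close> sits at position \<open>g - i\<close>.\<close>
    define s where "s x = (case x of Alpha i \<Rightarrow> inv snd (hs ! (g - i)) | Beta i \<Rightarrow> fst (hs ! (g - i)) | Xi \<Rightarrow> q)"
      for x
    have hs_i: "fst (hs ! (g - i)) \<in> carrier G \<and> snd (hs ! (g - i)) \<in> carrier G" if "i \<in> {1..g}" for i
    proof -
      have "hs ! (g - i) \<in> set hs" using that len by (intro nth_mem) auto
      then have "hs ! (g - i) \<in> carrier G \<times> carrier G" using hs(1) by (auto simp: handles_def)
      then show ?thesis by (simp add: mem_Times_iff)
    qed
    have s: "s x \<in> carrier G" if "x \<in> ?X" for x
      using that hs_i central_closed[OF q] by (auto simp: s_def surf_gens_def)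
    have hs_eq: "map (\<lambda>i. (s (Beta i), inv s (Alpha i))) (rev [1..<g + 1]) = hs"
    proof (rule nth_equalityI)
      show "length (map (\<lambda>i. (s (Beta i), inv s (Alpha i))) (rev [1..<g + 1])) = length hs"
        by (simp add: len del: upt_Suc)
      fix k assume "k < length (map (\<lambda>i. (s (Beta i), inv s (Alpha i))) (rev [1..<g + 1]))"
      then have k: "k < g" by (simp del: upt_Suc)
      then have "rev [1..<g + 1] ! k = g - k" by (simp add: rev_nth del: upt_Suc)
      then show "map (\<lambda>i. (s (Beta i), inv s (Alpha i))) (rev [1..<g + 1]) ! k = hs ! k"
        using k hs_i[of "g - k"] by (simp add: s_def del: upt_Suc)
    qed
    have "weval s l = weval s r" if lr: "(l, r) \<in> ?R" for l r
    proof (cases "l = surf_word g \<and> r = [(Xi, True)]")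
      case True
      have "weval s (surf_word g) = q"
        using weval_surf_word[of g s] s gens hs_eq hs(2) by simp
      moreover have "s Xi = q" by (simp add: s_def)
      ultimately show ?thesis using True central_closed[OF q] by simp
    next
      case False
      then obtain y where y: "y \<in> Alpha ` {1..g} \<union> Beta ` {1..g}"
          "l = [(Xi, True), (y, True)]" "r = [(y, True), (Xi, True)]"
        using lr unfolding surf_rels_def by (cases "g = 0") auto
      then have "s y \<in> carrier G" using s gens by auto
      moreover have "s Xi = q" by (simp add: s_def)
      ultimately show ?thesis using y central_comm[OF q] central_closed[OF q] by simp
    qed
    then obtain f where f: "f \<in> Hom_grp (presented_group ?X ?R) G"
        "\<forall>x\<in>?X. f (word_class ?X ?R [(x, True)]) = s x"
      using presented_group_lift[of ?X s ?R] s by blast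
    have "f (surface_x g) = s Xi" using f(2) by (simp add: surface_x_def surf_gens_def)
    then have "f \<in> surf_homs g q" using f(1) by (simp add: surf_homs_def surface_group_def s_def)
    moreover have "hom_handles g f = hs"
      unfolding hs_eq[symmetric] hom_handles_def using f(2) gens by auto
    ultimately show ?thesis by blast
  qed
  ultimately show ?thesis unfolding bij_betw_def by blast
qed

end

subsection \<open>Ciliated ribbon graphs\<close>

lemma set_support:
  "permutation f \<Longrightarrow> set (support f x) = orbit f x"
  by (auto simp: support_set orbit_altdef_permutation simp del: set_map)

lemma lpath_rev_funpow:
  "lpath \<iota> v a (rev (map (\<lambda>i. (f ^^ i) k) [0..<Suc n])) b \<longleftrightarrow>
    a = v (\<iota> ((f ^^ n) k)) \<and> b = v k \<and> (\<forall>i<n. v ((f ^^ Suc i) k) = v (\<iota> ((f ^^ i) k)))"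
proof (induction n arbitrary: a)
  case (Suc n)
  have eq: "rev (map (\<lambda>i. (f ^^ i) k) [0..<Suc (Suc n)]) =
      (f ^^ Suc n) k # rev (map (\<lambda>i. (f ^^ i) k) [0..<Suc n])" by simp
  show ?case unfolding eq lpath.simps Suc.IH using less_Suc_eq by (auto simp del: funpow.simps)
qed auto

text \<open>In the reversed cycle \<open>f x\<close> stands directly before \<open>x\<close>, so the
  path continues if the end of \<open>f x\<close> is the start of \<open>x\<close>. The list itself
  gives this for all entries but the last power of \<open>f\<close>; requiring equal end points
  gives it there too, as \<open>f\<close> leads from there back to \<open>k\<close>.\<close>

lemma lpath_rev_support:
  assumes "permutation f"
  shows "lpath \<iota> v a (rev (support f k)) a \<longleftrightarrow> a = v k \<and> (\<forall>x\<in>set (support f k). v (f x) = v (\<iota> x))"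
proof -
  obtain n where n: "least_power f k = Suc n"
    using least_power_of_permutation(2)[OF assms, of k] by (metis gr0_implies_Suc)
  have last: "(f ^^ Suc n) k = k" using least_power_of_permutation(1)[OF assms, of k] n by simp
  have "(\<forall>x\<in>set (support f k). v (f x) = v (\<iota> x)) \<longleftrightarrow>
      (\<forall>i<Suc n. v ((f ^^ Suc i) k) = v (\<iota> ((f ^^ i) k)))"
    unfolding n by (auto simp del: upt_Suc)
  also have "\<dots> \<longleftrightarrow> v k = v (\<iota> ((f ^^ n) k)) \<and> (\<forall>i<n. v ((f ^^ Suc i) k) = v (\<iota> ((f ^^ i) k)))"
    using last less_Suc_eq by (auto simp del: funpow.simps)
  finally show ?thesis unfolding n lpath_rev_funpow by (auto simp del: funpow.simps)
qed

locale ciliated =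
  fixes \<Gamma> :: "nat ciliated_graph"
  assumes kitaev: "kitaev_graph \<Gamma>"
begin

abbreviation "H \<equiv> halfedges \<Gamma>"
abbreviation "\<iota> \<equiv> iota \<Gamma>"
abbreviation "\<rho> \<equiv> rho \<Gamma>"
abbreviation "\<phi> \<equiv> face_perm \<Gamma>"

lemma ribbon: "finite H" "\<iota> permutes H" "\<rho> permutes H" "h \<in> H \<Longrightarrow> \<iota> (\<iota> h) = h" "h \<in> H \<Longrightarrow> \<iota> h \<noteq> h"
  using kitaev by (auto simp: kitaev_graph_def ribbon_graph_def)

lemma iota_iota: "\<iota> (\<iota> h) = h"
  using ribbon(2,4) by (cases "h \<in> H") (auto simp: permutes_def)

lemma iota_in: "\<iota> h \<in> H \<longleftrightarrow> h \<in> H" and rho_in: "\<rho> h \<in> H \<longleftrightarrow> h \<in> H"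
  using ribbon(2,3) by (simp_all add: permutes_in_image)

abbreviation "rho_inv \<equiv> inv_into UNIV \<rho>"

lemma rho_inv: "\<rho> (rho_inv h) = h" "rho_inv (\<rho> h) = h" "rho_inv h \<in> H \<longleftrightarrow> h \<in> H"
  using ribbon(3) permutes_inverses[OF ribbon(3)] permutes_in_image[OF permutes_inv[OF ribbon(3)]] by auto

lemma phi_permutes: "\<phi> permutes H"
  unfolding face_perm_def by (intro permutes_compose ribbon permutes_inv)

lemma permutations: "permutation \<rho>" "permutation \<iota>" "permutation \<phi>"
  using ribbon phi_permutes by (auto simp: permutation_permutes)

lemma orbit_subset_H: "f permutes H \<Longrightarrow> h \<in> H \<Longrightarrow> orbit f h \<subseteq> H"
  by (rule permutes_orbit_subset)

text \<open>Applied to membership in a set of half-edges, to see that the faces are glued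
  connectedly, and to the character of a stabilizing gauge transformation, to see that it is
  constant.\<close>

lemma connected_invariant:
  assumes "\<And>h. h \<in> H \<Longrightarrow> f (\<iota> h) = f h" "\<And>h. h \<in> H \<Longrightarrow> f (\<rho> h) = f h" "h \<in> H" "k \<in> H"
  shows "f h = f k"
proof -
  have all: "f (\<iota> h) = f h" "f (\<rho> h) = f h" for h
    using assms(1,2)[of h] ribbon(2,3) by (cases "h \<in> H"; simp add: permutes_def)+
  let ?r = "{(h, \<iota> h) | h. True} \<union> {(h, \<rho> h) | h. True}"
  have "(h, k) \<in> (?r \<union> ?r\<inverse>)\<^sup>*"
    using kitaev assms(3,4) by (simp add: kitaev_graph_def connected_graph_def Let_def)
  then show ?thesis by (induction rule: rtrancl_induct) (auto simp: all)
qed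

abbreviation "C \<equiv> cilia \<Gamma>"

lemma cilia: "C \<subseteq> H" "finite C" "pt \<Gamma> \<in> C"
  using kitaev ribbon(1) by (auto simp: kitaev_graph_def intro: finite_subset)

text \<open>Vertices are named by their cilia, so that corner labels, gauge parameters and tensor
  factors of the acting Hopf algebra share one index set.\<close>

definition cil :: "nat \<Rightarrow> nat" where
  "cil h = inv_into C (vertex_of \<Gamma>) (vertex_of \<Gamma> h)"

lemma vertex_bij: "bij_betw (vertex_of \<Gamma>) C (vertices \<Gamma>)"
  using kitaev by (simp add: kitaev_graph_def)

lemma cil:
  assumes "h \<in> H"
  shows "cil h \<in> C" "vertex_of \<Gamma> (cil h) = vertex_of \<Gamma> h"
proof -
  have "vertex_of \<Gamma> h \<in> vertex_of \<Gamma> ` C"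
    using vertex_bij assms by (auto simp: bij_betw_def vertices_def)
  then show "cil h \<in> C" "vertex_of \<Gamma> (cil h) = vertex_of \<Gamma> h"
    unfolding cil_def by (rule inv_into_into, rule f_inv_into_f)
qed

lemma cil_eq_iff: "h \<in> H \<Longrightarrow> k \<in> H \<Longrightarrow> cil h = cil k \<longleftrightarrow> vertex_of \<Gamma> h = vertex_of \<Gamma> k"
  using cil unfolding cil_def by metis

lemma cil_cilium: "c \<in> C \<Longrightarrow> cil c = c"
  using vertex_bij by (simp add: cil_def bij_betw_def)

lemma orbit_perm_eq:
  assumes "permutation f" "k \<in> orbit f h"
  shows "orbit f k = orbit f h"
  using assms permutation_self_in_orbit orbit_trans orbit_swap by (metis subset_antisym subsetI)

lemma vertex_eq_iff: "vertex_of \<Gamma> h = vertex_of \<Gamma> k \<longleftrightarrow> h \<in> orbit \<rho> k"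
  unfolding vertex_of_def
  using orbit_perm_eq[OF permutations(1)] permutation_self_in_orbit[OF permutations(1)] by metis

lemma cil_eq: "h \<in> H \<Longrightarrow> c \<in> C \<Longrightarrow> cil h = c \<longleftrightarrow> h \<in> orbit \<rho> c"
  using cil_eq_iff[of h c] cil_cilium[of c] cilia(1) vertex_eq_iff by auto

lemma cil_rho: "h \<in> H \<Longrightarrow> cil (\<rho> h) = cil h"
  using cil_eq_iff[of "\<rho> h" h] rho_in vertex_eq_iff by (auto intro: orbit.base)

lemma cil_rho_inv: "h \<in> H \<Longrightarrow> cil (rho_inv h) = cil h"
  using cil_rho[of "rho_inv h"] rho_inv by simp

text \<open>The face is read backwards because in the coaction the first half-edge of the cycle
  receives the last tensor factor: the degree read off is the product along the reversed cycle. In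
  this order consecutive sides also meet head to tail.\<close>

definition word :: "nat \<Rightarrow> nat list" where
  "word c = rev (support \<phi> (rho_inv c))"

lemma set_word: "set (word c) = orbit \<phi> (rho_inv c)"
  unfolding word_def set_rev by (rule set_support[OF permutations(3)])

lemma distinct_word: "distinct (word c)"
  unfolding word_def distinct_rev by (rule cycle_of_permutation[OF permutations(3)])

text \<open>Since \<open>\<phi> x\<close> is \<open>rho_inv (\<iota> x)\<close>, closing up along a
  face means that \<open>\<theta>\<close> does not change when passing from \<open>\<iota> x\<close>
  to its predecessor at the same vertex. Over all faces this says that \<open>\<theta>\<close> is
  constant on vertices.\<close>

lemma lpath_word: "lpath \<iota> \<theta> a (word c) a \<longleftrightarrow>
    a = \<theta> (rho_inv c) \<and> (\<forall>x\<in>set (word c). \<theta> (rho_inv (\<iota> x)) = \<theta> (\<iota> x))"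
  unfolding word_def set_rev lpath_rev_support[OF permutations(3)] by (simp add: face_perm_def)

lemma face_bij: "bij_betw (\<lambda>c. orbit \<phi> (rho_inv c)) C (faces \<Gamma>)"
  using kitaev by (simp add: kitaev_graph_def face_of_def)

lemma H_eq_words: "H = (\<Union>c\<in>C. set (word c))"
proof
  show "(\<Union>c\<in>C. set (word c)) \<subseteq> H"
    unfolding set_word using orbit_subset_H[OF phi_permutes] rho_inv(3) cilia(1) by blast
  show "H \<subseteq> (\<Union>c\<in>C. set (word c))"
  proof
    fix h assume "h \<in> H"
    then have "orbit \<phi> h \<in> (\<lambda>c. orbit \<phi> (rho_inv c)) ` C"
      using face_bij by (auto simp: bij_betw_def faces_def face_of_def)
    then show "h \<in> (\<Union>c\<in>C. set (word c))"
      unfolding set_word using permutation_self_in_orbit[OF permutations(3), of h] by auto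
  qed
qed

lemma disjoint_words: "c \<in> C \<Longrightarrow> d \<in> C \<Longrightarrow> c \<noteq> d \<Longrightarrow> set (word c) \<inter> set (word d) = {}"
  unfolding set_word using orbit_perm_eq[OF permutations(3)] face_bij
  unfolding bij_betw_def inj_on_def by (metis disjoint_iff)

text \<open>The faces are the polygons and the vertices the corners. Universality comes from
  \<open>lpath_word\<close>: a labelling closed along all faces is constant on the cycles of
  \<open>\<rho>\<close>. The gluing is connected because a union of faces closed under
  \<open>\<iota>\<close> is closed under \<open>\<rho>\<close> as well.\<close>

lemma polygons: "polygons \<iota> cil (pt \<Gamma>) H (word (pt \<Gamma>)) (C - {pt \<Gamma>}) word"
proof (unfold_locales, goal_cases)
  case 1 then show ?case by (rule iota_iota)
next
  case 2 then show ?case by (rule ribbon)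
next
  case (3 x) then show ?case by (simp add: iota_in)
next
  case (4 x) then show ?case by (rule ribbon)
next
  case 5 then show ?case using cilia by simp
next
  case 6 then show ?case by (rule distinct_word)
next
  case (7 i) show ?case by (rule distinct_word)
next
  case (8 i) then show ?case using disjoint_words[of "pt \<Gamma>" i] cilia(3) by blast
next
  case (9 i j) then show ?case using disjoint_words[of i j] by blast
next
  case 10 then show ?case using H_eq_words cilia(3) by auto
next
  case 11
  have "cil (rho_inv (\<iota> x)) = cil (\<iota> x)" if "x \<in> H" for x
    using that by (simp add: cil_rho_inv iota_in)
  moreover have "cil (rho_inv (pt \<Gamma>)) = pt \<Gamma>" using cil_rho_inv cil_cilium cilia by auto
  ultimately show ?case unfolding lpath_word using H_eq_words cilia(3) by auto
next
  case (12 i)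
  have "cil (rho_inv (\<iota> x)) = cil (\<iota> x)" if "x \<in> H" for x
    using that by (simp add: cil_rho_inv iota_in)
  then show ?case unfolding lpath_word using H_eq_words 12 by auto
next
  case (13 J)
  define X where "X = (\<Union>j\<in>J. set (word j))"
  have XH: "X \<subseteq> H" using 13(1) H_eq_words by (auto simp: X_def)
  show ?case
  proof (rule ccontr)
    assume "\<not> ?case"
    then have iota_X: "\<iota> k \<in> X" if "k \<in> X" for k using that by (auto simp: X_def)
    have phi_X: "\<phi> k \<in> X" if "k \<in> X" for k
      using that by (auto simp: X_def set_word intro: orbit.step)
    have "rho_inv k \<in> X" if "k \<in> X" for k
      using phi_X[OF iota_X[OF that]] by (simp add: face_perm_def iota_iota)
    \<comment> \<open>Closure under \<open>\<rho>\<close> itself follows from finiteness: an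
      injective self-map of the finite set \<open>X\<close> is onto.\<close>
    then have "rho_inv ` X \<subseteq> X" by blast
    moreover have "inj_on rho_inv X" using rho_inv(1) by (metis inj_onI)
    ultimately have "rho_inv ` X = X"
      using XH ribbon(1) by (metis endo_inj_surj finite_subset)
    then have rho_X: "\<rho> k \<in> X \<longleftrightarrow> k \<in> X" for k
      using rho_inv by (metis image_iff)
    have "(h \<in> X) = (k \<in> X)" if "h \<in> H" "k \<in> H" for h k
      by (rule connected_invariant[of "\<lambda>h. h \<in> X"]) (use iota_X iota_iota rho_X that in metis)+
    moreover obtain j where "j \<in> J" using 13(2) by blast
    then have "rho_inv j \<in> X" using permutation_self_in_orbit[OF permutations(3)] by (auto simp: X_def set_word)
    moreover have "rho_inv (pt \<Gamma>) \<in> set (word (pt \<Gamma>))"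
      using permutation_self_in_orbit[OF permutations(3)] by (simp add: set_word)
    then have "rho_inv (pt \<Gamma>) \<notin> X"
      using disjoint_words[of "pt \<Gamma>"] 13(1) cilia(3) unfolding X_def by blast
    moreover have "rho_inv (pt \<Gamma>) \<in> H" using rho_inv(3) cilia by blast
    ultimately show False using XH by blast
  qed
next
  case (14 \<theta> t x)
  have words: "\<theta> (rho_inv (\<iota> y)) = \<theta> (\<iota> y)" if "c \<in> C" "y \<in> set (word c)" for c y
    using 14(1) 14(2)[of c] that unfolding lpath_word by (cases "c = pt \<Gamma>") auto
  \<comment> \<open>As \<open>\<iota>\<close> permutes the half-edges, the conditions at all
    \<open>\<iota> x\<close> are conditions at all half-edges.\<close>
  have inv: "\<theta> (rho_inv y) = \<theta> y" if y: "y \<in> H" for y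
  proof -
    have "\<iota> y \<in> H" using y by (simp add: iota_in)
    then obtain c where "c \<in> C" "\<iota> y \<in> set (word c)" using H_eq_words by blast
    then show ?thesis using words[of c "\<iota> y"] by (simp add: iota_iota)
  qed
  have orb: "\<theta> y = \<theta> k" if "y \<in> orbit \<rho> k" "k \<in> H" for y k
    using that
  proof (induction)
    case base
    then show ?case using inv[of "\<rho> k"] by (simp add: rho_in rho_inv)
  next
    case (step y)
    then have "\<rho> y \<in> H" using orbit_subset_H[OF ribbon(3), of k] by (auto simp: rho_in)
    then show ?case using inv[of "\<rho> y"] step by (simp add: rho_inv)
  qed
  have "t = \<theta> (pt \<Gamma>)" using 14(1) inv cilia unfolding lpath_word by auto
  then show ?case
    using orb 14(3) cil_eq[of x "pt \<Gamma>"] cilia cil_eq_iff[OF 14(3)] vertex_eq_iff by auto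
qed

lemma cil_image: "insert (pt \<Gamma>) (cil ` H) = C"
  using cil(1) cil_cilium cilia by (metis image_eqI image_subset_iff insert_absorb subset_antisym subset_eq)

section \<open>Sources, targets and the number of edges\<close>

definition sources :: "nat set" where
  "sources = {h \<in> H. is_source \<Gamma> h}"

lemma is_source_iota: "h \<in> H \<Longrightarrow> is_source \<Gamma> (\<iota> h) \<longleftrightarrow> \<not> is_source \<Gamma> h"
  using ribbon(5)[of h] by (auto simp: is_source_def iota_iota min_def)

lemma edge_of: "edge_of \<Gamma> h = {h, \<iota> h}"
proof -
  have "orbit \<iota> h \<subseteq> {h, \<iota> h}"
  proof
    fix x assume "x \<in> orbit \<iota> h"
    then show "x \<in> {h, \<iota> h}" by induction (auto simp: iota_iota)
  qed
  moreover have "\<iota> h \<in> orbit \<iota> h" by (rule orbit.base)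
  moreover have "h \<in> orbit \<iota> h" by (rule permutation_self_in_orbit[OF permutations(2)])
  ultimately show ?thesis by (auto simp: edge_of_def)
qed

lemma edge_of_bij: "bij_betw (edge_of \<Gamma>) sources (edges \<Gamma>)"
proof (rule bij_betw_imageI)
  show "inj_on (edge_of \<Gamma>) sources"
  proof (rule inj_onI)
    fix h k assume "h \<in> sources" "k \<in> sources" "edge_of \<Gamma> h = edge_of \<Gamma> k"
    then show "h = k" using is_source_iota by (auto simp: sources_def edge_of doubleton_eq_iff)
  qed
  have "edge_of \<Gamma> h \<in> edge_of \<Gamma> ` sources" if h: "h \<in> H" for h
  proof (cases "is_source \<Gamma> h")
    case True
    then show ?thesis using h by (auto simp: sources_def)
  next
    case False
    then have "\<iota> h \<in> sources" using h is_source_iota iota_in by (simp add: sources_def)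
    moreover have "edge_of \<Gamma> (\<iota> h) = edge_of \<Gamma> h" by (auto simp: edge_of iota_iota)
    ultimately show ?thesis by (metis image_eqI)
  qed
  then show "edge_of \<Gamma> ` sources = edges \<Gamma>" by (auto simp: edges_def sources_def)
qed

lemma card_sources: "card sources = card (edges \<Gamma>)"
  by (rule bij_betw_same_card[OF edge_of_bij])

lemma card_targets: "card (H - sources) = card (edges \<Gamma>)"
proof -
  have "bij_betw \<iota> sources (H - sources)"
    by (rule bij_betw_byWitness[where f' = \<iota>]) (use is_source_iota in \<open>auto simp: iota_iota sources_def iota_in\<close>)
  then show ?thesis using card_sources bij_betw_same_card by metis
qed

lemma card_H: "card H = 2 * card (edges \<Gamma>)"
proof -
  have "sources \<subseteq> H" by (auto simp: sources_def)
  then show ?thesis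
    using card_sources card_targets card_Diff_subset[of sources H] card_mono[of H sources] ribbon(1) finite_subset
    by fastforce
qed

lemma genus_eq:
  assumes "genus \<Gamma> = of_nat g"
  shows "card (edges \<Gamma>) + 2 = 2 * g + 2 * card C"
proof -
  have "card (vertices \<Gamma>) = card C" "card (faces \<Gamma>) = card C"
    using bij_betw_same_card[OF vertex_bij] bij_betw_same_card[OF face_bij] by simp_all
  then have "of_nat (card (edges \<Gamma>) + 2) = (of_nat (2 * g + 2 * card C) :: rat)"
    using assms by (simp add: genus_def field_simps)
  then show ?thesis by (simp only: of_nat_eq_iff)
qed

end

subsection \<open>Characters of the group algebra\<close>

lemma lin_form_single [simp]: "lin_form \<phi> (single x) = \<phi> x"
proof -
  have "{y. single x y \<noteq> (0::'a)} = {x}" by (auto simp: single_def)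
  then show ?thesis by (simp add: lin_form_def single_def)
qed

lemma lin_ext_single [simp]: "lin_ext \<phi> (single x) = \<phi> x"
  by (simp add: lin_ext_def)

lemma lin_form_finite:
  assumes "finite A" "v \<in> free_vs A"
  shows "lin_form \<phi> v = (\<Sum>x\<in>A. v x * \<phi> x)"
  unfolding lin_form_def using assms by (intro sum.mono_neutral_left) (auto simp: free_vs_def)

lemma lin_form_add:
  assumes "finite A" "v \<in> free_vs A" "w \<in> free_vs A"
  shows "lin_form \<phi> (v + w) = lin_form \<phi> v + lin_form \<phi> w"
  using assms fv.subspace_add[OF subspace_free_vs assms(2,3)]
  by (simp add: lin_form_finite[OF assms(1)] algebra_simps sum.distrib)

lemma lin_form_scale:
  assumes "finite A" "v \<in> free_vs A"
  shows "lin_form \<phi> (fscale c v) = c * lin_form \<phi> v"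
  using assms fv.subspace_scale[OF subspace_free_vs assms(2)]
  by (simp add: lin_form_finite[OF assms(1)] algebra_simps sum_distrib_left)

lemma kmult_single_single [simp]: "kmult G (single x) (single y) = single (x \<otimes>\<^bsub>G\<^esub> y)"
  by (simp add: kmult_def)

lemma antipode_single [simp]: "antipode G (single x) = single (inv\<^bsub>G\<^esub> x)"
  by (simp add: antipode_def)

locale finite_grp = group G for G (structure) +
  assumes finite_G: "finite (carrier G)"
begin

lemma single_grp_alg: "x \<in> carrier G \<Longrightarrow> single x \<in> grp_alg G"
  by (rule single_in_free_vs)

lemma grp_alg_iff: "v \<in> grp_alg G \<longleftrightarrow> (\<forall>x. x \<notin> carrier G \<longrightarrow> v x = 0)"
  by (rule finite_support_free_vs[OF finite_G])

lemma lin_form_G: "v \<in> grp_alg G \<Longrightarrow> lin_form \<phi> v = (\<Sum>x\<in>carrier G. v x * \<phi> x)"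
  by (rule lin_form_finite[OF finite_G])

lemma kmult_single_left:
  assumes "a \<in> carrier G" "m \<in> grp_alg G"
  shows "kmult G (single a) m = (\<lambda>z. if z \<in> carrier G then m (inv a \<otimes> z) else 0)"
proof
  fix z
  have "kmult G (single a) m z = (\<Sum>y\<in>carrier G. m y * single (a \<otimes> y) z)"
    using assms by (simp add: kmult_def lin_ext_def lin_form_G)
  also have "\<dots> = (\<Sum>y\<in>carrier G. if z \<in> carrier G \<and> y = inv a \<otimes> z then m y else 0)"
    using assms(1) by (intro sum.cong HOL.refl) (auto simp: single_def inv_cancel_left)
  also have "\<dots> = (if z \<in> carrier G then m (inv a \<otimes> z) else 0)"
    using finite_G assms(1) by (cases "z \<in> carrier G") simp_all
  finally show "kmult G (single a) m z = (if z \<in> carrier G then m (inv a \<otimes> z) else 0)" .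
qed

lemma kmult_single_right:
  assumes "a \<in> carrier G" "m \<in> grp_alg G"
  shows "kmult G m (single a) = (\<lambda>z. if z \<in> carrier G then m (z \<otimes> inv a) else 0)"
proof
  fix z
  have "kmult G m (single a) z = (\<Sum>y\<in>carrier G. m y * single (y \<otimes> a) z)"
    using assms by (simp add: kmult_def lin_ext_def lin_form_G)
  also have "\<dots> = (\<Sum>y\<in>carrier G. if z \<in> carrier G \<and> y = z \<otimes> inv a then m y else 0)"
    using assms(1) by (intro sum.cong HOL.refl) (auto simp: single_def m_assoc)
  also have "\<dots> = (if z \<in> carrier G then m (z \<otimes> inv a) else 0)"
    using finite_G assms(1) by (cases "z \<in> carrier G") simp_all
  finally show "kmult G m (single a) z = (if z \<in> carrier G then m (z \<otimes> inv a) else 0)" .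
qed

lemma kmult_grp_alg:
  assumes "a \<in> grp_alg G" "b \<in> grp_alg G"
  shows "kmult G a b \<in> grp_alg G"
proof -
  have "kmult G a b z = 0" if z: "z \<notin> carrier G" for z
  proof -
    have "kmult G a b z = (\<Sum>x\<in>carrier G. a x * (\<Sum>y\<in>carrier G. b y * single (x \<otimes> y) z))"
      using assms by (simp add: kmult_def lin_ext_def lin_form_G)
    also have "\<dots> = (\<Sum>x\<in>carrier G. a x * (\<Sum>y\<in>carrier G. 0))"
      using z by (intro sum.cong HOL.refl arg_cong2[of _ _ _ _ "(*)"]) (auto simp: single_def)
    finally show ?thesis by simp
  qed
  then show ?thesis by (simp add: grp_alg_iff)
qed

lemma char_linear:
  fixes \<chi> :: "('a \<Rightarrow> 'k::field) \<Rightarrow> 'k"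
  assumes \<chi>: "\<chi> \<in> algebra_maps G" and v: "v \<in> grp_alg G"
  shows "\<chi> v = lin_form (\<lambda>x. \<chi> (single x)) v"
proof -
  have add: "\<chi> (a + b) = \<chi> a + \<chi> b" if "a \<in> grp_alg G" "b \<in> grp_alg G" for a b
    using \<chi> that by (simp add: algebra_maps_def)
  have scale: "\<chi> (fscale c a) = c * \<chi> a" if "a \<in> grp_alg G" for c a
    using \<chi> that by (simp add: algebra_maps_def)
  have "\<chi> (\<Sum>x\<in>A. fscale (v x) (single x)) = (\<Sum>x\<in>A. v x * \<chi> (single x))"
    if "A \<subseteq> carrier G" for A
    using finite_subset[OF that finite_G] that
  proof (induction A)
    case empty
    have "\<chi> (fscale 0 0) = 0 * \<chi> 0" by (rule scale[OF fv.subspace_0[OF subspace_free_vs]])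
    then have "\<chi> 0 = 0" by (simp only: fv.scale_zero_left mult_zero_left)
    then show ?case by (simp only: sum.empty)
  next
    case (insert x A)
    have A: "(\<Sum>x\<in>A. fscale (v x) (single x)) \<in> grp_alg G"
      by (intro fv.subspace_sum[OF subspace_free_vs] fv.subspace_scale[OF subspace_free_vs] single_grp_alg)
        (use insert in blast)
    have x: "single x \<in> grp_alg G" using insert.prems by (auto intro: single_grp_alg)
    have "\<chi> (\<Sum>x\<in>insert x A. fscale (v x) (single x)) =
        \<chi> (fscale (v x) (single x)) + \<chi> (\<Sum>x\<in>A. fscale (v x) (single x))"
      unfolding sum.insert[OF insert.hyps]
      by (rule add[OF fv.subspace_scale[OF subspace_free_vs x] A])
    also have "\<dots> = v x * \<chi> (single x) + (\<Sum>x\<in>A. v x * \<chi> (single x))"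
      using insert.prems by (simp only: insert.IH insert_subset scale[OF x])
    finally show ?case unfolding sum.insert[OF insert.hyps] .
  qed
  from this[OF subset_refl] show ?thesis
    using sum_fscale_single[OF finite_G v] by (simp add: lin_form_G[OF v])
qed

lemma char_mult:
  assumes "\<chi> \<in> algebra_maps G" "x \<in> carrier G" "y \<in> carrier G"
  shows "\<chi> (single (x \<otimes> y)) = \<chi> (single x) * \<chi> (single y)"
proof -
  have "\<chi> (kmult G (single x) (single y)) = \<chi> (single x) * \<chi> (single y)"
    using assms single_grp_alg unfolding algebra_maps_def by blast
  then show ?thesis by simp
qed

lemma char_one: "\<chi> \<in> algebra_maps G \<Longrightarrow> \<chi> (single \<one>) = 1"
  by (simp add: algebra_maps_def)

lemma char_eqI:
  fixes \<chi> :: "('a \<Rightarrow> 'k::field) \<Rightarrow> 'k"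
  assumes "\<chi> \<in> algebra_maps G" "\<psi> \<in> algebra_maps G"
    and "\<And>x. x \<in> carrier G \<Longrightarrow> \<chi> (single x) = \<psi> (single x)"
  shows "\<chi> = \<psi>"
proof (rule extensionalityI[of _ "grp_alg G"])
  fix v :: "'a \<Rightarrow> 'k" assume "v \<in> grp_alg G"
  then show "\<chi> v = \<psi> v" by (simp add: char_linear assms lin_form_G)
qed (use assms in \<open>simp_all add: algebra_maps_def\<close>)

text \<open>Products, unit and inverses in the character group are all obtained from multiplicative
  functions on G, as group-likes turn convolution into multiplication of values.\<close>

lemma char_of_hom:
  assumes "\<And>x y. x \<in> carrier G \<Longrightarrow> y \<in> carrier G \<Longrightarrow> c (x \<otimes> y) = c x * c y" "c \<one> = (1::'k::field)"
  shows "restrict (lin_form c) (grp_alg G) \<in> algebra_maps G"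
    and "x \<in> carrier G \<Longrightarrow> restrict (lin_form c) (grp_alg G) (single x) = c x"
proof -
  have mult: "lin_form c (kmult G a b) = lin_form c a * lin_form c b"
    if ab: "a \<in> grp_alg G" "b \<in> grp_alg G" for a b
  proof -
    have "kmult G a b z = (\<Sum>x\<in>carrier G. a x * (\<Sum>y\<in>carrier G. b y * single (x \<otimes> y) z))" for z
      using ab by (simp add: kmult_def lin_ext_def lin_form_G)
    then have "lin_form c (kmult G a b) =
        (\<Sum>z\<in>carrier G. \<Sum>x\<in>carrier G. \<Sum>y\<in>carrier G. a x * b y * (single (x \<otimes> y) z * c z))"
      using lin_form_G[OF kmult_grp_alg[OF ab], of c]
      by (simp add: sum_distrib_left sum_distrib_right mult_ac)
    also have "\<dots> = (\<Sum>x\<in>carrier G. \<Sum>z\<in>carrier G. \<Sum>y\<in>carrier G. a x * b y * (single (x \<otimes> y) z * c z))"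
      by (rule sum.swap)
    also have "\<dots> = (\<Sum>x\<in>carrier G. \<Sum>y\<in>carrier G. \<Sum>z\<in>carrier G. a x * b y * (single (x \<otimes> y) z * c z))"
      by (rule sum.cong[OF HOL.refl]) (rule sum.swap)
    also have "\<dots> = (\<Sum>x\<in>carrier G. \<Sum>y\<in>carrier G. a x * b y * c (x \<otimes> y))"
    proof (intro sum.cong HOL.refl)
      fix x y assume xy: "x \<in> carrier G" "y \<in> carrier G"
      have "(\<Sum>z\<in>carrier G. a x * b y * (single (x \<otimes> y) z * c z)) =
          (\<Sum>z\<in>carrier G. if z = x \<otimes> y then a x * b y * c z else 0)"
        by (intro sum.cong HOL.refl) (simp add: single_def)
      then show "(\<Sum>z\<in>carrier G. a x * b y * (single (x \<otimes> y) z * c z)) = a x * b y * c (x \<otimes> y)"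
        using finite_G xy by simp
    qed
    also have "\<dots> = lin_form c a * lin_form c b"
      using ab assms(1) by (simp add: lin_form_G sum_product mult_ac)
    finally show ?thesis .
  qed
  show "restrict (lin_form c) (grp_alg G) \<in> algebra_maps G"
    unfolding algebra_maps_def
    by (simp add: mult kmult_grp_alg fv.subspace_add[OF subspace_free_vs] single_grp_alg assms(2)
      fv.subspace_scale[OF subspace_free_vs] lin_form_add[OF finite_G] lin_form_scale[OF finite_G])
  show "x \<in> carrier G \<Longrightarrow> restrict (lin_form c) (grp_alg G) (single x) = c x"
    by (simp add: single_grp_alg)
qed

section \<open>The group of characters and its powers\<close>

lemma char_group_mult:
  fixes \<chi> \<psi> :: "('a \<Rightarrow> 'k::field) \<Rightarrow> 'k"
  assumes "\<chi> \<in> algebra_maps G" "\<psi> \<in> algebra_maps G"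
  shows "\<chi> \<otimes>\<^bsub>char_group G\<^esub> \<psi> \<in> algebra_maps G"
    and "x \<in> carrier G \<Longrightarrow> (\<chi> \<otimes>\<^bsub>char_group G\<^esub> \<psi>) (single x) = \<chi> (single x) * \<psi> (single x)"
  using char_of_hom[of "\<lambda>x. \<chi> (single x) * \<psi> (single x)"] assms
  by (simp_all add: char_group_def char_mult char_one)

lemma counit_char: "counit G \<in> algebra_maps G" "x \<in> carrier G \<Longrightarrow> counit G (single x) = 1"
  using char_of_hom[of "\<lambda>_. 1"] by (simp_all add: counit_def single_grp_alg)

lemma char_nonzero:
  assumes "\<chi> \<in> algebra_maps G" "x \<in> carrier G"
  shows "\<chi> (single x) \<noteq> 0" "\<chi> (single (inv x)) = inverse (\<chi> (single x))"
proof -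
  have "\<chi> (single x) * \<chi> (single (inv x)) = 1"
    using char_mult[OF assms, of "inv x"] char_one[OF assms(1)] assms(2) by simp
  then show "\<chi> (single x) \<noteq> 0" "\<chi> (single (inv x)) = inverse (\<chi> (single x))"
    by (auto simp: inverse_unique)
qed

lemma group_char_group: "group (char_group G :: (('a \<Rightarrow> 'k::field) \<Rightarrow> 'k) monoid)"
proof (rule groupI)
  let ?C = "char_group G :: (('a \<Rightarrow> 'k) \<Rightarrow> 'k) monoid"
  have c: "carrier ?C = algebra_maps G" and o: "\<one>\<^bsub>?C\<^esub> = counit G" by (simp_all add: char_group_def)
  show "\<one>\<^bsub>?C\<^esub> \<in> carrier ?C" by (simp add: c o counit_char)
  fix \<chi> assume \<chi>: "\<chi> \<in> carrier ?C"
  show "\<one>\<^bsub>?C\<^esub> \<otimes>\<^bsub>?C\<^esub> \<chi> = \<chi>"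
    by (rule char_eqI) (use \<chi> in \<open>simp_all add: c o char_group_mult counit_char\<close>)
  let ?i = "restrict (lin_form (\<lambda>x. inverse (\<chi> (single x)))) (grp_alg G)"
  have i: "?i \<in> algebra_maps G" "\<And>x. x \<in> carrier G \<Longrightarrow> ?i (single x) = inverse (\<chi> (single x))"
    using char_of_hom[of "\<lambda>x. inverse (\<chi> (single x))"] \<chi> by (simp_all add: c char_mult char_one)
  have "?i \<otimes>\<^bsub>?C\<^esub> \<chi> = \<one>\<^bsub>?C\<^esub>"
    by (rule char_eqI)
      (use \<chi> i in \<open>simp_all add: c o char_group_mult counit_char char_nonzero\<close>)
  then show "\<exists>\<psi>\<in>carrier ?C. \<psi> \<otimes>\<^bsub>?C\<^esub> \<chi> = \<one>\<^bsub>?C\<^esub>" using i(1) unfolding c by blast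
  fix \<psi> assume \<psi>: "\<psi> \<in> carrier ?C"
  show "\<chi> \<otimes>\<^bsub>?C\<^esub> \<psi> \<in> carrier ?C" using \<chi> \<psi> by (simp add: c char_group_mult)
  fix \<theta> assume \<theta>: "\<theta> \<in> carrier ?C"
  show "\<chi> \<otimes>\<^bsub>?C\<^esub> \<psi> \<otimes>\<^bsub>?C\<^esub> \<theta> = \<chi> \<otimes>\<^bsub>?C\<^esub> (\<psi> \<otimes>\<^bsub>?C\<^esub> \<theta>)"
    by (rule char_eqI) (use \<chi> \<psi> \<theta> in \<open>simp_all add: c char_group_mult\<close>)
qed

lemma char_group_carrier: "carrier (char_group G) = algebra_maps G"
  by (simp add: char_group_def)

lemma char_group_inv:
  fixes \<chi> :: "('a \<Rightarrow> 'k::field) \<Rightarrow> 'k"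
  assumes "\<chi> \<in> algebra_maps G" "x \<in> carrier G"
  shows "(inv\<^bsub>char_group G\<^esub> \<chi>) (single x) = inverse (\<chi> (single x))"
    and "inv\<^bsub>char_group G\<^esub> \<chi> \<in> algebra_maps G"
proof -
  interpret C: group "char_group G :: (('a \<Rightarrow> 'k) \<Rightarrow> 'k) monoid" by (rule group_char_group)
  show i: "inv\<^bsub>char_group G\<^esub> \<chi> \<in> algebra_maps G"
    using C.inv_closed assms by (simp add: char_group_carrier)
  have "(\<chi> \<otimes>\<^bsub>char_group G\<^esub> inv\<^bsub>char_group G\<^esub> \<chi>) (single x) = counit G (single x)"
    using C.r_inv assms by (simp add: char_group_carrier) (simp add: char_group_def)
  then show "(inv\<^bsub>char_group G\<^esub> \<chi>) (single x) = inverse (\<chi> (single x))"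
    using char_group_mult(2)[OF assms(1) i assms(2)]
    by (simp add: inverse_unique counit_char(2)[OF assms(2)])
qed

lemma char_group_nat_pow:
  fixes \<chi> :: "('a \<Rightarrow> 'k::field) \<Rightarrow> 'k"
  assumes "\<chi> \<in> algebra_maps G"
  shows "\<chi> [^]\<^bsub>char_group G\<^esub> (n::nat) \<in> algebra_maps G"
    and "x \<in> carrier G \<Longrightarrow> (\<chi> [^]\<^bsub>char_group G\<^esub> n) (single x) = \<chi> (single x) ^ n"
proof -
  have "\<chi> [^]\<^bsub>char_group G\<^esub> n \<in> algebra_maps G \<and>
      (x \<in> carrier G \<longrightarrow> (\<chi> [^]\<^bsub>char_group G\<^esub> n) (single x) = \<chi> (single x) ^ n)" for x
  proof (induction n)
    case 0
    then show ?case by (simp add: char_group_def nat_pow_def counit_char)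
  next
    case (Suc n)
    then show ?case
      using char_group_mult[OF _ assms, of "\<chi> [^]\<^bsub>char_group G\<^esub> n"] by (simp add: nat_pow_def mult.commute)
  qed
  then show "\<chi> [^]\<^bsub>char_group G\<^esub> n \<in> algebra_maps G"
    and "x \<in> carrier G \<Longrightarrow> (\<chi> [^]\<^bsub>char_group G\<^esub> n) (single x) = \<chi> (single x) ^ n" by blast+
qed

lemma char_group_pow_nonneg:
  "\<chi> [^]\<^bsub>char_group G\<^esub> (2::int) = \<chi> [^]\<^bsub>char_group G\<^esub> (2::nat)"
  by (simp add: int_pow_def2)

lemma char_group_neg_pow:
  fixes \<chi> :: "('a \<Rightarrow> 'k::field) \<Rightarrow> 'k"
  assumes "\<chi> \<in> algebra_maps G"
  shows "\<chi> [^]\<^bsub>char_group G\<^esub> (- 2 * int g) \<in> algebra_maps G"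
    and "x \<in> carrier G \<Longrightarrow> (\<chi> [^]\<^bsub>char_group G\<^esub> (- 2 * int g)) (single x) = inverse (\<chi> (single x) ^ (2 * g))"
proof -
  interpret C: group "char_group G :: (('a \<Rightarrow> 'k) \<Rightarrow> 'k) monoid" by (rule group_char_group)
  have eq: "\<chi> [^]\<^bsub>char_group G\<^esub> (- 2 * int g) = inv\<^bsub>char_group G\<^esub> (\<chi> [^]\<^bsub>char_group G\<^esub> (2 * g))"
    using C.int_pow_neg_int[of \<chi> "2 * g"] assms by (simp add: char_group_carrier)
  show "\<chi> [^]\<^bsub>char_group G\<^esub> (- 2 * int g) \<in> algebra_maps G"
    unfolding eq using C.inv_closed char_group_nat_pow(1)[OF assms] by (simp add: char_group_carrier)
  show "x \<in> carrier G \<Longrightarrow> (\<chi> [^]\<^bsub>char_group G\<^esub> (- 2 * int g)) (single x) = inverse (\<chi> (single x) ^ (2 * g))"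
    unfolding eq by (simp add: char_group_inv char_group_nat_pow assms)
qed

end

subsection \<open>The extended Hilbert space\<close>

locale kitaev_data = finite_grp G + ciliated \<Gamma>
  for G (structure) and \<Gamma> :: "nat ciliated_graph" +
  fixes p :: 'a and \<chi> :: "('a \<Rightarrow> 'k::field) \<Rightarrow> 'k" and \<zeta> :: 'k and M :: "('a, 'k) hopf_bimodule"
  assumes pair: "pair_in_involution G p \<chi>" and M_def: "M = induced_bimodule G p \<chi> \<zeta>"
begin

lemma chi: "\<chi> \<in> algebra_maps G"
  using pair by (simp add: pair_in_involution_def char_group_def)

text \<open>On a group element both sides are explicit: the square of the antipode fixes it and the
  two character values cancel, so it commutes with \<open>p\<close>.\<close>

lemma p_central: "central p"
proof -
  have p: "p \<in> carrier G" using pair by (simp add: pair_in_involution_def)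
  have "p \<otimes> x = x \<otimes> p" if x: "x \<in> carrier G" for x
  proof -
    have "antipode G (antipode G (single x)) =
        lin_ext (\<lambda>x. fscale ((inv\<^bsub>char_group G\<^esub> \<chi>) (single x) * \<chi> (single x))
          (kmult G (kmult G (single p) (single x)) (single (inv p)))) (single x :: 'a \<Rightarrow> 'k)"
      using pair single_grp_alg[OF x] unfolding pair_in_involution_def by blast
    then have "(single x :: 'a \<Rightarrow> 'k) = fscale 1 (single (p \<otimes> x \<otimes> inv p))"
      using x char_nonzero(1)[OF chi x] by (simp add: char_group_inv[OF chi])
    then have "(single x :: 'a \<Rightarrow> 'k) x = single (p \<otimes> x \<otimes> inv p) x" by simp
    then have "x = p \<otimes> x \<otimes> inv p" by (simp add: single_def split: if_splits)
    then have "x \<otimes> p = p \<otimes> x \<otimes> inv p \<otimes> p" by simp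
    then show ?thesis using p x by (simp add: m_assoc)
  qed
  then show ?thesis using p unfolding central_def by blast
qed

lemmas p_closed = central_closed[OF p_central]

abbreviation chr :: "'a \<Rightarrow> 'k" where
  "chr x \<equiv> \<chi> (single x)"

abbreviation "B \<equiv> edges \<Gamma> \<rightarrow>\<^sub>E carrier G"

lemma finite_edges: "finite (edges \<Gamma>)"
  using ribbon(1) by (simp add: edges_def)

lemma finite_B: "finite B"
  by (intro finite_PiE finite_edges finite_G)

lemma free_vs_B: "m \<in> free_vs B \<longleftrightarrow> (\<forall>\<gamma>. \<gamma> \<notin> B \<longrightarrow> m \<gamma> = 0)"
  by (rule finite_support_free_vs[OF finite_B])

lemma edge_in: "k \<in> H \<Longrightarrow> edge_of \<Gamma> k \<in> edges \<Gamma>"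
  by (simp add: edges_def)

lemma edge_value: "\<gamma> \<in> B \<Longrightarrow> k \<in> H \<Longrightarrow> \<gamma> (edge_of \<Gamma> k) \<in> carrier G"
  using edge_in by blast

lemma upd_in_B: "e \<in> edges \<Gamma> \<Longrightarrow> \<gamma> \<in> B \<Longrightarrow> x \<in> carrier G \<Longrightarrow> \<gamma>(e := x) \<in> B"
  by (auto simp: PiE_def extensional_def)

lemma upd_notin_B:
  assumes "e \<in> edges \<Gamma>" "\<gamma> \<notin> B" "\<gamma> e \<in> carrier G"
  shows "\<gamma>(e := x) \<notin> B"
proof
  assume "\<gamma>(e := x) \<in> B"
  from upd_in_B[OF assms(1) this assms(3)] show False using assms by simp
qed

lemma slice_grp_alg:
  assumes "e \<in> edges \<Gamma>" "m \<in> free_vs B"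
  shows "(\<lambda>x. m (\<gamma>(e := x))) \<in> grp_alg G"
proof -
  have "m (\<gamma>(e := x)) = 0" if x: "x \<notin> carrier G" for x
  proof -
    have "\<gamma>(e := x) \<notin> B" using x assms(1) by (auto simp: PiE_def Pi_def)
    then show ?thesis using assms(2) by (simp add: free_vs_B)
  qed
  then show ?thesis by (simp add: grp_alg_iff)
qed

text \<open>Operators are computed on coefficients, so this is the inverse of the action on basis
  elements: at a source the action is right multiplication by \<open>inv a\<close>, and the new
  coefficient at \<open>\<gamma>\<close> is the old one at \<open>\<gamma>\<close> with the edge
  value multiplied by \<open>a\<close>.\<close>

definition shift :: "nat \<Rightarrow> 'a \<Rightarrow> (nat set \<Rightarrow> 'a) \<Rightarrow> nat set \<Rightarrow> 'a" where
  "shift k a \<gamma> = \<gamma>(edge_of \<Gamma> k :=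
    if is_source \<Gamma> k then \<gamma> (edge_of \<Gamma> k) \<otimes> a else inv a \<otimes> \<gamma> (edge_of \<Gamma> k))"

lemma shift_in_B: "k \<in> H \<Longrightarrow> a \<in> carrier G \<Longrightarrow> \<gamma> \<in> B \<Longrightarrow> shift k a \<gamma> \<in> B"
  unfolding shift_def using edge_value by (intro upd_in_B edge_in) simp_all

lemma half_act_eq:
  assumes k: "k \<in> H" and a: "a \<in> carrier G" and m: "m \<in> free_vs B"
  shows "half_act G M \<Gamma> k (single a) m =
    (\<lambda>\<gamma>. if \<gamma> \<in> B then (if is_source \<Gamma> k then chr a else 1) * m (shift k a \<gamma>) else 0)"
proof
  fix \<gamma>
  let ?e = "edge_of \<Gamma> k" and ?n = "\<lambda>x. m (\<gamma>(edge_of \<Gamma> k := x))"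
  have n: "?n \<in> grp_alg G" using k m by (intro slice_grp_alg edge_in)
  have "half_act G M \<Gamma> k (single a) m \<gamma> =
      (if \<gamma> ?e \<in> carrier G then (if is_source \<Gamma> k then chr a else 1) * m (shift k a \<gamma>) else 0)"
  proof (cases "is_source \<Gamma> k")
    case True
    \<comment> \<open>The right action carries the inverse character and is applied to the antipode
      of \<open>a\<close>; the two inversions leave \<open>chr a\<close>, a factor that targets do
      not have.\<close>
    have "half_act G M \<Gamma> k (single a) m \<gamma> =
        inverse (chr (inv a)) * kmult G ?n (single (inv a)) (\<gamma> ?e)"
      using True a by (simp add: half_act_def on_factor_def M_def induced_bimodule_def char_group_inv[OF chi])
    then show ?thesis
      using True a by (simp add: kmult_single_right[OF _ n] char_nonzero(2)[OF chi] shift_def)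
  next
    case False
    then have "half_act G M \<Gamma> k (single a) m \<gamma> = kmult G (single a) ?n (\<gamma> ?e)"
      by (simp add: half_act_def on_factor_def M_def induced_bimodule_def)
    then show ?thesis using False by (simp add: kmult_single_left[OF a n] shift_def)
  qed
  also have "\<dots> = (if \<gamma> \<in> B then (if is_source \<Gamma> k then chr a else 1) * m (shift k a \<gamma>) else 0)"
  proof (cases "\<gamma> \<in> B")
    case True
    then show ?thesis using edge_value k by simp
  next
    case False
    have "m (shift k a \<gamma>) = 0" if "\<gamma> ?e \<in> carrier G"
      using upd_notin_B[OF edge_in[OF k] False that] m by (simp add: free_vs_B shift_def)
    then show ?thesis using False by simp
  qed
  finally show "half_act G M \<Gamma> k (single a) m \<gamma> =
    (if \<gamma> \<in> B then (if is_source \<Gamma> k then chr a else 1) * m (shift k a \<gamma>) else 0)" .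
qed

text \<open>Pulling back coefficients reverses composition, which turns \<open>fold\<close> into
  \<open>foldr\<close>.\<close>

lemma fold_half_act:
  assumes "set ks \<subseteq> H" "\<And>k. k \<in> H \<Longrightarrow> \<alpha> k \<in> carrier G" "m \<in> free_vs B"
  shows "fold (\<lambda>k. half_act G M \<Gamma> k (single (\<alpha> k))) ks m =
    (\<lambda>\<gamma>. if \<gamma> \<in> B then (\<Prod>k\<leftarrow>ks. if is_source \<Gamma> k then chr (\<alpha> k) else 1) *
      m (foldr (\<lambda>k. shift k (\<alpha> k)) ks \<gamma>) else 0)"
  using assms(1,3)
proof (induction ks arbitrary: m)
  case Nil
  then show ?case by (auto simp: free_vs_B)
next
  case (Cons k ks)
  let ?m = "half_act G M \<Gamma> k (single (\<alpha> k)) m"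
  have k: "k \<in> H" "\<alpha> k \<in> carrier G" using Cons.prems assms(2) by auto
  note eq = half_act_eq[OF k Cons.prems(2)]
  have "?m \<in> free_vs B" by (simp add: free_vs_B eq)
  moreover have "foldr (\<lambda>k. shift k (\<alpha> k)) ls \<gamma> \<in> B" if "\<gamma> \<in> B" "set ls \<subseteq> H" for \<gamma> ls
    using that(2) by (induction ls) (use that(1) assms(2) shift_in_B in auto)
  ultimately show ?case using Cons by (auto simp: eq)
qed

text \<open>Colouring half-edges instead of edges removes the distinction between sources and
  targets: a shift at \<open>k\<close> always multiplies the colour of \<open>k\<close> on the right
  and that of \<open>\<iota> k\<close> on the left.\<close>

definition tau :: "(nat set \<Rightarrow> 'a) \<Rightarrow> nat \<Rightarrow> 'a" where
  "tau \<gamma> = (\<lambda>k\<in>H. if is_source \<Gamma> k then \<gamma> (edge_of \<Gamma> k) else inv \<gamma> (edge_of \<Gamma> k))"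

lemma edge_of_iota: "edge_of \<Gamma> (\<iota> k) = edge_of \<Gamma> k"
  by (auto simp: edge_of iota_iota)

lemma edge_of_eq_iff: "edge_of \<Gamma> l = edge_of \<Gamma> k \<longleftrightarrow> l = k \<or> l = \<iota> k"
  by (auto simp: edge_of iota_iota doubleton_eq_iff)

lemma tau_colourings: "\<gamma> \<in> B \<Longrightarrow> tau \<gamma> \<in> colourings \<iota> H"
  unfolding colourings_iff
  by (auto simp: tau_def edge_value iota_in edge_of_iota is_source_iota)

lemma tau_bij: "bij_betw tau B (colourings \<iota> H)"
proof (rule bij_betw_imageI)
  show "inj_on tau B"
  proof (rule inj_onI)
    fix \<gamma> \<gamma>' assume g: "\<gamma> \<in> B" "\<gamma>' \<in> B" "tau \<gamma> = tau \<gamma>'"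
    have "\<gamma> (edge_of \<Gamma> k) = \<gamma>' (edge_of \<Gamma> k)" if "k \<in> H" for k
    proof -
      have "tau \<gamma> k = tau \<gamma>' k" using g(3) by simp
      then have "\<gamma> (edge_of \<Gamma> k) = \<gamma>' (edge_of \<Gamma> k) \<or> inv \<gamma> (edge_of \<Gamma> k) = inv \<gamma>' (edge_of \<Gamma> k)"
        using that by (simp add: tau_def split: if_splits)
      then show ?thesis using inv_inv[OF edge_value[OF g(1) that]] inv_inv[OF edge_value[OF g(2) that]] by metis
    qed
    then have "\<gamma> e = \<gamma>' e" if "e \<in> edges \<Gamma>" for e using that unfolding edges_def by blast
    then show "\<gamma> = \<gamma>'" by (rule PiE_ext[OF g(1,2)])
  qed
  show "tau ` B = colourings \<iota> H"
  proof (intro equalityI subsetI)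
    fix \<tau> assume t: "\<tau> \<in> colourings \<iota> H"
    define \<gamma> where "\<gamma> = (\<lambda>e\<in>edges \<Gamma>. \<tau> (inv_into sources (edge_of \<Gamma>) e))"
    have src: "\<gamma> (edge_of \<Gamma> k) = \<tau> k" if "k \<in> sources" for k
      using that edge_of_bij by (simp add: \<gamma>_def bij_betw_def edges_def sources_def)
    have edge: "\<exists>k\<in>sources. e = edge_of \<Gamma> k" if "e \<in> edges \<Gamma>" for e
      using that edge_of_bij by (auto simp: bij_betw_def)
    have "\<gamma> \<in> B"
    proof (rule PiE_I)
      fix e assume "e \<in> edges \<Gamma>"
      then obtain k where "k \<in> sources" "e = edge_of \<Gamma> k" using edge by blast
      then show "\<gamma> e \<in> carrier G" using src colourings_closed[OF t] by (simp add: sources_def)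
    qed (simp add: \<gamma>_def)
    moreover have "tau \<gamma> = \<tau>"
    proof (rule colourings_eqI[OF tau_colourings[OF \<open>\<gamma> \<in> B\<close>] t])
      fix k assume k: "k \<in> H"
      show "tau \<gamma> k = \<tau> k"
      proof (cases "is_source \<Gamma> k")
        case True
        then show ?thesis using k src[of k] by (simp add: tau_def sources_def)
      next
        case False
        then have "\<gamma> (edge_of \<Gamma> k) = inv \<tau> k"
          using k src[of "\<iota> k"] by (simp add: sources_def is_source_iota iota_in edge_of_iota colourings_inv[OF t])
        then show ?thesis using k False colourings_closed[OF t k] by (simp add: tau_def)
      qed
    qed
    ultimately show "\<tau> \<in> tau ` B" by blast
  qed (use tau_colourings in auto)
qed

lemma tau_shift:
  assumes "\<gamma> \<in> B" "k \<in> H" "a \<in> carrier G" "l \<in> H"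
  shows "tau (shift k a \<gamma>) l =
    (if l = k then tau \<gamma> l \<otimes> a else if l = \<iota> k then inv a \<otimes> tau \<gamma> l else tau \<gamma> l)"
proof -
  consider "l = k" | "l = \<iota> k" "l \<noteq> k" | "l \<noteq> k" "l \<noteq> \<iota> k" by blast
  then show ?thesis
  proof cases
    case 1
    then show ?thesis using assms edge_value[OF assms(1,2)] by (auto simp: tau_def shift_def inv_mult_group)
  next
    case 2
    then show ?thesis
      using assms edge_value[OF assms(1,2)]
      by (auto simp: tau_def shift_def inv_mult_group edge_of_iota is_source_iota)
  next
    case 3
    then have "edge_of \<Gamma> l \<noteq> edge_of \<Gamma> k" by (simp add: edge_of_eq_iff)
    then show ?thesis using 3 by (simp add: tau_def shift_def)
  qed
qed

lemma foldr_shift_in_B: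
  assumes "\<gamma> \<in> B" "set ks \<subseteq> H" "\<And>k. k \<in> H \<Longrightarrow> \<alpha> k \<in> carrier G"
  shows "foldr (\<lambda>k. shift k (\<alpha> k)) ks \<gamma> \<in> B"
  using assms(2) by (induction ks) (use assms(1,3) shift_in_B in auto)

text \<open>The colour of \<open>l\<close> is changed at most twice, on the right by the shift at
  \<open>l\<close> and on the left by the shift at \<open>\<iota> l\<close>. These commute, so only
  membership in the list matters.\<close>

lemma tau_foldr_shift:
  assumes "\<gamma> \<in> B" "set ks \<subseteq> H" "distinct ks" "\<And>k. k \<in> H \<Longrightarrow> \<alpha> k \<in> carrier G" "l \<in> H"
  shows "tau (foldr (\<lambda>k. shift k (\<alpha> k)) ks \<gamma>) l =
    (if \<iota> l \<in> set ks then inv \<alpha> (\<iota> l) else \<one>) \<otimes> tau \<gamma> l \<otimes> (if l \<in> set ks then \<alpha> l else \<one>)"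
  using assms(2,3)
proof (induction ks)
  case Nil
  then show ?case using colourings_closed[OF tau_colourings[OF assms(1)] assms(5)] by simp
next
  case (Cons k ks)
  have k: "k \<in> H" "\<alpha> k \<in> carrier G" "set ks \<subseteq> H" using Cons.prems assms(4) by auto
  have il: "\<alpha> l \<in> carrier G" "\<alpha> (\<iota> l) \<in> carrier G" "\<iota> l \<noteq> l"
    using assms(4,5) iota_in ribbon(5) by auto
  have eq: "l = \<iota> k \<longleftrightarrow> \<iota> l = k" using iota_iota by auto
  have t: "tau \<gamma> l \<in> carrier G" using colourings_closed[OF tau_colourings[OF assms(1)] assms(5)] .
  show ?case
    using Cons.IH Cons.prems k il t tau_shift[OF foldr_shift_in_B[OF assms(1) k(3) assms(4)] k(1,2) assms(5)]
    by (auto simp: eq m_assoc)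
qed

section \<open>The combined action of all cilia as one gauge transformation\<close>

definition half_list :: "nat list" where
  "half_list = concat (map (support \<rho>) (sorted_list_of_set C))"

lemma set_concat_map: "set (concat (map f xs)) = (\<Union>x\<in>set xs. set (f x))"
  by simp

lemma set_half_list: "set half_list = H"
proof -
  have "set half_list = (\<Union>c\<in>C. orbit \<rho> c)"
    unfolding half_list_def set_concat_map set_support[OF permutations(1)] using cilia(2) by simp
  also have "\<dots> = H"
    using cil_eq cil(1) cilia(1) orbit_subset_H[OF ribbon(3)] by blast
  finally show ?thesis .
qed

lemma distinct_half_list: "distinct half_list"
proof -
  have "distinct (concat (map (support \<rho>) cs))" if "set cs \<subseteq> C" "distinct cs" for cs
    using that
  proof (induction cs)
    case (Cons c cs)
    have "distinct (support \<rho> c)" by (rule cycle_of_permutation[OF permutations(1)])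
    moreover have "set (support \<rho> c) \<inter> set (concat (map (support \<rho>) cs)) = {}"
    proof (rule equals0I)
      fix k assume "k \<in> set (support \<rho> c) \<inter> set (concat (map (support \<rho>) cs))"
      then obtain d where d: "k \<in> set (support \<rho> c)" "d \<in> set cs" "k \<in> set (support \<rho> d)"
        unfolding set_concat_map by blast
      then have "k \<in> orbit \<rho> c" "k \<in> orbit \<rho> d"
        unfolding set_support[OF permutations(1)] by blast+
      moreover have "c \<in> C" "d \<in> C" using Cons.prems d(2) by auto
      moreover have "k \<in> H"
        using calculation(1,3) orbit_subset_H[OF ribbon(3)] cilia(1) by blast
      ultimately have "c = d" using cil_eq by blast
      then show False using Cons.prems(2) d(2) by simp
    qed
    ultimately show ?case using Cons by (simp only: list.map concat.simps distinct_append) simp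
  qed simp
  then show ?thesis by (simp add: half_list_def cilia(2))
qed

definition act :: "(nat \<Rightarrow> 'a) \<Rightarrow> (nat set \<Rightarrow> 'a) \<Rightarrow> nat set \<Rightarrow> 'a" where
  "act \<kappa> = foldr (\<lambda>k. shift k (\<kappa> (cil k))) half_list"

lemma cilia_basis_closed: "\<kappa> \<in> cilia_basis G \<Gamma> \<Longrightarrow> k \<in> H \<Longrightarrow> \<kappa> (cil k) \<in> carrier G"
  using cil(1) by (auto simp: cilia_basis_def)

lemma act_in_B: "\<kappa> \<in> cilia_basis G \<Gamma> \<Longrightarrow> \<gamma> \<in> B \<Longrightarrow> act \<kappa> \<gamma> \<in> B"
  unfolding act_def by (rule foldr_shift_in_B) (use cilia_basis_closed set_half_list in auto)

text \<open>The inverse appears because \<open>act\<close> moves the argument of a coefficient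
  function, not the basis element.\<close>

lemma tau_act:
  assumes "\<kappa> \<in> cilia_basis G \<Gamma>" "\<gamma> \<in> B"
  shows "tau (act \<kappa> \<gamma>) = gauge \<iota> cil H (\<lambda>c. inv \<kappa> c) (tau \<gamma>)"
proof
  fix l
  show "tau (act \<kappa> \<gamma>) l = gauge \<iota> cil H (\<lambda>c. inv \<kappa> c) (tau \<gamma>) l"
  proof (cases "l \<in> H")
    case True
    then have "\<iota> l \<in> H" by (simp add: iota_in)
    have "tau (act \<kappa> \<gamma>) l = inv \<kappa> (cil (\<iota> l)) \<otimes> tau \<gamma> l \<otimes> \<kappa> (cil l)"
      unfolding act_def
      by (subst tau_foldr_shift[OF assms(2) _ distinct_half_list _ True])
        (use set_half_list cilia_basis_closed[OF assms(1)] True \<open>\<iota> l \<in> H\<close> in auto)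
    then show ?thesis using True cilia_basis_closed[OF assms(1) True] by (simp add: gauge_def)
  qed (simp add: tau_def gauge_def)
qed

definition sigma :: "(nat \<Rightarrow> 'a) \<Rightarrow> 'k" where
  "sigma \<kappa> = (\<Prod>k\<in>sources. chr (\<kappa> (cil k)))"

lemma fold_cilium_act:
  assumes "set cs \<subseteq> C"
  shows "fold (\<lambda>c. cilium_act G M \<Gamma> c (single (\<kappa> c))) cs m =
    fold (\<lambda>k. half_act G M \<Gamma> k (single (\<kappa> (cil k)))) (concat (map (support \<rho>) cs)) m"
  using assms
proof (induction cs arbitrary: m)
  case (Cons c cs)
  have "fold (\<lambda>k. half_act G M \<Gamma> k (single (\<kappa> c))) (support \<rho> c) m =
      fold (\<lambda>k. half_act G M \<Gamma> k (single (\<kappa> (cil k)))) (support \<rho> c) m"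
  proof (rule fold_cong[OF HOL.refl HOL.refl])
    fix k assume "k \<in> set (support \<rho> c)"
    then have k: "k \<in> orbit \<rho> c" unfolding set_support[OF permutations(1)] .
    moreover have "k \<in> H" using k orbit_subset_H[OF ribbon(3)] Cons.prems cilia(1) by auto
    ultimately have "cil k = c" using cil_eq Cons.prems by simp
    then show "half_act G M \<Gamma> k (single (\<kappa> c)) = half_act G M \<Gamma> k (single (\<kappa> (cil k)))" by simp
  qed
  then show ?case using Cons by (simp add: cilium_act_def)
qed simp

lemma finite_cilia_basis: "finite (cilia_basis G \<Gamma>)"
  unfolding cilia_basis_def by (intro finite_PiE cilia(2) finite_G)

lemma lact_eq:
  assumes b: "b \<in> free_vs (cilia_basis G \<Gamma>)" and m: "m \<in> free_vs B"
  shows "lact (ext_hilbert G M \<Gamma>) b m \<gamma> =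
    (if \<gamma> \<in> B then \<Sum>\<kappa>\<in>cilia_basis G \<Gamma>. b \<kappa> * (sigma \<kappa> * m (act \<kappa> \<gamma>)) else 0)"
proof -
  have "fold (\<lambda>c. cilium_act G M \<Gamma> c (single (\<kappa> c))) (sorted_list_of_set C) m \<gamma> =
      (if \<gamma> \<in> B then sigma \<kappa> * m (act \<kappa> \<gamma>) else 0)" if \<kappa>: "\<kappa> \<in> cilia_basis G \<Gamma>" for \<kappa>
  proof -
    have "(\<Prod>k\<leftarrow>half_list. if is_source \<Gamma> k then chr (\<kappa> (cil k)) else 1) = sigma \<kappa>"
      unfolding prod.distinct_set_conv_list[OF distinct_half_list, symmetric] set_half_list sigma_def sources_def
      using ribbon(1) by (simp add: prod.inter_filter)
    then show ?thesis
      using fold_half_act[of half_list "\<lambda>k. \<kappa> (cil k)" m] cilia_basis_closed[OF \<kappa>] m cilia(2) set_half_list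
      by (simp add: fold_cilium_act act_def flip: half_list_def)
  qed
  then show ?thesis
    by (simp add: ext_hilbert_def lin_ext_def lin_form_finite[OF finite_cilia_basis b])
qed

text \<open>The group element on which the functional in the operator at \<open>k\<close> is
  evaluated. For an edge value \<open>y\<close> it is \<open>y\<close> at a source and the antipode
  of \<open>y \<otimes> p\<close> at a target.\<close>

definition deg :: "nat \<Rightarrow> (nat set \<Rightarrow> 'a) \<Rightarrow> 'a" where
  "deg k \<gamma> = tau \<gamma> k \<otimes> (if is_source \<Gamma> k then \<one> else inv p)"

lemma deg_closed: "\<gamma> \<in> B \<Longrightarrow> k \<in> H \<Longrightarrow> deg k \<gamma> \<in> carrier G"
  using colourings_closed[OF tau_colourings] p_closed by (simp add: deg_def)

lemma lin_ext_basis_map: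
  assumes "inj f" "finite A" "n \<in> free_vs A"
  shows "lin_ext F (lin_ext (\<lambda>x. single (f x)) n) y = lin_form (\<lambda>x. F (f x) y) (n :: 'x \<Rightarrow> 'k)"
proof -
  let ?w = "lin_ext (\<lambda>x. single (f x)) n"
  have w: "?w z = (\<Sum>x\<in>A. if z = f x then n x else 0)" for z
    unfolding lin_ext_def lin_form_finite[OF assms(2,3)] by (rule sum.cong) (auto simp: single_def)
  have wf: "?w (f x) = n x" for x
    using assms by (simp add: w inj_eq finite_support_free_vs)
  have "?w \<in> free_vs (f ` A)"
    using assms(2) by (auto simp: finite_support_free_vs w intro!: sum.neutral)
  then have "lin_ext F ?w y = (\<Sum>z\<in>f ` A. ?w z * F z y)"
    unfolding lin_ext_def using assms(2) by (intro lin_form_finite) auto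
  also have "\<dots> = (\<Sum>x\<in>A. n x * F (f x) y)"
    by (simp add: sum.reindex[OF inj_on_subset[OF assms(1) subset_UNIV]] wf)
  finally show ?thesis by (simp add: lin_form_finite[OF assms(2,3)])
qed

lemma tensor_single: "tensor (single x) (single y) = (single (x, y) :: _ \<Rightarrow> 'k)"
  by (auto simp: tensor_def single_def fun_eq_iff)

text \<open>All legs of the coaction are multiples of the same group element, so a dual basis vector
  just projects onto the basis elements of the given degree.\<close>

lemma half_coact_eq:
  assumes k: "k \<in> H" and m: "m \<in> free_vs B"
  shows "half_coact G M \<Gamma> k (\<lambda>a. a x) m = (\<lambda>\<gamma>. if deg k \<gamma> = x then m \<gamma> else 0)"
proof
  fix \<gamma>
  let ?e = "edge_of \<Gamma> k" and ?n = "\<lambda>x. m (\<gamma>(edge_of \<Gamma> k := x))"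
  define F :: "'a \<times> 'a \<times> 'a \<Rightarrow> 'a \<Rightarrow> 'k" where "F = (\<lambda>(y, z, w). fscale
     (if is_source \<Gamma> k then single y x * counit G (single w)
      else counit G (single y) * antipode G (single w) x) (single z))"
  have n: "?n \<in> grp_alg G" using k m by (intro slice_grp_alg edge_in)
  have inj: "inj (\<lambda>y. (y, y, y \<otimes> p))" by (simp add: inj_def)
  have F: "F (y, y, y \<otimes> p) z = (if z = y \<and> x = (if is_source \<Gamma> k then y else inv y \<otimes> inv p) then 1 else 0)"
    if y: "y \<in> carrier G" for y z
  proof -
    have "inv (y \<otimes> p) = inv y \<otimes> inv p"
      using y p_closed central_comm[OF p_central y] by (metis inv_mult_group)
    then have "F (y, y, y \<otimes> p) z = (if is_source \<Gamma> k then single y x else single (inv y \<otimes> inv p) x) * single y z"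
      using y p_closed by (simp add: F_def counit_char)
    then show ?thesis by (simp add: single_def)
  qed
  have "half_coact G M \<Gamma> k (\<lambda>a. a x) m \<gamma> =
      lin_ext F (lin_ext (\<lambda>y. single (y, y, y \<otimes> p)) ?n) (\<gamma> ?e)"
    by (simp add: half_coact_def on_factor_def M_def induced_bimodule_def tensor_single F_def)
  also have "\<dots> = (\<Sum>y\<in>carrier G. ?n y * F (y, y, y \<otimes> p) (\<gamma> ?e))"
    by (simp add: lin_ext_basis_map[OF inj finite_G n] lin_form_G[OF n])
  also have "\<dots> = (\<Sum>y\<in>carrier G. if y = \<gamma> ?e then
      (if x = (if is_source \<Gamma> k then y else inv y \<otimes> inv p) then ?n y else 0) else 0)"
    by (rule sum.cong) (auto simp: F)
  also have "\<dots> = (if \<gamma> ?e \<in> carrier G \<and> deg k \<gamma> = x then m \<gamma> else 0)"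
    using finite_G k p_closed by (auto simp: deg_def tau_def)
  also have "\<dots> = (if deg k \<gamma> = x then m \<gamma> else 0)"
    using edge_value[OF _ k] m by (auto simp: free_vs_B)
  finally show "half_coact G M \<Gamma> k (\<lambda>a. a x) m \<gamma> = (if deg k \<gamma> = x then m \<gamma> else 0)" .
qed

lemma fold_half_coact:
  assumes "length ks = length xs" "set ks \<subseteq> H" "m \<in> free_vs B"
  shows "fold (\<lambda>(k, x). half_coact G M \<Gamma> k (\<lambda>a. a x)) (zip ks xs) m =
    (\<lambda>\<gamma>. if map (\<lambda>k. deg k \<gamma>) ks = xs then m \<gamma> else 0)"
  using assms
proof (induction ks xs arbitrary: m rule: list_induct2)
  case (Cons k ks x xs)
  let ?m = "\<lambda>\<gamma>. if deg k \<gamma> = x then m \<gamma> else 0"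
  have "?m \<in> free_vs B" using Cons.prems by (simp add: free_vs_B)
  then have "fold (\<lambda>(k, x). half_coact G M \<Gamma> k (\<lambda>a. a x)) (zip ks xs) ?m =
      (\<lambda>\<gamma>. if map (\<lambda>k. deg k \<gamma>) ks = xs then ?m \<gamma> else 0)"
    using Cons.IH Cons.prems by simp
  moreover have "half_coact G M \<Gamma> k (\<lambda>a. a x) m = ?m"
    using Cons.prems by (intro half_coact_eq) simp_all
  ultimately show ?case by (simp only: zip_Cons_Cons fold_simps prod.case) auto
qed simp

definition deg_word :: "nat \<Rightarrow> (nat set \<Rightarrow> 'a) \<Rightarrow> 'a" where
  "deg_word c \<gamma> = mprod (map (\<lambda>k. deg k \<gamma>) (word c))"

lemma word_in_H: "c \<in> C \<Longrightarrow> set (word c) \<subseteq> H"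
  using H_eq_words by blast

text \<open>For given \<open>\<gamma>\<close> the projections along the face annihilate the
  coefficient for every list \<open>xs\<close> except the one formed by the degrees along
  \<open>word c\<close>.\<close>

lemma holonomy_eq:
  assumes c: "c \<in> C" and m: "m \<in> free_vs B"
  shows "holonomy G M \<Gamma> c (\<lambda>a. a x) m \<gamma> = (if deg_word c \<gamma> = x then m \<gamma> else 0)"
proof -
  define ks where "ks = support \<phi> (rho_inv c)"
  have word: "word c = rev ks" by (simp add: word_def ks_def)
  have ks: "set ks \<subseteq> H" using word_in_H[OF c] by (simp add: word)
  let ?L = "{xs. length xs = length ks \<and> set xs \<subseteq> carrier G}"
  have fin: "finite ?L" using finite_lists_length_eq[OF finite_G, of "length ks"] by (simp add: conj_commute)
  have swap: "map (\<lambda>k. deg k \<gamma>) ks = rev xs \<longleftrightarrow> xs = map (\<lambda>k. deg k \<gamma>) (word c)" for xs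
    by (metis rev_map rev_rev_ident word)
  have "holonomy G M \<Gamma> c (\<lambda>a. a x) m \<gamma> =
      (\<Sum>xs\<in>?L. single (mprod xs) x * (if map (\<lambda>k. deg k \<gamma>) ks = rev xs then m \<gamma> else 0))"
    unfolding holonomy_def Let_def sum_fun_apply ks_def[symmetric] fscale_apply mprod_def
    by (rule sum.cong) (use fold_half_coact[OF _ ks m] in auto)
  also have "\<dots> = (\<Sum>xs\<in>?L. if xs = map (\<lambda>k. deg k \<gamma>) (word c) then single (mprod xs) x * m \<gamma> else 0)"
    by (rule sum.cong) (simp_all add: swap)
  also have "\<dots> = (if map (\<lambda>k. deg k \<gamma>) (word c) \<in> ?L then single (deg_word c \<gamma>) x * m \<gamma> else 0)"
    using fin by (simp add: deg_word_def)
  also have "\<dots> = (if deg_word c \<gamma> = x then m \<gamma> else 0)"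
  proof (cases "\<gamma> \<in> B")
    case True
    then have "map (\<lambda>k. deg k \<gamma>) (word c) \<in> ?L"
      using word_in_H[OF c] deg_closed by (auto simp: word)
    then show ?thesis by (simp add: single_def)
  qed (use m in \<open>simp add: free_vs_B\<close>)
  finally show ?thesis .
qed

lemma lcoact_eq:
  assumes \<kappa>: "\<kappa> \<in> cilia_basis G \<Gamma>" and m: "m \<in> free_vs B"
  shows "lcoact (ext_hilbert G M \<Gamma>) m (\<kappa>, \<gamma>) = (if \<forall>c\<in>C. deg_word c \<gamma> = \<kappa> c then m \<gamma> else 0)"
proof -
  have "fold (\<lambda>c m' \<gamma>'. cilium_coact G M \<Gamma> c m' (\<kappa> c, \<gamma>')) cs m =
      (\<lambda>\<gamma>. if \<forall>c\<in>set cs. deg_word c \<gamma> = \<kappa> c then m \<gamma> else 0)" if "set cs \<subseteq> C" for cs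
    using that m
  proof (induction cs arbitrary: m)
    case (Cons c cs)
    let ?m = "\<lambda>\<gamma>. if deg_word c \<gamma> = \<kappa> c then m \<gamma> else 0"
    have "?m \<in> free_vs B" using Cons.prems by (simp add: free_vs_B)
    moreover have "(\<lambda>\<gamma>'. cilium_coact G M \<Gamma> c m (\<kappa> c, \<gamma>')) = ?m"
      using Cons.prems \<kappa> holonomy_eq[of c m] by (auto simp: cilium_coact_def cilia_basis_def fun_eq_iff)
    ultimately show ?case using Cons by (auto simp: fun_eq_iff)
  qed simp
  then show ?thesis using \<kappa> cilia(2) by (simp add: ext_hilbert_def)
qed

text \<open>Every target on the face contributes one central factor \<open>inv p\<close>, and these
  can be collected at the end.\<close>

lemma deg_word_hol:
  assumes \<gamma>: "\<gamma> \<in> B" and c: "c \<in> C"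
  shows "deg_word c \<gamma> = hol (tau \<gamma>) (word c) \<otimes> p [^] (- int (card (set (word c) - sources)))"
proof -
  have t: "tau \<gamma> \<in> colourings \<iota> H" by (rule tau_colourings[OF \<gamma>])
  have "mprod (map (\<lambda>k. deg k \<gamma>) w) = hol (tau \<gamma>) w \<otimes> p [^] (- int (card (set w - sources)))"
    if "set w \<subseteq> H" "distinct w" for w
    using that
  proof (induction w)
    case (Cons k w)
    have k: "tau \<gamma> k \<in> carrier G" "hol (tau \<gamma>) w \<in> carrier G" "k \<in> H"
      using Cons.prems colourings_closed[OF t] hol_closed[OF t, of w] by auto
    let ?n = "card (set w - sources)"
    define z where "z = p [^] (- int ?n)"
    have z: "z \<in> carrier G" using p_closed by (simp add: z_def)
    show ?case
    proof (cases "is_source \<Gamma> k")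
      case True
      then have "set (k # w) - sources = set w - sources" using k by (auto simp: sources_def)
      then show ?thesis using Cons True k z by (simp add: deg_def m_assoc flip: z_def)
    next
      case False
      then have "set (k # w) - sources = insert k (set w - sources)" by (auto simp: sources_def)
      then have "card (set (k # w) - sources) = Suc ?n" using Cons.prems by simp
      moreover have "p [^] (- int (Suc ?n)) = inv p \<otimes> z"
        using p_closed int_pow_mult[of p "-1" "- int ?n"] by (simp add: z_def int_pow_neg)
      moreover have "hol (tau \<gamma>) w \<otimes> (inv p \<otimes> z) = inv p \<otimes> (hol (tau \<gamma>) w \<otimes> z)"
        by (rule central_left_comm[OF central_inv[OF p_central] k(2) z])
      ultimately show ?thesis using Cons False k z p_closed by (simp add: deg_def m_assoc flip: z_def)
    qed
  qed (simp add: deg_word_def)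
  then show ?thesis unfolding deg_word_def using word_in_H[OF c] distinct_word by blast
qed

end

subsection \<open>The Yetter-Drinfeld module of surface group representations\<close>

context finite_grp
begin

lemma lin_form_diff:
  "finite A \<Longrightarrow> v \<in> free_vs A \<Longrightarrow> w \<in> free_vs A \<Longrightarrow> lin_form \<phi> (v - w) = lin_form \<phi> v - lin_form \<phi> w"
  using fv.subspace_diff[OF subspace_free_vs, of v A w]
  by (simp add: lin_form_finite algebra_simps sum_subtractf)

lemma conj_hom_one: "f \<in> Hom_grp (surface_group g) G \<Longrightarrow> conj_hom g \<one> f = f"
  by (rule extensionalityI[of _ "carrier (surface_group g)"])
    (auto simp: conj_hom_def Hom_grp_closed, simp add: Hom_grp_def)

lemma conj_hom_mult:
  assumes "h \<in> carrier G" "k \<in> carrier G" "f \<in> Hom_grp (surface_group g) G"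
  shows "conj_hom g h (conj_hom g k f) = conj_hom g (h \<otimes> k) f"
  by (rule extensionalityI[of _ "carrier (surface_group g)"])
    (use assms Hom_grp_closed[OF assms(3)] in \<open>simp_all add: conj_hom_def word_simps\<close>)

lemma surf_homs_Hom: "f \<in> surf_homs g q \<Longrightarrow> f \<in> Hom_grp (surface_group g) G"
  by (simp add: surf_homs_def)

lemma finite_handles: "finite (handles n)"
proof -
  have "finite {hs. set hs \<subseteq> carrier G \<times> carrier G \<and> length hs = n}"
    using finite_G by (intro finite_lists_length_eq) simp
  then show ?thesis by (simp add: handles_def conj_commute)
qed

lemma graded_part_Omega:
  "graded_part q (Omega G g) = (free_vs (surf_homs g q) :: (_ \<Rightarrow> 'k::field) set)"
proof -
  have coact: "lcoact (Omega G g) v (a, f) = (if a = f (surface_x g) then v f else 0)"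
    if v: "v \<in> free_vs (Hom_grp (surface_group g) G)" for v :: "_ \<Rightarrow> 'k" and a f
  proof -
    have fin: "finite {f. v f \<noteq> 0}" and sup: "v \<in> free_vs {f. v f \<noteq> 0}"
      using v by (auto simp: free_vs_def)
    have "lcoact (Omega G g) v (a, f) =
        (\<Sum>f' | v f' \<noteq> 0. if f' = f then if a = f (surface_x g) then v f else 0 else 0)"
      unfolding Omega_def left_modcomod.simps lin_ext_def lin_form_finite[OF fin sup]
      by (rule sum.cong) (auto simp: tensor_def single_def)
    then show ?thesis using fin by simp
  qed
  have "v \<in> graded_part q (Omega G g) \<longleftrightarrow> v \<in> free_vs (surf_homs g q)" for v :: "_ \<Rightarrow> 'k"
  proof (cases "v \<in> free_vs (Hom_grp (surface_group g) G)")
    case True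
    have "lcoact (Omega G g) v = tensor (single q) v \<longleftrightarrow> (\<forall>f. v f \<noteq> 0 \<longrightarrow> f (surface_x g) = q)"
      unfolding fun_eq_iff split_paired_All coact[OF True] by (auto simp: tensor_def single_def)
    moreover have "lbasis (Omega G g :: (_, 'a, 'k) left_modcomod) = Hom_grp (surface_group g) G" by (simp add: Omega_def)
    ultimately show ?thesis using True by (auto simp: graded_part_def free_vs_def surf_homs_def)
  qed (auto simp: graded_part_def free_vs_def surf_homs_def Omega_def)
  then show ?thesis by blast
qed

end

section \<open>Homomorphisms of fixed central degree under conjugation\<close>

locale surface_rep = finite_grp G for G (structure) +
  fixes g :: nat and q :: 'a and \<chi> :: "('a \<Rightarrow> 'k::field) \<Rightarrow> 'k"
  assumes chi_alg: "\<chi> \<in> algebra_maps G" and q_central: "central q" and q_genus_0: "g = 0 \<Longrightarrow> q = \<one>"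
begin

abbreviation "T \<equiv> surf_homs g q"

abbreviation wt :: "'a \<Rightarrow> 'k" where
  "wt h \<equiv> \<chi> (single h) ^ (2 * g)"

text \<open>In the quotient, acting by \<open>h\<close> multiplies by
  \<open>\<theta> (single h)\<close>, the inverse of \<open>wt h\<close>. Hence \<open>f\<close> is
  identified with \<open>wt h\<close> times its conjugate.\<close>

definition Q :: "(surf_gen word set \<Rightarrow> 'a) \<Rightarrow> 'k \<Rightarrow> (surf_gen word set \<Rightarrow> 'a) \<Rightarrow> bool" where
  "Q f d f' \<longleftrightarrow> (\<exists>h\<in>carrier G. f' = conj_hom g h f \<and> d = wt h)"

definition \<theta> :: "('a \<Rightarrow> 'k) \<Rightarrow> 'k" where
  "\<theta> = \<chi> [^]\<^bsub>char_group G\<^esub> (- 2 * int g)"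

lemma theta: "\<theta> \<in> algebra_maps G" "h \<in> carrier G \<Longrightarrow> \<theta> (single h) = inverse (wt h)"
  unfolding \<theta>_def using char_group_neg_pow[OF chi_alg] by auto

lemma wt: "h \<in> carrier G \<Longrightarrow> wt h \<noteq> 0"
    "h \<in> carrier G \<Longrightarrow> k \<in> carrier G \<Longrightarrow> wt (h \<otimes> k) = wt h * wt k"
    "wt \<one> = 1" "h \<in> carrier G \<Longrightarrow> wt (inv h) = inverse (wt h)"
  using char_nonzero[OF chi_alg] char_mult[OF chi_alg] char_one[OF chi_alg]
  by (simp_all add: power_mult_distrib power_inverse)

lemma finite_T: "finite T"
  using bij_betw_finite[OF hom_handles_bij[OF q_central q_genus_0]] finite_handles by auto

lemma conj_T: "h \<in> carrier G \<Longrightarrow> f \<in> T \<Longrightarrow> conj_hom g h f \<in> T"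
  using conj_hom_surf_homs q_central by blast

lemma conj_inv:
  assumes "h \<in> carrier G" "f \<in> T"
  shows "conj_hom g (inv h) (conj_hom g h f) = f" "conj_hom g h (conj_hom g (inv h) f) = f"
  using assms by (simp_all add: conj_hom_mult conj_hom_one surf_homs_Hom)

lemma weighted_equiv_Q: "weighted_equiv T Q"
proof
  show "finite T" by (rule finite_T)
  fix f assume f: "f \<in> T"
  show "Q f 1 f" unfolding Q_def using wt(3) conj_hom_one[OF surf_homs_Hom[OF f]] by (intro bexI[of _ \<one>]) auto
  fix d f' assume "Q f d f'"
  then obtain h where h: "h \<in> carrier G" "f' = conj_hom g h f" "d = wt h" by (auto simp: Q_def)
  show "Q f' (inverse d) f"
    unfolding Q_def using h f wt(4)[OF h(1)] conj_inv by (intro bexI[of _ "inv h"]) auto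
  show "d \<noteq> 0" using h wt(1) by simp
  show "f' \<in> T" using h f conj_T by simp
  fix e f'' assume "Q f' e f''"
  then obtain k where k: "k \<in> carrier G" "f'' = conj_hom g k f'" "e = wt k" by (auto simp: Q_def)
  have "f'' = conj_hom g (k \<otimes> h) f" using h k f by (simp add: conj_hom_mult surf_homs_Hom)
  moreover have "d * e = wt (k \<otimes> h)" using h k wt(2) by simp
  ultimately show "Q f (d * e) f''" unfolding Q_def using h k by blast
qed

lemma lact_Omega:
  assumes "v \<in> free_vs T" "a \<in> grp_alg G"
  shows "lact (Omega G g) a v f' =
    (\<Sum>f\<in>T. v f * (\<Sum>h\<in>carrier G. a h * (single (conj_hom g h f) f' :: 'k)))"
  unfolding Omega_def left_modcomod.simps lin_ext_def lin_form_finite[OF finite_T assms(1)]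
    lin_form_G[OF assms(2)] conj_hom_def ..

lemma lact_Omega_single:
  assumes "v \<in> free_vs T" "h \<in> carrier G" "f' \<in> T"
  shows "lact (Omega G g) (single h) v f' = (v (conj_hom g (inv h) f') :: 'k)"
proof -
  have eq: "f' = conj_hom g h f \<longleftrightarrow> f = conj_hom g (inv h) f'" if "f \<in> T" for f
    using conj_inv assms that by auto
  have "lact (Omega G g) (single h) v f' = (\<Sum>f\<in>T. v f * (\<Sum>k\<in>carrier G. if k = h then single (conj_hom g h f) f' else 0))"
    unfolding lact_Omega[OF assms(1) single_grp_alg[OF assms(2)]]
    by (intro sum.cong HOL.refl arg_cong2[of _ _ _ _ "(*)"]) (auto simp: single_def)
  also have "\<dots> = (\<Sum>f\<in>T. if f = conj_hom g (inv h) f' then v f else 0)"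
    using finite_G assms(2) eq by (intro sum.cong HOL.refl) (auto simp: single_def)
  also have "\<dots> = v (conj_hom g (inv h) f')"
    using finite_T conj_T[of "inv h" f'] assms by simp
  finally show ?thesis .
qed

lemma coinvariants_Omega:
  "linearly_isomorphic
    (quot_image (graded_part q (Omega G g)) (act_span (Omega G g) (char_kernel G \<theta>) (graded_part q (Omega G g))))
    (subspace_vs (free_vs (weighted_equiv.good_classes T Q)) :: ('k, _) module)"
  unfolding graded_part_Omega
proof (rule weighted_equiv.coinvariants_isomorphic[OF weighted_equiv_Q])
  let ?W = "act_span (Omega G g) (char_kernel G \<theta>) (free_vs T :: (_ \<Rightarrow> 'k) set)"
  show "fv.subspace ?W" by (simp add: act_span_def)
  show "single f - fscale d (single f') \<in> ?W" if f: "f \<in> T" and ff: "Q f d f'" for f d f'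
  proof -
    obtain h where h: "h \<in> carrier G" "f' = conj_hom g h f" "d = wt h" using ff by (auto simp: Q_def)
    \<comment> \<open>These differences lie in the kernel of \<open>\<theta>\<close>, and applied to
      \<open>single f\<close> they produce exactly the identifications of \<open>Q\<close>.\<close>
    define a :: "'a \<Rightarrow> 'k" where "a = single \<one> - fscale d (single h)"
    have s: "single \<one> \<in> grp_alg G" "fscale d (single h) \<in> grp_alg G"
      using h fv.subspace_scale[OF subspace_free_vs] single_grp_alg by blast+
    have aG: "a \<in> grp_alg G" unfolding a_def by (rule fv.subspace_diff[OF subspace_free_vs s])
    have lin: "lin_form \<phi> a = \<phi> \<one> - d * \<phi> h" for \<phi>
      unfolding a_def lin_form_diff[OF finite_G s] lin_form_scale[OF finite_G single_grp_alg[OF h(1)]]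
      by simp
    have "\<theta> a = 0"
      using wt(1,3) h(1) by (simp add: char_linear[OF theta(1) aG] lin theta(2) h(3))
    then have "a \<in> char_kernel G \<theta>" using aG by (simp add: char_kernel_def)
    moreover have "lact (Omega G g) a (single f) = single f - fscale d (single f')"
    proof
      fix z
      have "lact (Omega G g) a (single f) z = lin_form (\<lambda>h. single (conj_hom g h f) z) a"
        by (simp add: Omega_def lin_ext_def conj_hom_def)
      then show "lact (Omega G g) a (single f) z = (single f - fscale d (single f')) z"
        using conj_hom_one[OF surf_homs_Hom[OF f]] by (simp add: lin h(2))
    qed
    ultimately show ?thesis
      unfolding act_span_def
      by (intro fv.span_base CollectI exI[of _ a] exI[of _ "single f"] conjI)
        (simp_all add: single_in_free_vs f)
  qed
  fix w v :: "_ \<Rightarrow> 'k"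
  assume w: "\<And>x. x \<notin> T \<Longrightarrow> w x = 0" "\<And>x c y. x \<in> T \<Longrightarrow> Q x c y \<Longrightarrow> w x = c * w y" and v: "v \<in> ?W"
  have w_conj: "w (conj_hom g h f) = \<theta> (single h) * w f" if "h \<in> carrier G" "f \<in> T" for h f
  proof -
    have "Q f (wt h) (conj_hom g h f)" unfolding Q_def using that by blast
    then have "w f = wt h * w (conj_hom g h f)" by (rule w(2)[OF that(2)])
    then show ?thesis using wt(1)[OF that(1)] by (simp add: theta that)
  qed
  show "(\<Sum>x\<in>T. v x * w x) = 0"
    using v unfolding act_span_def
  proof (induction rule: fv.span_induct)
    case base
    show ?case by (rule fv.subspaceI) (auto simp: algebra_simps sum.distrib simp flip: sum_distrib_left)
  next
    case (step y)
    then obtain a u where a: "a \<in> grp_alg G" "\<theta> a = 0" and u: "u \<in> free_vs T" and y: "y = lact (Omega G g) a u"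
      by (auto simp: char_kernel_def)
    \<comment> \<open>For a general element of the kernel the sums are interchanged:
      \<open>w\<close> turns the action of each \<open>h\<close> into the factor
      \<open>\<theta> (single h)\<close>, so the coefficients of \<open>a\<close> add up to
      \<open>\<theta> a\<close>, which is 0.\<close>
    have "(\<Sum>x\<in>T. y x * w x) = (\<Sum>x\<in>T. \<Sum>f\<in>T. \<Sum>h\<in>carrier G. u f * a h * (single (conj_hom g h f) x * w x))"
      unfolding y lact_Omega[OF u a(1)] by (simp add: sum_distrib_left sum_distrib_right mult_ac)
    also have "\<dots> = (\<Sum>f\<in>T. \<Sum>x\<in>T. \<Sum>h\<in>carrier G. u f * a h * (single (conj_hom g h f) x * w x))"
      by (rule sum.swap)
    also have "\<dots> = (\<Sum>f\<in>T. \<Sum>h\<in>carrier G. \<Sum>x\<in>T. u f * a h * (single (conj_hom g h f) x * w x))"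
      by (rule sum.cong[OF HOL.refl]) (rule sum.swap)
    also have "\<dots> = (\<Sum>f\<in>T. \<Sum>h\<in>carrier G. u f * w f * (a h * \<theta> (single h)))"
    proof (intro sum.cong HOL.refl)
      fix f h assume fh: "f \<in> T" "h \<in> carrier G"
      have "(\<Sum>x\<in>T. u f * a h * (single (conj_hom g h f) x * w x)) =
          (\<Sum>x\<in>T. if x = conj_hom g h f then u f * a h * w x else 0)"
        by (intro sum.cong HOL.refl) (simp add: single_def)
      also have "\<dots> = u f * w f * (a h * \<theta> (single h))"
        using finite_T conj_T[OF fh(2,1)] w_conj[OF fh(2,1)] by simp
      finally show "(\<Sum>x\<in>T. u f * a h * (single (conj_hom g h f) x * w x)) = u f * w f * (a h * \<theta> (single h))" .
    qed
    also have "\<dots> = (\<Sum>f\<in>T. u f * w f * \<theta> a)"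
      by (simp add: char_linear[OF theta(1) a(1)] lin_form_G[OF a(1)] sum_distrib_left)
    finally show ?case using a(2) by simp
  qed
qed

text \<open>Acting by \<open>h\<close> pulls a function back along conjugation by
  \<open>inv h\<close>. Read at the conjugated argument, the character is inverted and becomes the
  weight of \<open>Q\<close>.\<close>

lemma invariants_Omega_eq:
  "{f \<in> graded_part q (Omega G g). \<forall>h\<in>carrier G. lact (Omega G g) (single h) f = fscale (\<theta> (single h)) f}
    = {f \<in> free_vs T. \<forall>x\<in>T. \<forall>c y. Q x c y \<longrightarrow> f y = c * f x}"
proof -
  have lact_out: "lact (Omega G g) (single h) v f' = 0" if "v \<in> free_vs T" "h \<in> carrier G" "f' \<notin> T" for h f' and v :: "_ \<Rightarrow> 'k"
    unfolding lact_Omega[OF that(1) single_grp_alg[OF that(2)]]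
    using conj_T that(3) by (intro sum.neutral ballI) (auto simp: single_def intro!: sum.neutral)
  have "(\<forall>h\<in>carrier G. lact (Omega G g) (single h) v = fscale (\<theta> (single h)) v) \<longleftrightarrow>
      (\<forall>x\<in>T. \<forall>c y. Q x c y \<longrightarrow> v y = c * v x)" if v: "v \<in> free_vs T" for v :: "_ \<Rightarrow> 'k"
  proof (intro iffI ballI allI impI)
    fix x c y assume inv: "\<forall>h\<in>carrier G. lact (Omega G g) (single h) v = fscale (\<theta> (single h)) v"
      and x: "x \<in> T" and "Q x c y"
    then obtain h where h: "h \<in> carrier G" "y = conj_hom g h x" "c = wt h" by (auto simp: Q_def)
    have "v x = \<theta> (single h) * v y"
      using lact_Omega_single[OF v h(1), of y] inv h x conj_T[OF h(1) x] conj_inv(1)[OF h(1) x] by simp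
    then show "v y = c * v x" using wt(1)[OF h(1)] h by (simp add: theta)
  next
    fix h assume inv: "\<forall>x\<in>T. \<forall>c y. Q x c y \<longrightarrow> v y = c * v x" and h: "h \<in> carrier G"
    show "lact (Omega G g) (single h) v = fscale (\<theta> (single h)) v"
    proof
      fix f'
      show "lact (Omega G g) (single h) v f' = fscale (\<theta> (single h)) v f'"
      proof (cases "f' \<in> T")
        case True
        let ?x = "conj_hom g (inv h) f'"
        have "Q ?x (wt h) f'" unfolding Q_def using h conj_inv(2)[OF h True] by (intro bexI[of _ h]) simp_all
        then have "v f' = wt h * v ?x" using inv conj_T[of "inv h" f'] h True by auto
        then show ?thesis using wt(1)[OF h] by (simp add: lact_Omega_single[OF v h True] theta h)
      next
        case False
        then show ?thesis using v lact_out[OF v h False] by (simp add: finite_support_free_vs finite_T)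
      qed
    qed
  qed
  then show ?thesis unfolding graded_part_Omega by blast
qed

lemma invariants_Omega:
  "linearly_isomorphic
    (subspace_vs {f \<in> graded_part q (Omega G g). \<forall>h\<in>carrier G. lact (Omega G g) (single h) f = fscale (\<theta> (single h)) f})
    (subspace_vs (free_vs (weighted_equiv.good_classes T Q)) :: ('k, _) module)"
  unfolding invariants_Omega_eq by (rule weighted_equiv.invariants_isomorphic[OF weighted_equiv_Q])

lemma subspace_invariants:
  "fv.subspace {f \<in> graded_part q (Omega G g). \<forall>h\<in>carrier G. lact (Omega G g) (single h) f = fscale (\<theta> (single h)) f}"
  unfolding invariants_Omega_eq
  by (rule fv.subspaceI) (auto simp: finite_support_free_vs finite_T algebra_simps)

end

subsection \<open>The protected space\<close>

lemma unit_fun_upd [simp]: "f(c := ()) = (f :: 'x \<Rightarrow> unit)"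
  by (simp add: fun_eq_iff)

lemma unit_fun_eq: "f = (h :: 'x \<Rightarrow> unit)"
  by (simp add: fun_eq_iff)

locale kitaev_genus = kitaev_data G \<Gamma> p \<chi> \<zeta> M
  for G (structure) and \<Gamma> and p and \<chi> :: "('a \<Rightarrow> 'k::field) \<Rightarrow> 'k" and \<zeta> and M +
  fixes g :: nat
  assumes genus: "genus \<Gamma> = of_nat g"
begin

definition Z :: "nat \<Rightarrow> (unit, 'a, 'k) right_modcomod" where
  "Z c = (if c = pt \<Gamma> then one_dim (counit G) \<one>
    else one_dim (\<chi> [^]\<^bsub>char_group G\<^esub> (2::int)) (p [^] (-2::int)))"

abbreviation "X \<equiv> cilia_tensor G \<Gamma> Z"
abbreviation "N \<equiv> ext_hilbert G M \<Gamma>"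

definition twist :: "nat \<Rightarrow> 'a" where
  "twist c = (if c = pt \<Gamma> then \<one> else p [^] (-2::int))"

definition lambda :: "(nat \<Rightarrow> 'a) \<Rightarrow> 'k" where
  "lambda \<kappa> = (\<Prod>c\<in>C - {pt \<Gamma>}. chr (\<kappa> c) ^ 2)"

text \<open>The only value of type \<open>unit\<close> is also \<open>undefined\<close>, so
  extensionality excludes nothing and the basis is the one existing function.\<close>

lemma rbasis_X: "rbasis X = UNIV"
  by (auto simp: cilia_tensor_def PiE_def Pi_def extensional_def Z_def one_dim_def)

lemma rcoact_X:
  assumes "\<kappa> \<in> cilia_basis G \<Gamma>"
  shows "rcoact X v (u, \<kappa>) = (if \<forall>c\<in>C. twist c = \<kappa> c then v u else 0)"
proof -
  have "on_factor c (\<lambda>w y. rcoact (Z c) w (y, \<kappa> c)) v = (\<lambda>u. if twist c = \<kappa> c then v u else 0)" for c v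
    by (auto simp: Z_def twist_def one_dim_def on_factor_def tensor_def single_def)
  then have "fold (\<lambda>c. on_factor c (\<lambda>w y. rcoact (Z c) w (y, \<kappa> c))) cs v =
      (\<lambda>u. if \<forall>c\<in>set cs. twist c = \<kappa> c then v u else 0)" for cs
    by (induction cs arbitrary: v) auto
  then show ?thesis using assms cilia(2) by (simp add: cilia_tensor_def)
qed

lemma ract_X:
  assumes b: "b \<in> free_vs (cilia_basis G \<Gamma>)"
  shows "ract X v b u = (\<Sum>\<kappa>\<in>cilia_basis G \<Gamma>. b \<kappa> * (lambda \<kappa> * v u))"
proof -
  have "fold (\<lambda>c. on_factor c (\<lambda>w. ract (Z c) w (single (\<kappa> c)))) (sorted_list_of_set C) v u = lambda \<kappa> * v u"
    if \<kappa>: "\<kappa> \<in> cilia_basis G \<Gamma>" for \<kappa>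
  proof -
    define s where "s c = (if c = pt \<Gamma> then 1 else chr (\<kappa> c) ^ 2)" for c
    have one: "on_factor c (\<lambda>w. ract (Z c) w (single (\<kappa> c))) v = fscale (s c) v" if "c \<in> C" for c v
    proof -
      have "\<kappa> c \<in> carrier G" using \<kappa> that by (auto simp: cilia_basis_def)
      then show ?thesis
        by (auto simp: Z_def one_dim_def on_factor_def s_def counit_char char_group_pow_nonneg
            char_group_nat_pow chi fun_eq_iff)
    qed
    have "fold (\<lambda>c. on_factor c (\<lambda>w. ract (Z c) w (single (\<kappa> c)))) cs v = fscale (prod_list (map s cs)) v"
      if "set cs \<subseteq> C" for cs
      using that by (induction cs arbitrary: v) (auto simp: one mult.commute fun_eq_iff)
    then have "fold (\<lambda>c. on_factor c (\<lambda>w. ract (Z c) w (single (\<kappa> c)))) (sorted_list_of_set C) v u =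
        prod s C * v u"
      using cilia(2) by (simp add: prod.distinct_set_conv_list[symmetric])
    also have "prod s C = lambda \<kappa>"
      using cilia(2,3) by (simp add: prod.remove[of C "pt \<Gamma>"] s_def lambda_def)
    finally show ?thesis .
  qed
  then show ?thesis by (simp add: cilia_tensor_def lin_ext_def lin_form_finite[OF finite_cilia_basis b])
qed

text \<open>
  The right coaction of M multiplies by p, so each target in a face contributes p\<inverse> to its degree.
\<close>

definition expo :: "nat \<Rightarrow> int" where
  "expo c = int (card (set (word c) - sources)) - (if c = pt \<Gamma> then 0 else 2)"

definition flat :: "(nat \<Rightarrow> 'a) set" where
  "flat = {\<tau> \<in> colourings \<iota> H. \<forall>c\<in>C. hol \<tau> (word c) = p [^] expo c}"

definition flat_B :: "(nat set \<Rightarrow> 'a) set" where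
  "flat_B = {\<gamma> \<in> B. tau \<gamma> \<in> flat}"

lemma flat_B_iff:
  assumes "\<gamma> \<in> B"
  shows "\<gamma> \<in> flat_B \<longleftrightarrow> (\<forall>c\<in>C. deg_word c \<gamma> = twist c)"
proof -
  have "deg_word c \<gamma> = twist c \<longleftrightarrow> hol (tau \<gamma>) (word c) = p [^] expo c" if c: "c \<in> C" for c
  proof -
    let ?n = "int (card (set (word c) - sources))" and ?h = "hol (tau \<gamma>) (word c)"
    have h: "?h \<in> carrier G" using hol_closed[OF tau_colourings[OF assms] word_in_H[OF c]] .
    have t: "twist c = p [^] (expo c - ?n)" by (simp add: twist_def expo_def)
    have e: "p [^] expo c = p [^] (expo c - ?n) \<otimes> p [^] ?n" "p [^] (- ?n) \<otimes> p [^] ?n = \<one>"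
      "p [^] ?n \<otimes> p [^] (- ?n) = \<one>"
      using p_closed by (simp_all flip: int_pow_mult)
    show ?thesis
    proof
      assume "deg_word c \<gamma> = twist c"
      then have "?h \<otimes> p [^] (- ?n) \<otimes> p [^] ?n = p [^] expo c"
        unfolding deg_word_hol[OF assms c] t e(1) by simp
      then show "?h = p [^] expo c" using h p_closed e(2) by (simp add: m_assoc)
    next
      assume "?h = p [^] expo c"
      then have "deg_word c \<gamma> = p [^] (expo c - ?n) \<otimes> (p [^] ?n \<otimes> p [^] (- ?n))"
        unfolding deg_word_hol[OF assms c] e(1) using p_closed by (simp add: m_assoc)
      then show "deg_word c \<gamma> = twist c" using p_closed e(3) by (simp add: t)
    qed
  qed
  then show ?thesis using assms by (auto simp: flat_B_def flat_def tau_colourings)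
qed

definition S :: "((nat \<Rightarrow> unit) \<times> (nat set \<Rightarrow> 'a)) set" where
  "S = UNIV \<times> flat_B"

lemma flat_B_subset: "flat_B \<subseteq> B"
  by (auto simp: flat_B_def)

lemma finite_unit_fun: "finite (UNIV :: (nat \<Rightarrow> unit) set)"
proof -
  have "(UNIV :: (nat \<Rightarrow> unit) set) = {\<lambda>_. ()}" by auto
  then show ?thesis by (metis finite.simps)
qed

lemma finite_S: "finite S"
  unfolding S_def using finite_unit_fun finite_subset[OF flat_B_subset finite_B] by blast

lemma lbasis_N: "lbasis N = B"
  by (simp add: ext_hilbert_def)

lemma finite_basis: "finite (UNIV \<times> B :: ((nat \<Rightarrow> unit) \<times> _) set)"
  using finite_unit_fun finite_B by blast

lemma twist_cilia_basis: "restrict twist C \<in> cilia_basis G \<Gamma>"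
  using p_closed by (auto simp: cilia_basis_def twist_def)

text \<open>Both coactions are diagonal on the chosen bases, with degrees \<open>twist\<close> and
  \<open>deg_word\<close>. A tensor lies in the cotensor product when it is supported where these
  degrees agree, which are the flat configurations.\<close>

lemma cotensor_eq: "cotensor X N = free_vs S"
proof -
  have "t \<in> cotensor X N \<longleftrightarrow> t \<in> free_vs S" for t :: "_ \<Rightarrow> 'k"
  proof (cases "t \<in> free_vs (UNIV \<times> B)")
    case True
    then have out: "t (u, \<gamma>) = 0" if "\<gamma> \<notin> B" for u \<gamma>
      using that by (auto simp: finite_support_free_vs finite_basis)
    have slice: "(\<lambda>\<gamma>. t (u, \<gamma>)) \<in> free_vs B" for u
      using out by (simp add: free_vs_B)
    have off: "rcoact X v (u, \<kappa>) = 0" "lcoact N m (\<kappa>, \<gamma>) = 0" if "\<kappa> \<notin> cilia_basis G \<Gamma>" for v u \<kappa> m \<gamma>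
      using that by (simp_all add: cilia_tensor_def ext_hilbert_def)
    have eq: "rcoact X (\<lambda>u'. t (u', \<gamma>)) (u, \<kappa>) = lcoact N (\<lambda>\<gamma>'. t (u, \<gamma>')) (\<kappa>, \<gamma>) \<longleftrightarrow>
        (\<kappa> \<in> cilia_basis G \<Gamma> \<longrightarrow> (if \<forall>c\<in>C. twist c = \<kappa> c then t (u, \<gamma>) else 0) =
          (if \<forall>c\<in>C. deg_word c \<gamma> = \<kappa> c then t (u, \<gamma>) else 0))" for u \<kappa> \<gamma>
      by (cases "\<kappa> \<in> cilia_basis G \<Gamma>") (simp_all only: rcoact_X lcoact_eq[OF _ slice] off simp_thms)
    have "t \<in> cotensor X N \<longleftrightarrow> (\<forall>u \<kappa> \<gamma>.
        rcoact X (\<lambda>u'. t (u', \<gamma>)) (u, \<kappa>) = lcoact N (\<lambda>\<gamma>'. t (u, \<gamma>')) (\<kappa>, \<gamma>))"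
      unfolding cotensor_def rbasis_X lbasis_N using True by blast
    also have "\<dots> \<longleftrightarrow> (\<forall>u. \<forall>\<kappa>\<in>cilia_basis G \<Gamma>. \<forall>\<gamma>.
        (if \<forall>c\<in>C. twist c = \<kappa> c then t (u, \<gamma>) else 0) = (if \<forall>c\<in>C. deg_word c \<gamma> = \<kappa> c then t (u, \<gamma>) else 0))"
      unfolding eq by blast
    also have "\<dots> \<longleftrightarrow> (\<forall>u \<gamma>. t (u, \<gamma>) \<noteq> 0 \<longrightarrow> (\<forall>c\<in>C. deg_word c \<gamma> = twist c))"
    proof (intro iffI allI impI ballI)
      fix u \<gamma> c
      assume *: "\<forall>u. \<forall>\<kappa>\<in>cilia_basis G \<Gamma>. \<forall>\<gamma>.
        (if \<forall>c\<in>C. twist c = \<kappa> c then t (u, \<gamma>) else 0) = (if \<forall>c\<in>C. deg_word c \<gamma> = \<kappa> c then t (u, \<gamma>) else 0)"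
        and t: "t (u, \<gamma>) \<noteq> 0" and c: "c \<in> C"
      \<comment> \<open>Comparing coefficients at the single degree \<open>restrict twist C\<close>
        suffices, since there the left side is \<open>t (u, \<gamma>)\<close> itself.\<close>
      have "(if \<forall>c\<in>C. twist c = restrict twist C c then t (u, \<gamma>) else 0) =
          (if \<forall>c\<in>C. deg_word c \<gamma> = restrict twist C c then t (u, \<gamma>) else 0)"
        using * twist_cilia_basis by blast
      then have "\<forall>c\<in>C. deg_word c \<gamma> = restrict twist C c" using t by (simp split: if_splits)
      then show "deg_word c \<gamma> = twist c" using c by simp
    next
      fix u \<kappa> \<gamma>
      assume *: "\<forall>u \<gamma>. t (u, \<gamma>) \<noteq> 0 \<longrightarrow> (\<forall>c\<in>C. deg_word c \<gamma> = twist c)"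
      show "(if \<forall>c\<in>C. twist c = \<kappa> c then t (u, \<gamma>) else 0) = (if \<forall>c\<in>C. deg_word c \<gamma> = \<kappa> c then t (u, \<gamma>) else 0)"
        using * by (cases "t (u, \<gamma>) = 0") auto
    qed
    also have "\<dots> \<longleftrightarrow> t \<in> free_vs S"
    proof -
      have "t \<in> free_vs S \<longleftrightarrow> (\<forall>u \<gamma>. \<gamma> \<notin> flat_B \<longrightarrow> t (u, \<gamma>) = 0)"
        by (simp add: finite_support_free_vs[OF finite_S]) (auto simp: S_def)
      moreover have "(\<gamma> \<notin> flat_B \<longrightarrow> t (u, \<gamma>) = 0) \<longleftrightarrow>
          (t (u, \<gamma>) \<noteq> 0 \<longrightarrow> (\<forall>c\<in>C. deg_word c \<gamma> = twist c))" for u \<gamma>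
        using out[of \<gamma> u] flat_B_iff[of \<gamma>] by (cases "\<gamma> \<in> B") auto
      ultimately show ?thesis by simp
    qed
    finally show ?thesis .
  next
    case False
    moreover have "free_vs S \<subseteq> (free_vs (UNIV \<times> B) :: (_ \<Rightarrow> 'k) set)"
      using flat_B_subset by (auto simp: free_vs_def S_def)
    ultimately show ?thesis by (auto simp: cotensor_def rbasis_X lbasis_N)
  qed
  then show ?thesis by blast
qed

text \<open>The tensor relation for the basis element \<open>\<kappa>\<close> moves it from the
  right module, where it acts by \<open>lambda \<kappa>\<close>, to the Hilbert space, where it acts
  by \<open>sigma \<kappa>\<close> and a gauge transformation. Dividing by
  \<open>lambda \<kappa>\<close> gives the scalar.\<close>

definition R :: "(nat \<Rightarrow> unit) \<times> (nat set \<Rightarrow> 'a) \<Rightarrow> 'k \<Rightarrow> (nat \<Rightarrow> unit) \<times> (nat set \<Rightarrow> 'a) \<Rightarrow> bool" where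
  "R x d y \<longleftrightarrow> snd x \<in> B \<and> snd y \<in> B \<and> (\<exists>\<kappa>. (\<forall>c. \<kappa> c \<in> carrier G) \<and>
    tau (snd y) = gauge \<iota> cil H \<kappa> (tau (snd x)) \<and> d = sigma \<kappa> / lambda \<kappa>)"

section \<open>Gauge equivalence of flat configurations and its scalars\<close>

lemma chr_mult: "x \<in> carrier G \<Longrightarrow> y \<in> carrier G \<Longrightarrow> chr (x \<otimes> y) = chr x * chr y"
  by (rule char_mult[OF chi])

lemma chr_nonzero: "x \<in> carrier G \<Longrightarrow> chr x \<noteq> 0"
  by (rule char_nonzero[OF chi])

lemma sigma_lambda:
  assumes "\<And>c. \<kappa> c \<in> carrier G"
  shows "sigma \<kappa> \<noteq> 0" "lambda \<kappa> \<noteq> 0"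
    "(\<And>c. \<mu> c \<in> carrier G) \<Longrightarrow> sigma (\<lambda>c. \<kappa> c \<otimes> \<mu> c) = sigma \<kappa> * sigma \<mu>"
    "(\<And>c. \<mu> c \<in> carrier G) \<Longrightarrow> lambda (\<lambda>c. \<kappa> c \<otimes> \<mu> c) = lambda \<kappa> * lambda \<mu>"
    "sigma (\<lambda>c. inv \<kappa> c) = inverse (sigma \<kappa>)" "lambda (\<lambda>c. inv \<kappa> c) = inverse (lambda \<kappa>)"
  using assms finite_subset[OF _ ribbon(1), of sources] cilia(2)
  by (auto simp: sigma_def lambda_def chr_mult chr_nonzero char_nonzero(2)[OF chi] prod.distrib
      power_mult_distrib prod_inversef[symmetric] power_inverse sources_def)

lemma sigma_one: "sigma (\<lambda>_. \<one>) = 1" "lambda (\<lambda>_. \<one>) = 1"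
  by (simp_all add: sigma_def lambda_def char_one[OF chi])

lemma gauge_flat:
  assumes "\<tau> \<in> flat" "\<And>c. \<kappa> c \<in> carrier G"
  shows "gauge \<iota> cil H \<kappa> \<tau> \<in> flat"
proof -
  interpret P: polygons \<iota> cil "pt \<Gamma>" H "word (pt \<Gamma>)" "C - {pt \<Gamma>}" word by (rule polygons)
  have t: "\<tau> \<in> colourings \<iota> H" "\<And>c. c \<in> C \<Longrightarrow> hol \<tau> (word c) = p [^] expo c"
    using assms(1) by (auto simp: flat_def)
  have "hol (gauge \<iota> cil H \<kappa> \<tau>) (word c) = hol \<tau> (word c)" if c: "c \<in> C" for c
  proof -
    obtain a where a: "lpath \<iota> cil a (word c) a"
      using P.path_W P.path_face[of c] c by (cases "c = pt \<Gamma>") auto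
    show ?thesis
      by (rule hol_gauge_central[OF _ a word_in_H[OF c] assms(2) t(1)])
        (simp add: t(2)[OF c] central_int_pow[OF p_central])
  qed
  moreover have "gauge \<iota> cil H \<kappa> \<tau> \<in> colourings \<iota> H"
    by (rule gauge_colourings[OF assms(2) iota_iota _ t(1)]) (simp add: iota_in)
  ultimately show ?thesis using t by (simp add: flat_def)
qed

lemma gauge_inv:
  assumes "\<tau> \<in> colourings \<iota> H" "\<And>c. \<kappa> c \<in> carrier G"
  shows "gauge \<iota> cil H (\<lambda>c. inv \<kappa> c) (gauge \<iota> cil H \<kappa> \<tau>) = \<tau>"
    "gauge \<iota> cil H \<kappa> (gauge \<iota> cil H (\<lambda>c. inv \<kappa> c) \<tau>) = \<tau>"
  using assms(2) gauge_one[OF assms(1), of cil]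
  by (simp_all add: gauge_gauge[OF _ _ assms(1)] iota_in)

lemma R_sym:
  assumes "R x d y"
  shows "R y (inverse d) x"
proof -
  obtain \<kappa> where \<kappa>: "\<And>c. \<kappa> c \<in> carrier G" "tau (snd y) = gauge \<iota> cil H \<kappa> (tau (snd x))"
    "d = sigma \<kappa> / lambda \<kappa>" and B: "snd x \<in> B" "snd y \<in> B"
    using assms by (auto simp: R_def)
  have "tau (snd x) = gauge \<iota> cil H (\<lambda>c. inv \<kappa> c) (tau (snd y))"
    unfolding \<kappa>(2) by (rule gauge_inv(1)[OF tau_colourings[OF B(1)] \<kappa>(1), symmetric])
  moreover have "inverse d = sigma (\<lambda>c. inv \<kappa> c) / lambda (\<lambda>c. inv \<kappa> c)"
    using sigma_lambda(5,6)[OF \<kappa>(1)] by (simp add: \<kappa>(3) divide_inverse)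
  ultimately show ?thesis
    unfolding R_def using B \<kappa>(1) by (intro conjI exI[of _ "\<lambda>c. inv \<kappa> c"]) auto
qed

lemma weighted_equiv_R: "weighted_equiv S R"
proof
  show "finite S" by (rule finite_S)
  fix x assume "x \<in> S"
  then have x: "snd x \<in> B" "tau (snd x) \<in> flat" by (auto simp: S_def flat_B_def)
  note tx = tau_colourings[OF x(1)]
  show "R x 1 x"
    unfolding R_def using x gauge_one[OF tx, of cil] sigma_one
    by (intro conjI exI[of _ "\<lambda>_. \<one>"]) (auto simp: iota_in)
  fix d y assume d: "R x d y"
  then show "R y (inverse d) x" by (rule R_sym)
  obtain \<kappa> where \<kappa>: "\<And>c. \<kappa> c \<in> carrier G" "tau (snd y) = gauge \<iota> cil H \<kappa> (tau (snd x))"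
    "d = sigma \<kappa> / lambda \<kappa>" and y: "snd y \<in> B"
    using d by (auto simp: R_def)
  show "d \<noteq> 0" using sigma_lambda(1,2)[OF \<kappa>(1)] \<kappa>(3) by simp
  show "y \<in> S" using gauge_flat[OF x(2) \<kappa>(1)] y \<kappa>(2) by (auto simp: S_def flat_B_def mem_Times_iff)
  fix e z assume "R y e z"
  then obtain \<mu> where \<mu>: "\<And>c. \<mu> c \<in> carrier G" "tau (snd z) = gauge \<iota> cil H \<mu> (tau (snd y))"
    "e = sigma \<mu> / lambda \<mu>" and z: "snd z \<in> B"
    by (auto simp: R_def)
  have "tau (snd z) = gauge \<iota> cil H (\<lambda>c. \<mu> c \<otimes> \<kappa> c) (tau (snd x))"
    unfolding \<mu>(2) \<kappa>(2) by (rule gauge_gauge[OF \<mu>(1) \<kappa>(1) tx])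
  moreover have "d * e = sigma (\<lambda>c. \<mu> c \<otimes> \<kappa> c) / lambda (\<lambda>c. \<mu> c \<otimes> \<kappa> c)"
    using sigma_lambda(3,4)[OF \<mu>(1) \<kappa>(1)] by (simp add: \<mu>(3) \<kappa>(3) mult.commute)
  ultimately show "R x (d * e) z"
    unfolding R_def using x z \<kappa>(1) \<mu>(1) by (intro conjI exI[of _ "\<lambda>c. \<mu> c \<otimes> \<kappa> c"]) auto
qed

text \<open>Gauge parameters in \<open>R\<close> are total functions, which suits pointwise
  products, whereas basis elements of the Hopf algebra of all cilia are extensional; both scalars
  see only values at cilia.\<close>

lemma sigma_restrict: "sigma (restrict \<kappa> C) = sigma \<kappa>" and lambda_restrict: "lambda (restrict \<kappa> C) = lambda \<kappa>"
proof -
  show "sigma (restrict \<kappa> C) = sigma \<kappa>"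
    unfolding sigma_def by (rule prod.cong[OF HOL.refl]) (use cil(1) in \<open>simp add: sources_def\<close>)
  show "lambda (restrict \<kappa> C) = lambda \<kappa>"
    unfolding lambda_def by (rule prod.cong[OF HOL.refl]) simp
qed

lemma tau_inj: "\<gamma> \<in> B \<Longrightarrow> \<gamma>' \<in> B \<Longrightarrow> tau \<gamma> = tau \<gamma>' \<Longrightarrow> \<gamma> = \<gamma>'"
  using bij_betw_imp_inj_on[OF tau_bij] by (rule inj_onD)

lemma tau_act_total:
  assumes "\<And>c. \<kappa> c \<in> carrier G" "\<gamma> \<in> B"
  shows "tau (act (restrict \<kappa> C) \<gamma>) = gauge \<iota> cil H (\<lambda>c. inv \<kappa> c) (tau \<gamma>)"
proof -
  have "restrict \<kappa> C \<in> cilia_basis G \<Gamma>" using assms(1) by (auto simp: cilia_basis_def)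
  then have "tau (act (restrict \<kappa> C) \<gamma>) = gauge \<iota> cil H (\<lambda>c. inv (restrict \<kappa> C) c) (tau \<gamma>)"
    by (rule tau_act[OF _ assms(2)])
  also have "\<dots> = gauge \<iota> cil H (\<lambda>c. inv \<kappa> c) (tau \<gamma>)"
    unfolding gauge_def using cil(1) iota_in by (intro restrict_ext) simp
  finally show ?thesis .
qed

lemma R_act:
  assumes "\<kappa> \<in> cilia_basis G \<Gamma>" "\<gamma> \<in> B"
  shows "R (u, act \<kappa> \<gamma>) (sigma \<kappa> / lambda \<kappa>) (u', \<gamma>)"
proof -
  define \<mu> where "\<mu> c = (if c \<in> C then \<kappa> c else \<one>)" for c
  have \<mu>: "\<mu> c \<in> carrier G" for c using assms(1) by (auto simp: \<mu>_def cilia_basis_def)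
  have \<kappa>: "restrict \<mu> C = \<kappa>"
    using assms(1) by (auto simp: \<mu>_def cilia_basis_def PiE_def extensional_def)
  have "tau \<gamma> = gauge \<iota> cil H \<mu> (tau (act \<kappa> \<gamma>))"
    using tau_act_total[of \<mu>, OF \<mu> assms(2)] gauge_inv(2)[OF tau_colourings[OF assms(2)], of \<mu>] \<mu>
    by (simp add: \<kappa>)
  moreover have "sigma \<kappa> = sigma \<mu>" "lambda \<kappa> = lambda \<mu>"
    using sigma_restrict[of \<mu>] lambda_restrict[of \<mu>] by (simp_all add: \<kappa>)
  ultimately show ?thesis
    unfolding R_def using assms act_in_B \<mu> by (intro conjI exI[of _ \<mu>]) simp_all
qed

lemma act_flat_B:
  assumes "\<kappa> \<in> cilia_basis G \<Gamma>" "\<gamma> \<in> flat_B"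
  shows "act \<kappa> \<gamma> \<in> flat_B"
proof -
  fix u :: "nat \<Rightarrow> unit"
  have "\<gamma> \<in> B" using assms(2) flat_B_subset by blast
  then have "R (u, \<gamma>) (inverse (sigma \<kappa> / lambda \<kappa>)) (u, act \<kappa> \<gamma>)"
    by (intro R_sym R_act assms(1))
  moreover have "(u, \<gamma>) \<in> S" using assms(2) by (simp add: S_def)
  ultimately have "(u, act \<kappa> \<gamma>) \<in> S" using weighted_equiv.stable[OF weighted_equiv_R] by blast
  then show ?thesis by (simp add: S_def)
qed

lemma act_bij:
  assumes \<kappa>: "\<kappa> \<in> cilia_basis G \<Gamma>"
  shows "bij_betw (act \<kappa>) flat_B flat_B"
proof -
  have "inj_on (act \<kappa>) flat_B"
  proof (rule inj_onI)
    fix \<gamma> \<gamma>' assume g: "\<gamma> \<in> flat_B" "\<gamma>' \<in> flat_B" "act \<kappa> \<gamma> = act \<kappa> \<gamma>'"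
    then have B: "\<gamma> \<in> B" "\<gamma>' \<in> B" using flat_B_subset by auto
    define \<mu> where "\<mu> c = (if c \<in> C then \<kappa> c else \<one>)" for c
    have \<mu>: "\<mu> c \<in> carrier G" for c using \<kappa> by (auto simp: \<mu>_def cilia_basis_def)
    have r: "restrict \<mu> C = \<kappa>"
      using \<kappa> by (auto simp: \<mu>_def cilia_basis_def PiE_def extensional_def)
    have "tau \<gamma> = gauge \<iota> cil H \<mu> (tau (act \<kappa> \<gamma>))" if "\<gamma> \<in> B" for \<gamma>
      using tau_act_total[of \<mu>, OF \<mu> that] gauge_inv(2)[OF tau_colourings[OF that], of \<mu>] \<mu> by (simp add: r)
    then show "\<gamma> = \<gamma>'" using tau_inj B g(3) by metis
  qed
  moreover have "act \<kappa> ` flat_B \<subseteq> flat_B" using act_flat_B[OF \<kappa>] by blast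
  ultimately show ?thesis
    unfolding bij_betw_def using endo_inj_surj[OF finite_subset[OF flat_B_subset finite_B]] by blast
qed

abbreviation "W \<equiv> tensor_relations (cilia_basis G \<Gamma>) X N"

lemma R_in_W:
  assumes "R x d y"
  shows "single x - fscale d (single y) \<in> W"
proof -
  obtain \<kappa> where \<kappa>: "\<And>c. \<kappa> c \<in> carrier G" "tau (snd y) = gauge \<iota> cil H \<kappa> (tau (snd x))"
    "d = sigma \<kappa> / lambda \<kappa>" and B: "snd x \<in> B" "snd y \<in> B"
    using assms by (auto simp: R_def)
  define u \<gamma> \<gamma>' where "u = fst x" and "\<gamma> = snd x" and "\<gamma>' = snd y"
  then have xy: "x = (u, \<gamma>)" "y = (u, \<gamma>')" using unit_fun_eq[of "fst y" u] by (simp_all add: prod_eq_iff)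
  define \<mu> where "\<mu> = restrict \<kappa> C"
  have \<mu>: "\<mu> \<in> cilia_basis G \<Gamma>" "sigma \<mu> = sigma \<kappa>" "lambda \<mu> = lambda \<kappa>"
    using \<kappa>(1) by (auto simp: \<mu>_def cilia_basis_def sigma_restrict lambda_restrict)
  have act: "act \<mu> \<gamma>'' = \<gamma> \<longleftrightarrow> \<gamma>'' = \<gamma>'" if g: "\<gamma>'' \<in> B" for \<gamma>''
  proof -
    have t: "tau (act \<mu> \<gamma>'') = gauge \<iota> cil H (\<lambda>c. inv \<kappa> c) (tau \<gamma>'')"
      unfolding \<mu>_def by (rule tau_act_total[OF \<kappa>(1) g])
    show ?thesis
    proof
      assume "act \<mu> \<gamma>'' = \<gamma>"
      then have "tau \<gamma>' = tau \<gamma>''"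
        using \<kappa>(2) t gauge_inv(2)[OF tau_colourings[OF g] \<kappa>(1)] by (simp add: xy)
      then show "\<gamma>'' = \<gamma>'" using tau_inj g B by (simp add: xy)
    next
      assume "\<gamma>'' = \<gamma>'"
      then have "tau (act \<mu> \<gamma>'') = tau \<gamma>"
        using \<kappa>(2) t gauge_inv(1)[OF tau_colourings[OF B(1)] \<kappa>(1)] by (simp add: xy)
      then show "act \<mu> \<gamma>'' = \<gamma>" using tau_inj act_in_B[OF \<mu>(1) g] B by (simp add: xy)
    qed
  qed
  have basis_sum: "(\<Sum>\<kappa>'\<in>cilia_basis G \<Gamma>. (single \<mu> \<kappa>' :: 'k) * f \<kappa>') = f \<mu>" for f
  proof -
    have "(\<Sum>\<kappa>'\<in>cilia_basis G \<Gamma>. (single \<mu> \<kappa>' :: 'k) * f \<kappa>') =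
        (\<Sum>\<kappa>'\<in>cilia_basis G \<Gamma>. if \<kappa>' = \<mu> then f \<mu> else 0)"
      by (intro sum.cong HOL.refl) (simp add: single_def)
    then show ?thesis using finite_cilia_basis \<mu>(1) by simp
  qed
  have sm: "(single \<mu> :: _ \<Rightarrow> 'k) \<in> free_vs (cilia_basis G \<Gamma>)" using \<mu>(1) by (rule single_in_free_vs)
  have sg: "(single \<gamma> :: _ \<Rightarrow> 'k) \<in> free_vs B" using B(1) by (intro single_in_free_vs) (simp add: xy)
  \<comment> \<open>For basis vectors the defining generator of \<open>W\<close> is the wanted
    difference up to the invertible factor \<open>lambda \<mu>\<close>.\<close>
  have "tensor (ract X (single u) (single \<mu>)) (single \<gamma>) - tensor (single u) (lact N (single \<mu>) (single \<gamma>))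
      = fscale (lambda \<mu>) (single x - fscale d (single y))"
  proof
    fix z :: "(nat \<Rightarrow> unit) \<times> (nat set \<Rightarrow> 'a)"
    define \<gamma>'' where "\<gamma>'' = snd z"
    then have z: "z = (u, \<gamma>'')" using unit_fun_eq[of "fst z" u] by (simp add: prod_eq_iff)
    have u: "(single u :: (nat \<Rightarrow> unit) \<Rightarrow> 'k) u = 1" by (simp add: single_def)
    have l: "lambda \<mu> * (d * a) = sigma \<mu> * a" for a
      using sigma_lambda(2)[OF \<kappa>(1)] by (simp add: \<kappa>(3) \<mu>)
    have "lact N (single \<mu>) (single \<gamma>) \<gamma>'' = sigma \<mu> * single \<gamma>' \<gamma>''"
    proof -
      have "lact N (single \<mu>) (single \<gamma>) \<gamma>'' = (if \<gamma>'' \<in> B then sigma \<mu> * single \<gamma> (act \<mu> \<gamma>'') else 0)"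
        by (simp only: lact_eq[OF sm sg] basis_sum)
      then show ?thesis using act[of \<gamma>''] B(2) by (auto simp: single_def xy)
    qed
    then show "(tensor (ract X (single u) (single \<mu>)) (single \<gamma>) -
        tensor (single u) (lact N (single \<mu>) (single \<gamma>))) z =
      fscale (lambda \<mu>) (single x - fscale d (single y)) z"
      by (simp add: z tensor_def ract_X[OF sm] basis_sum u xy right_diff_distrib l)
        (simp add: single_def)
  qed
  then have "fscale (lambda \<mu>) (single x - fscale d (single y)) \<in> W"
    unfolding tensor_relations_def rbasis_X lbasis_N using sm sg single_in_free_vs[of u UNIV]
    by (intro fv.span_base CollectI exI[of _ "single u"] exI[of _ "single \<mu>"] exI[of _ "single \<gamma>"] conjI) auto
  then have "fscale (inverse (lambda \<mu>)) (fscale (lambda \<mu>) (single x - fscale d (single y))) \<in> W"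
    unfolding tensor_relations_def by (rule fv.span_scale)
  then show ?thesis using sigma_lambda(2)[OF \<kappa>(1)] by (simp add: \<mu>)
qed

text \<open>A generator may involve vectors that are not flat, but \<open>w\<close> vanishes off
  \<open>S\<close> and each \<open>act \<kappa>\<close> permutes the flat configurations.
  Substituting along this permutation makes the two halves of the generator cancel.\<close>

lemma W_killed:
  assumes w: "\<And>x. x \<notin> S \<Longrightarrow> w x = 0" "\<And>x d y. x \<in> S \<Longrightarrow> R x d y \<Longrightarrow> w x = d * w y" and v: "v \<in> W"
  shows "(\<Sum>x\<in>S. v x * w x) = 0"
  using v unfolding tensor_relations_def
proof (induction rule: fv.span_induct)
  case base
  show ?case by (rule fv.subspaceI) (auto simp: algebra_simps sum.distrib simp flip: sum_distrib_left)
next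
  case (step y)
  then obtain x a n where y: "y = tensor (ract X x a) n - tensor x (lact N a n)"
    and a: "a \<in> free_vs (cilia_basis G \<Gamma>)" and n: "n \<in> free_vs B"
    by (auto simp: lbasis_N)
  let ?K = "cilia_basis G \<Gamma>"
  \<comment> \<open>For one group element \<open>\<kappa>\<close>, the transformation rule of
    \<open>w\<close> trades \<open>lambda \<kappa>\<close> for \<open>sigma \<kappa>\<close> after
    the substitution.\<close>
  have zero: "(\<Sum>\<gamma>\<in>flat_B. w (u, \<gamma>) * (lambda \<kappa> * n \<gamma> - sigma \<kappa> * n (act \<kappa> \<gamma>))) = 0" if \<kappa>: "\<kappa> \<in> ?K" for u \<kappa>
  proof -
    have "lambda \<kappa> \<noteq> 0"
      unfolding lambda_def using \<kappa> chr_nonzero cilia(2) by (auto simp: cilia_basis_def)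
    then have wa: "lambda \<kappa> * w (u, act \<kappa> \<gamma>) = sigma \<kappa> * w (u, \<gamma>)" if "\<gamma> \<in> flat_B" for \<gamma>
      using w(2)[OF _ R_act[OF \<kappa>, of \<gamma> u u]] act_flat_B[OF \<kappa> that] that flat_B_subset
      by (auto simp: S_def)
    have "(\<Sum>\<gamma>\<in>flat_B. w (u, \<gamma>) * (lambda \<kappa> * n \<gamma>)) = (\<Sum>\<gamma>\<in>flat_B. w (u, act \<kappa> \<gamma>) * (lambda \<kappa> * n (act \<kappa> \<gamma>)))"
      by (rule sum.reindex_bij_betw[OF act_bij[OF \<kappa>], symmetric])
    also have "\<dots> = (\<Sum>\<gamma>\<in>flat_B. w (u, \<gamma>) * (sigma \<kappa> * n (act \<kappa> \<gamma>)))"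
    proof (rule sum.cong[OF HOL.refl])
      fix \<gamma> assume "\<gamma> \<in> flat_B"
      then have "lambda \<kappa> * w (u, act \<kappa> \<gamma>) * n (act \<kappa> \<gamma>) = sigma \<kappa> * w (u, \<gamma>) * n (act \<kappa> \<gamma>)"
        by (simp only: wa)
      then show "w (u, act \<kappa> \<gamma>) * (lambda \<kappa> * n (act \<kappa> \<gamma>)) = w (u, \<gamma>) * (sigma \<kappa> * n (act \<kappa> \<gamma>))"
        by (simp add: mult_ac)
    qed
    finally show ?thesis by (simp add: right_diff_distrib sum_subtractf)
  qed
  have val: "y (u, \<gamma>) = (\<Sum>\<kappa>\<in>?K. a \<kappa> * x u * (lambda \<kappa> * n \<gamma> - sigma \<kappa> * n (act \<kappa> \<gamma>)))"
    if "\<gamma> \<in> flat_B" for u \<gamma>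
  proof -
    have "\<gamma> \<in> B" using that flat_B_subset by blast
    then have "y (u, \<gamma>) = (\<Sum>\<kappa>\<in>?K. a \<kappa> * (lambda \<kappa> * x u)) * n \<gamma> -
        x u * (\<Sum>\<kappa>\<in>?K. a \<kappa> * (sigma \<kappa> * n (act \<kappa> \<gamma>)))"
      by (simp add: y tensor_def ract_X[OF a] lact_eq[OF a n])
    also have "\<dots> = (\<Sum>\<kappa>\<in>?K. a \<kappa> * (lambda \<kappa> * x u) * n \<gamma> - x u * (a \<kappa> * (sigma \<kappa> * n (act \<kappa> \<gamma>))))"
      by (simp only: sum_distrib_left sum_distrib_right sum_subtractf)
    finally show ?thesis by (simp add: right_diff_distrib mult_ac)
  qed
  have "(\<Sum>x\<in>S. y x * w x) = (\<Sum>u\<in>UNIV. \<Sum>\<gamma>\<in>flat_B. y (u, \<gamma>) * w (u, \<gamma>))"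
    unfolding S_def by (rule sum.cartesian_product')
  also have "\<dots> = (\<Sum>u\<in>UNIV. \<Sum>\<gamma>\<in>flat_B. \<Sum>\<kappa>\<in>?K. a \<kappa> * x u * (w (u, \<gamma>) * (lambda \<kappa> * n \<gamma> - sigma \<kappa> * n (act \<kappa> \<gamma>))))"
  proof (intro sum.cong HOL.refl)
    fix u \<gamma> assume "\<gamma> \<in> flat_B"
    then show "y (u, \<gamma>) * w (u, \<gamma>) =
        (\<Sum>\<kappa>\<in>?K. a \<kappa> * x u * (w (u, \<gamma>) * (lambda \<kappa> * n \<gamma> - sigma \<kappa> * n (act \<kappa> \<gamma>))))"
      by (simp only: val sum_distrib_right) (simp only: mult_ac)
  qed
  also have "\<dots> = (\<Sum>u\<in>UNIV. \<Sum>\<kappa>\<in>?K. \<Sum>\<gamma>\<in>flat_B. a \<kappa> * x u * (w (u, \<gamma>) * (lambda \<kappa> * n \<gamma> - sigma \<kappa> * n (act \<kappa> \<gamma>))))"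
    by (rule sum.cong[OF HOL.refl]) (rule sum.swap)
  also have "\<dots> = 0"
  proof (rule sum.neutral, rule ballI, rule sum.neutral, rule ballI)
    fix u \<kappa> assume "\<kappa> \<in> ?K"
    then show "(\<Sum>\<gamma>\<in>flat_B. a \<kappa> * x u * (w (u, \<gamma>) * (lambda \<kappa> * n \<gamma> - sigma \<kappa> * n (act \<kappa> \<gamma>)))) = 0"
      unfolding sum_distrib_left[symmetric] by (simp only: zero mult_zero_right)
  qed
  finally show ?case .
qed

lemma Prot_isomorphic:
  "linearly_isomorphic (Bit (cilia_basis G \<Gamma>) X N) (subspace_vs (free_vs (weighted_equiv.good_classes S R)))"
  unfolding Bit_def cotensor_eq
proof (rule weighted_equiv.coinvariants_isomorphic[OF weighted_equiv_R])
  show "fv.subspace W" by (simp add: tensor_relations_def)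
  show "single x - fscale d (single y) \<in> W" if "x \<in> S" "R x d y" for x d y
    using that(2) by (rule R_in_W)
  show "(\<Sum>x\<in>S. v x * w x) = 0"
    if "\<And>x. x \<notin> S \<Longrightarrow> w x = 0" "\<And>x d y. x \<in> S \<Longrightarrow> R x d y \<Longrightarrow> w x = d * w y" "v \<in> W" for w v
    using that by (rule W_killed)
qed

section \<open>Comparison of the good orbits on both sides\<close>

sublocale surf: surface_rep G g "p [^] (2 * g)" \<chi>
proof
  show "\<chi> \<in> algebra_maps G" by (rule chi)
  show "central (p [^] (2 * g))" by (rule central_nat_pow[OF p_central])
  show "p [^] (2 * g) = \<one>" if "g = 0" using that by simp
qed

abbreviation "T \<equiv> surf_homs g (p [^] (2 * g))"

text \<open>
  Vertices and faces are both counted by cilia, so the Euler characteristic is 2|C| - |E|; moreover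
  every edge has exactly one target.
\<close>

lemma sum_expo: "(\<Sum>c\<in>C. expo c) = int (2 * g)"
proof -
  have "H - sources = (\<Union>c\<in>C. set (word c) - sources)" using H_eq_words by blast
  then have "card (edges \<Gamma>) = (\<Sum>c\<in>C. card (set (word c) - sources))"
    unfolding card_targets[symmetric]
    using disjoint_words cilia(2) by (subst card_UN_disjoint[symmetric]) auto
  moreover have "(\<Sum>c\<in>C. if c = pt \<Gamma> then 0 else 2 :: int) = 2 * (int (card C) - 1)"
  proof -
    have "(\<Sum>c\<in>C. if c = pt \<Gamma> then 0 else 2 :: int) = (\<Sum>c\<in>C - {pt \<Gamma>}. 2)"
      using cilia(2,3) by (simp add: sum.remove[of C "pt \<Gamma>"])
    moreover have "card C > 0" using cilia(2,3) card_gt_0_iff by blast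
    ultimately show ?thesis using cilia(2,3) by (simp add: card_Diff_singleton of_nat_diff)
  qed
  moreover have "int (card (edges \<Gamma>)) + 2 = 2 * int g + 2 * int (card C)"
    using arg_cong[OF genus_eq[OF genus], of int] by simp
  ultimately show ?thesis by (simp add: expo_def sum_subtractf of_nat_sum[symmetric] del: of_nat_sum)
qed

text \<open>The normal form uses the constraints of all faces except the one at the distinguished
  cilium. That last constraint is imposed afterwards and becomes a condition on the product of
  commutators, in which the exponents of all faces add up.\<close>

lemma flat_normal_form:
  "\<exists>\<Phi>. \<Phi> ` flat = {hs \<in> handles g. comms hs = p [^] (2 * g)} \<and>
    (\<forall>\<kappa>. (\<forall>c. \<kappa> c \<in> carrier G) \<longrightarrow> (\<forall>\<tau>\<in>flat.
      \<Phi> (gauge \<iota> cil H \<kappa> \<tau>) = map (conj (\<kappa> (pt \<Gamma>))) (\<Phi> \<tau>))) \<and>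
    (\<forall>\<tau>\<in>flat. \<forall>\<tau>'\<in>flat. \<Phi> \<tau> = \<Phi> \<tau>' \<longrightarrow>
      (\<exists>\<kappa>. (\<forall>c. \<kappa> c \<in> carrier G) \<and> \<kappa> (pt \<Gamma>) = \<one> \<and> \<tau>' = gauge \<iota> cil H \<kappa> \<tau>))"
proof -
  define A where "A = constrained \<iota> H (C - {pt \<Gamma>}) word (\<lambda>c. p [^] expo c)"
  let ?s = "sum expo (C - {pt \<Gamma>})"
  obtain n \<Phi> where nf:
    "card H + 2 = 4 * n + 2 * card (insert (pt \<Gamma>) (cil ` H)) + 2 * card (C - {pt \<Gamma>})"
    "\<Phi> ` A = handles n"
    "\<forall>\<tau>\<in>A. hol \<tau> (word (pt \<Gamma>)) \<otimes> p [^] ?s = comms (\<Phi> \<tau>)"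
    "\<forall>\<kappa>. (\<forall>c. \<kappa> c \<in> carrier G) \<longrightarrow> (\<forall>\<tau>\<in>A. \<Phi> (gauge \<iota> cil H \<kappa> \<tau>) = map (conj (\<kappa> (pt \<Gamma>))) (\<Phi> \<tau>))"
    "\<forall>\<tau>\<in>A. \<forall>\<tau>'\<in>A. \<Phi> \<tau> = \<Phi> \<tau>' \<longrightarrow>
      (\<exists>\<kappa>. (\<forall>c. \<kappa> c \<in> carrier G) \<and> \<kappa> (pt \<Gamma>) = \<one> \<and> \<tau>' = gauge \<iota> cil H \<kappa> \<tau>)"
    using polygons_normal_form[OF polygons p_central, of expo] unfolding A_def[symmetric] by (elim exE conjE)
  have "card C > 0" using cilia(2,3) card_gt_0_iff by blast
  \<comment> \<open>With |V| = |F| = |C| and \<open>card H\<close> = 2|E|, the count of the normal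
    form and the genus formula determine the same number of handles.\<close>
  then have n: "n = g"
    using nf(1) genus_eq[OF genus] card_H cilia(2,3) unfolding cil_image
    by (simp add: card_Diff_singleton)
  have flat_iff: "\<tau> \<in> flat \<longleftrightarrow> \<tau> \<in> A \<and> comms (\<Phi> \<tau>) = p [^] (2 * g)" for \<tau>
  proof -
    have "\<tau> \<in> flat \<longleftrightarrow> \<tau> \<in> A \<and> hol \<tau> (word (pt \<Gamma>)) = p [^] expo (pt \<Gamma>)"
      using cilia(3) by (auto simp: flat_def A_def constrained_def)
    also have "\<dots> \<longleftrightarrow> \<tau> \<in> A \<and> hol \<tau> (word (pt \<Gamma>)) \<otimes> p [^] ?s = p [^] expo (pt \<Gamma>) \<otimes> p [^] ?s"
    proof (rule conj_cong[OF HOL.refl])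
      assume "\<tau> \<in> A"
      then have "hol \<tau> (word (pt \<Gamma>)) \<in> carrier G"
        using hol_closed[OF _ word_in_H[OF cilia(3)], of \<tau> \<iota>] by (simp add: A_def constrained_def)
      then show "hol \<tau> (word (pt \<Gamma>)) = p [^] expo (pt \<Gamma>) \<longleftrightarrow>
          hol \<tau> (word (pt \<Gamma>)) \<otimes> p [^] ?s = p [^] expo (pt \<Gamma>) \<otimes> p [^] ?s"
        using p_closed by simp
    qed
    also have "p [^] expo (pt \<Gamma>) \<otimes> p [^] ?s = p [^] (\<Sum>c\<in>C. expo c)"
      using p_closed cilia(2,3) by (simp add: sum.remove[of C "pt \<Gamma>"] int_pow_mult)
    also have "\<dots> = p [^] (2 * g)" unfolding sum_expo int_pow_int ..
    finally show ?thesis using nf(3) by auto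
  qed
  show ?thesis
  proof (intro exI[of _ \<Phi>] conjI allI impI ballI)
    show "\<Phi> ` flat = {hs \<in> handles g. comms hs = p [^] (2 * g)}"
    proof (intro equalityI subsetI)
      fix hs assume "hs \<in> {hs \<in> handles g. comms hs = p [^] (2 * g)}"
      then have "hs \<in> \<Phi> ` A" "comms hs = p [^] (2 * g)" using nf(2) n by simp_all
      then obtain \<tau> where "\<tau> \<in> A" "hs = \<Phi> \<tau>" "comms (\<Phi> \<tau>) = p [^] (2 * g)" by blast
      then show "hs \<in> \<Phi> ` flat" using flat_iff by blast
    next
      fix hs assume "hs \<in> \<Phi> ` flat"
      then obtain \<tau> where "\<tau> \<in> A" "hs = \<Phi> \<tau>" "comms hs = p [^] (2 * g)" using flat_iff by blast
      then show "hs \<in> {hs \<in> handles g. comms hs = p [^] (2 * g)}" using nf(2) n by blast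
    qed
    show "\<Phi> (gauge \<iota> cil H \<kappa> \<tau>) = map (conj (\<kappa> (pt \<Gamma>))) (\<Phi> \<tau>)"
      if "\<forall>c. \<kappa> c \<in> carrier G" "\<tau> \<in> flat" for \<kappa> \<tau>
      using nf(4)[THEN spec, THEN mp, THEN bspec, OF that(1)] that(2) flat_iff by blast
    show "\<exists>\<kappa>. (\<forall>c. \<kappa> c \<in> carrier G) \<and> \<kappa> (pt \<Gamma>) = \<one> \<and> \<tau>' = gauge \<iota> cil H \<kappa> \<tau>"
      if "\<tau> \<in> flat" "\<tau>' \<in> flat" "\<Phi> \<tau> = \<Phi> \<tau>'" for \<tau> \<tau>'
      using nf(5)[THEN bspec, THEN bspec, THEN mp, of \<tau> \<tau>'] that flat_iff by blast
  qed
qed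

text \<open>
  Along an edge, a gauge transformation that fixes the colouring takes conjugate values, which the
  character does not distinguish. By connectedness its character is constant, so only the exponent
  |E| - 2(|C| - 1) = 2g matters.
\<close>

lemma stabilizer_weight:
  assumes \<tau>: "\<tau> \<in> colourings \<iota> H" and \<kappa>: "\<And>c. \<kappa> c \<in> carrier G" and fixed: "gauge \<iota> cil H \<kappa> \<tau> = \<tau>"
  shows "sigma \<kappa> / lambda \<kappa> = surf.wt (\<kappa> (pt \<Gamma>))"
proof -
  have pt: "pt \<Gamma> \<in> H" "cil (pt \<Gamma>) = pt \<Gamma>" using cilia cil_cilium by auto
  have const: "chr (\<kappa> (cil k)) = chr (\<kappa> (pt \<Gamma>))" if k: "k \<in> H" for k
  proof -
    have "chr (\<kappa> (cil k)) = chr (\<kappa> (cil (pt \<Gamma>)))"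
    proof (rule connected_invariant[OF _ _ k pt(1)])
      fix l assume l: "l \<in> H"
      note t = colourings_closed[OF \<tau> l]
      have "\<kappa> (cil (\<iota> l)) \<otimes> \<tau> l \<otimes> inv \<kappa> (cil l) = \<tau> l" using fun_cong[OF fixed, of l] l by (simp add: gauge_def)
      then have "chr (\<kappa> (cil (\<iota> l)) \<otimes> \<tau> l \<otimes> inv \<kappa> (cil l)) = chr (\<tau> l)" by simp
      then show "chr (\<kappa> (cil (\<iota> l))) = chr (\<kappa> (cil l))"
        using \<kappa> t chr_nonzero[OF t] chr_nonzero[OF \<kappa>, of "cil l"]
        by (simp add: chr_mult char_nonzero(2)[OF chi] field_simps)
      show "chr (\<kappa> (cil (\<rho> l))) = chr (\<kappa> (cil l))" using cil_rho[OF l] by simp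
    qed
    then show ?thesis by (simp add: pt)
  qed
  let ?x = "chr (\<kappa> (pt \<Gamma>))"
  have x: "?x \<noteq> 0" using chr_nonzero \<kappa> by blast
  have "sigma \<kappa> = ?x ^ card (edges \<Gamma>)"
    unfolding sigma_def card_sources[symmetric] using const by (simp add: sources_def)
  also have "card (edges \<Gamma>) = 2 * g + 2 * card (C - {pt \<Gamma>})"
  proof -
    have "card C > 0" using cilia(2,3) card_gt_0_iff by blast
    then show ?thesis using genus_eq[OF genus] cilia(2,3) by (simp add: card_Diff_singleton)
  qed
  finally have "sigma \<kappa> = surf.wt (\<kappa> (pt \<Gamma>)) * (?x ^ 2) ^ card (C - {pt \<Gamma>})"
    by (simp add: power_add power_mult)
  moreover have "lambda \<kappa> = (?x ^ 2) ^ card (C - {pt \<Gamma>})"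
  proof -
    have "chr (\<kappa> c) = ?x" if "c \<in> C" for c
      using const[of c] that cilia(1) cil_cilium[OF that] by auto
    then show ?thesis unfolding lambda_def by simp
  qed
  ultimately show ?thesis using x by simp
qed

text \<open>Gauge transformations trivial at the distinguished cilium disappear under the normal
  form, and the others act by conjugation with their value there. So orbits correspond, and
  stabilizers match up to elements whose weight \<open>stabilizer_weight\<close> controls.\<close>

lemma good_classes_R_Q:
  "linearly_isomorphic
    (subspace_vs (free_vs (weighted_equiv.good_classes S R)) :: ('k, _) module)
    (subspace_vs (free_vs (weighted_equiv.good_classes T surf.Q)))"
proof -
  obtain \<Phi> where \<Phi>: "\<Phi> ` flat = {hs \<in> handles g. comms hs = p [^] (2 * g)}"
    "\<And>\<kappa> \<tau>. (\<And>c. \<kappa> c \<in> carrier G) \<Longrightarrow> \<tau> \<in> flat \<Longrightarrow>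
      \<Phi> (gauge \<iota> cil H \<kappa> \<tau>) = map (conj (\<kappa> (pt \<Gamma>))) (\<Phi> \<tau>)"
    "\<And>\<tau> \<tau>'. \<tau> \<in> flat \<Longrightarrow> \<tau>' \<in> flat \<Longrightarrow> \<Phi> \<tau> = \<Phi> \<tau>' \<Longrightarrow>
      \<exists>\<kappa>. (\<forall>c. \<kappa> c \<in> carrier G) \<and> \<kappa> (pt \<Gamma>) = \<one> \<and> \<tau>' = gauge \<iota> cil H \<kappa> \<tau>"
    using flat_normal_form by (elim exE conjE) simp
  let ?HS = "{hs \<in> handles g. comms hs = p [^] (2 * g)}"
  have bij: "bij_betw (hom_handles g) T ?HS"
    by (rule hom_handles_bij[OF surf.q_central surf.q_genus_0])
  \<comment> \<open>Flat configurations and homomorphisms are both described by handle lists with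
    the same product of commutators; \<open>\<Psi>\<close> passes through these lists.\<close>
  define \<Psi> where "\<Psi> x = inv_into T (hom_handles g) (\<Phi> (tau (snd x)))" for x :: "(nat \<Rightarrow> unit) \<times> (nat set \<Rightarrow> 'a)"
  have S: "snd x \<in> B" "tau (snd x) \<in> flat" "tau (snd x) \<in> colourings \<iota> H" if "x \<in> S" for x
    using that by (auto simp: S_def flat_B_def flat_def)
  have \<Psi>: "\<Psi> x \<in> T" "hom_handles g (\<Psi> x) = \<Phi> (tau (snd x))" if "x \<in> S" for x
  proof -
    have "\<Phi> (tau (snd x)) \<in> hom_handles g ` T"
      using S(2)[OF that] \<Phi>(1) bij unfolding bij_betw_def by blast
    then show "\<Psi> x \<in> T" "hom_handles g (\<Psi> x) = \<Phi> (tau (snd x))"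
      unfolding \<Psi>_def by (rule inv_into_into, rule f_inv_into_f)
  qed
  have eqI: "f = f'" if "f \<in> T" "f' \<in> T" "hom_handles g f = hom_handles g f'" for f f'
    using bij that unfolding bij_betw_def inj_on_def by blast
  have equiv: "\<Psi> y = conj_hom g (\<kappa> (pt \<Gamma>)) (\<Psi> x)"
    if "x \<in> S" "y \<in> S" "\<And>c. \<kappa> c \<in> carrier G" "tau (snd y) = gauge \<iota> cil H \<kappa> (tau (snd x))" for x y \<kappa>
  proof (rule eqI[OF \<Psi>(1)[OF that(2)] surf.conj_T[OF that(3) \<Psi>(1)[OF that(1)]]])
    show "hom_handles g (\<Psi> y) = hom_handles g (conj_hom g (\<kappa> (pt \<Gamma>)) (\<Psi> x))"
      unfolding hom_handles_conj[OF that(3) surf_homs_Hom[OF \<Psi>(1)[OF that(1)]]] \<Psi>(2)[OF that(1)]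
        \<Psi>(2)[OF that(2)] that(4)
      by (rule \<Phi>(2)[OF that(3) S(2)[OF that(1)]])
  qed
  have lift: "\<exists>\<kappa>. (\<forall>c. \<kappa> c \<in> carrier G) \<and> \<kappa> (pt \<Gamma>) = h \<and> tau (snd y) = gauge \<iota> cil H \<kappa> (tau (snd x))"
    if x: "x \<in> S" and y: "y \<in> S" and h: "h \<in> carrier G" and eq: "\<Psi> y = conj_hom g h (\<Psi> x)" for x y h
  proof -
    \<comment> \<open>The constant gauge transformation \<open>h\<close> already gives the right
      handle list. What is left is corrected by a transformation trivial at the distinguished
      cilium, so the composite still has value \<open>h\<close> there.\<close>
    let ?\<sigma> = "gauge \<iota> cil H (\<lambda>_. h) (tau (snd x))"
    have "\<Phi> ?\<sigma> = map (conj h) (\<Phi> (tau (snd x)))" using \<Phi>(2)[of "\<lambda>_. h"] h S(2)[OF x] by simp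
    also have "\<dots> = \<Phi> (tau (snd y))"
      using hom_handles_conj[OF h surf_homs_Hom[OF \<Psi>(1)[OF x]]] \<Psi>(2)[OF x] \<Psi>(2)[OF y] eq by simp
    finally have eq: "\<Phi> ?\<sigma> = \<Phi> (tau (snd y))" .
    have "?\<sigma> \<in> flat" by (rule gauge_flat[OF S(2)[OF x] h])
    from \<Phi>(3)[OF this S(2)[OF y] eq] obtain \<kappa> where \<kappa>: "\<forall>c. \<kappa> c \<in> carrier G" "\<kappa> (pt \<Gamma>) = \<one>" "tau (snd y) = gauge \<iota> cil H \<kappa> ?\<sigma>"
      by blast
    have "tau (snd y) = gauge \<iota> cil H (\<lambda>c. \<kappa> c \<otimes> h) (tau (snd x))"
      unfolding \<kappa>(3) by (rule gauge_gauge[OF _ _ S(3)[OF x]]) (use \<kappa>(1) h in auto)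
    then show ?thesis using \<kappa>(1,2) h by (intro exI[of _ "\<lambda>c. \<kappa> c \<otimes> h"]) simp
  qed
  show ?thesis
  proof (rule good_classes_isomorphic[OF weighted_equiv_R surf.weighted_equiv_Q])
    show "\<Psi> ` S = T"
    proof (intro equalityI subsetI)
      fix f assume f: "f \<in> T"
      then have "hom_handles g f \<in> ?HS" using bij by (auto simp: bij_betw_def)
      then obtain \<tau> where t: "\<tau> \<in> flat" "hom_handles g f = \<Phi> \<tau>" using \<Phi>(1) by blast
      then have "\<tau> \<in> tau ` B" using bij_betw_imp_surj_on[OF tau_bij] by (simp add: flat_def)
      then obtain \<gamma> where \<gamma>: "\<gamma> \<in> B" "\<tau> = tau \<gamma>" by blast
      have x: "(\<lambda>_. (), \<gamma>) \<in> S" using \<gamma> t by (simp add: S_def flat_B_def)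
      then have "f = \<Psi> (\<lambda>_. (), \<gamma>)" using eqI[OF f \<Psi>(1)[OF x]] \<Psi>(2)[OF x] t(2) \<gamma>(2) by simp
      then show "f \<in> \<Psi> ` S" using x by blast
    qed (use \<Psi>(1) in auto)
  next
    fix x y assume xy: "x \<in> S" "y \<in> S"
    show "(\<exists>d. R x d y) \<longleftrightarrow> (\<exists>d. surf.Q (\<Psi> x) d (\<Psi> y))"
    proof
      assume "\<exists>d. R x d y"
      then obtain \<kappa> where "\<And>c. \<kappa> c \<in> carrier G" "tau (snd y) = gauge \<iota> cil H \<kappa> (tau (snd x))"
        by (auto simp: R_def)
      with equiv[OF xy this] show "\<exists>d. surf.Q (\<Psi> x) d (\<Psi> y)" unfolding surf.Q_def by blast
    next
      assume "\<exists>d. surf.Q (\<Psi> x) d (\<Psi> y)"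
      then obtain h where "h \<in> carrier G" "\<Psi> y = conj_hom g h (\<Psi> x)" unfolding surf.Q_def by blast
      from lift[OF xy this] show "\<exists>d. R x d y" unfolding R_def using S(1) xy by blast
    qed
  next
    fix x assume x: "x \<in> S"
    show "weighted_equiv.good R x \<longleftrightarrow> weighted_equiv.good surf.Q (\<Psi> x)"
      unfolding weighted_equiv.good_def[OF weighted_equiv_R] weighted_equiv.good_def[OF surf.weighted_equiv_Q]
    proof (intro iffI allI impI)
      fix d assume *: "\<forall>d. R x d x \<longrightarrow> d = 1" and "surf.Q (\<Psi> x) d (\<Psi> x)"
      then obtain h where h: "h \<in> carrier G" "\<Psi> x = conj_hom g h (\<Psi> x)" "d = surf.wt h"
        unfolding surf.Q_def by blast
      from lift[OF x x h(1,2)] obtain \<kappa> where \<kappa>: "\<forall>c. \<kappa> c \<in> carrier G" "\<kappa> (pt \<Gamma>) = h"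
        "tau (snd x) = gauge \<iota> cil H \<kappa> (tau (snd x))" by blast
      have "R x (sigma \<kappa> / lambda \<kappa>) x" unfolding R_def using S(1)[OF x] \<kappa>(1,3) by blast
      then have "sigma \<kappa> / lambda \<kappa> = 1" using * by blast
      then show "d = 1" using stabilizer_weight[OF S(3)[OF x], of \<kappa>] \<kappa> h(3) by simp
    next
      fix d assume *: "\<forall>d. surf.Q (\<Psi> x) d (\<Psi> x) \<longrightarrow> d = 1" and "R x d x"
      then obtain \<kappa> where \<kappa>: "\<And>c. \<kappa> c \<in> carrier G" "tau (snd x) = gauge \<iota> cil H \<kappa> (tau (snd x))"
        "d = sigma \<kappa> / lambda \<kappa>" by (auto simp: R_def)
      have "surf.Q (\<Psi> x) (surf.wt (\<kappa> (pt \<Gamma>))) (\<Psi> x)"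
        unfolding surf.Q_def using equiv[OF x x \<kappa>(1,2)] \<kappa>(1) by blast
      then show "d = 1" using * stabilizer_weight[OF S(3)[OF x] \<kappa>(1) \<kappa>(2)[symmetric]] \<kappa>(3) by simp
    qed
  qed
qed

lemma Prot_eq: "Prot G p \<chi> M \<Gamma> (one_dim (counit G) \<one> :: (unit, 'a, 'k) right_modcomod) =
    Bit (cilia_basis G \<Gamma>) X N"
  unfolding Prot_def Z_def ..

end

theorem proposition8p8:
  fixes G :: "('a, 'b) monoid_scheme" (structure)
    and p :: 'a
    and \<chi> :: "('a \<Rightarrow> 'k::field) \<Rightarrow> 'k"
    and \<zeta> :: 'k
    and M :: "('a, 'k) hopf_bimodule"
    and \<Gamma> :: "nat ciliated_graph"
    and g :: nat
  assumes "group G" and "finite (carrier G)"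
    and "\<Gamma> \<in> RK" and "genus \<Gamma> = of_nat g"
    and "pair_in_involution G p \<chi>"
    and "\<zeta>\<^sup>2 = \<chi> (single p)"
    and "M = induced_bimodule G p \<chi> \<zeta>"
  shows
    "let P = Prot G p \<chi> M \<Gamma> (one_dim (counit G) \<one> :: (unit, 'a, 'k) right_modcomod);
         \<Omega> = Omega G g :: (surf_gen word set \<Rightarrow> 'a, 'a, 'k) left_modcomod;
         V = graded_part (p [^] (2 * g)) \<Omega>;
         \<theta> = \<chi> [^]\<^bsub>char_group G\<^esub> (- 2 * int g)
     in linearly_isomorphic P (quot_image V (act_span \<Omega> (char_kernel G \<theta>) V)) \<and>
        (of_nat (card (carrier G)) \<noteq> (0::'k) \<longrightarrow>
         linearly_isomorphic P
           (subspace_vs {f \<in> V. \<forall>h\<in>carrier G. lact \<Omega> (single h) f = fscale (\<theta> (single h)) f}))"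
proof -
  interpret group G by (rule assms)
  interpret kitaev_genus G \<Gamma> p \<chi> \<zeta> M g
    by unfold_locales (use assms in \<open>auto simp: RK_def\<close>)
  \<comment> \<open>The common intermediate space: the protected space maps to it, and the quotient
    and the semi-invariants are both reached by inverting their identifications with it.\<close>
  let ?F = "subspace_vs (free_vs (weighted_equiv.good_classes T surf.Q)) :: ('k, _) module"
  have P: "linearly_isomorphic (Bit (cilia_basis G \<Gamma>) X N) ?F"
    by (rule linearly_isomorphic_trans[OF Prot_isomorphic good_classes_R_Q])
  let ?V = "graded_part (p [^] (2 * g)) (Omega G g) :: (_ \<Rightarrow> 'k) set"
  have V: "fv.subspace ?V" unfolding graded_part_Omega by (rule subspace_free_vs)
  have span: "fv.subspace (act_span (Omega G g) (char_kernel G surf.\<theta>) ?V)" by (simp add: act_span_def)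
  have Q: "linearly_isomorphic ?F (quot_image ?V (act_span (Omega G g) (char_kernel G surf.\<theta>) ?V))"
    by (rule linearly_isomorphic_sym[OF surf.coinvariants_Omega])
      (rule quot_image_closed[OF span V], assumption+)+
  let ?I = "{f \<in> ?V. \<forall>h\<in>carrier G. lact (Omega G g) (single h) f = fscale (surf.\<theta> (single h)) f}"
  have I: "linearly_isomorphic ?F (subspace_vs ?I)"
  proof (rule linearly_isomorphic_sym[OF surf.invariants_Omega])
    show "x \<oplus>\<^bsub>subspace_vs ?I\<^esub> y \<in> carrier (subspace_vs ?I)"
      if "x \<in> carrier (subspace_vs ?I)" "y \<in> carrier (subspace_vs ?I)" for x y
      using that fv.subspace_add[OF surf.subspace_invariants] by (simp add: subspace_vs_def)
    show "c \<odot>\<^bsub>subspace_vs ?I\<^esub> x \<in> carrier (subspace_vs ?I)"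
      if "x \<in> carrier (subspace_vs ?I)" for c x
      using that fv.subspace_scale[OF surf.subspace_invariants] by (simp add: subspace_vs_def)
  qed
  show ?thesis
    unfolding Let_def Prot_eq surf.\<theta>_def[symmetric]
    using linearly_isomorphic_trans[OF P Q] linearly_isomorphic_trans[OF P I] by blast
qed

end
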